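(* Let $\beta>0$. Then $$U_\beta(dx)=\eta_\beta\delta_0(dx)+\Bigl[\frac1{\mu_\beta}+\sum_{\rho\in\mathcal E_\beta}u_{\beta,\rho}(x)+\sum_{s\in\mathcal S_\beta}\frac{e^{sx}}{\phi_\beta'(s)}\Bigr]dx,$$ where the last series converges locally absolutely and uniformly for $x>0$. Equivalently, as an identity of meromorphic functions, $$\frac1{\phi_\beta(z)}=\eta_\beta+\frac1{\mu_\beta z}+\sum_{\rho\in\mathcal E_\beta}\mathcal P_{\beta,\rho}(z)+\sum_{s\in\mathcal S_\beta}\frac1{\phi_\beta'(s)(z-s)},$$ where the last series converges locally absolutely and uniformly on $\mathbb C\setminus\mathcal Z_\beta$. Consequently, for every $n\ge2$, $$\mathsf E D_n=\frac{h_{n-1}}{\mu_\beta}-\frac{\phi_\beta''(0)}{2\mu_\beta^2}-\sum_{\rho\in\mathcal E_\beta}\mathcal B_{\beta,\rho}(n)-\sum_{s\in\mathcal S_\beta}\frac{\Gamma(-s)\Gamma(n)}{\phi_\beta'(s)\Gamma(n-s)},$$ and the last series converges absolutely.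
   Context: $h_m=\sum_{r=1}^m1/r$ and $B(a,b)=\Gamma(a)\Gamma(b)/\Gamma(a+b)$. For $\beta>0$, $\phi_\beta$ is the meromorphic function on $\mathbb C$ given by $\phi_\beta(z)=B(\beta+2,\beta+1)-B(z+\beta+2,\beta+1)$; for $\operatorname{Re}z\ge0$ it equals $\int_0^1(1-s^z)s^{\beta+1}(1-s)^\beta\,ds$. Put $\mu_\beta=\phi_\beta'(0)$ and $\eta_\beta=B(\beta+2,\beta+1)^{-1}=\lim_{a\to\infty}1/\phi_\beta(a)$. Let $\xi$ be the subordinator with $\mathsf E e^{-z\xi_t}=e^{-t\phi_\beta(z)}$, $\operatorname{Re}z\ge0$; its potential measure is $U_\beta(dx)=\int_0^\infty\mathsf P(\xi_t\in dx)\,dt$, so $\int_{[0,\infty)}e^{-zx}U_\beta(dx)=1/\phi_\beta(z)$ for $\operatorname{Re}z>0$. Zeros: $\mathcal Z_\beta$ is the set of distinct nonzero zeros of $\phi_\beta$ (all have negative real part). For $\rho\in\mathcal Z_\beta$ let $m_\rho$ be its multiplicity and let $$\mathcal P_{\beta,\rho}(z)=\sum_{\ell=1}^{m_\rho}\frac{c_{\rho,\ell}}{(z-\rho)^\ell}$$ be the principal part of $1/\phi_\beta$ at $\rho$. For $x>0$ and $n\ge2$, $$u_{\beta,\rho}(x)=e^{\rho x}\sum_{\ell=1}^{m_\rho}c_{\rho,\ell}\frac{x^{\ell-1}}{(\ell-1)!},\qquad \mathcal B_{\beta,\rho}(n)=\sum_{\ell=1}^{m_\rho}\frac{c_{\rho,\ell}}{(\ell-1)!}\frac{\partial^{\ell-1}}{\partial\rho^{\ell-1}}B(-\rho,n).$$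 Let $\mathcal E_\beta=\{\rho\in\mathcal Z_\beta:\rho\notin\mathbb R\text{ or }m_\rho>1\}$ (a finite set) and $\mathcal S_\beta=\mathcal Z_\beta\setminus\mathcal E_\beta$ (so its elements are real simple zeros). Continuous-time beta-splitting tree on $n$ leaves: a continuous-time Markov chain $\Pi_n$ on partitions of $[n]=\{1,\dots,n\}$ started from the one-block partition, in which different blocks evolve independently, singletons are absorbing, and a block containing $m\ge2$ labels waits an exponential time of rate $\phi_\beta(m-1)$ and then splits into an ordered pair of nonempty blocks; the first has size $i$, $1\le i\le m-1$, with probability $q_\beta(m,i)=\frac{1}{2\phi_\beta(m-1)}\binom mi B(i+\beta+1,m-i+\beta+1)$, and, given $i$, the set of labels of the first block is uniform among subsets of size $i$. $D_n$ is the continuous height of a uniformly chosen leaf, i.e. the first time at which a uniformly chosen label of $[n]$ is a singleton block. *)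

theory Defs
  imports "HOL-Complex_Analysis.Complex_Analysis" "HOL-Probability.Probability"
begin

section \<open>The Laplace exponent and its zeros\<close>

text \<open>
  \<^const>\<open>Gamma\<close> and division are total, so a bare \<^const>\<open>Beta\<close> takes junk values at the poles of
  either Gamma factor. For integral \<open>\<beta>\<close> poles of numerator and denominator cancel, and the value there
  must be the limit; for odd integral \<open>\<beta>\<close> the zero \<open>z = - 3 * \<beta> - 4\<close> would be lost otherwise.
  \<^const>\<open>remove_sings\<close> yields the limit at all removable singularities and 0 at the poles, so that
  \<open>1 / phi \<beta> z = 0\<close> at a pole \<open>z\<close> of \<open>phi \<beta>\<close>, the correct value of the meromorphic function \<open>1 / \<phi>\<close>.
\<close>

definition phi :: "real \<Rightarrow> complex \<Rightarrow> complex" where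
  "phi \<beta> = remove_sings (\<lambda>z. Beta (of_real \<beta> + 2) (of_real \<beta> + 1)
                              - Beta (z + of_real \<beta> + 2) (of_real \<beta> + 1))"

definition mu :: "real \<Rightarrow> complex" where
  "mu \<beta> = deriv (phi \<beta>) 0"

definition eta :: "real \<Rightarrow> real" where
  "eta \<beta> = 1 / Beta (\<beta> + 2) (\<beta> + 1)"

text \<open>The poles have to be excluded explicitly, as \<^const>\<open>phi\<close> takes the value 0 there.\<close>

definition zeros :: "real \<Rightarrow> complex set" where
  "zeros \<beta> = {\<rho>. \<rho> \<noteq> 0 \<and> \<not> is_pole (phi \<beta>) \<rho> \<and> phi \<beta> \<rho> = 0}"

definition mult :: "real \<Rightarrow> complex \<Rightarrow> nat" where
  "mult \<beta> \<rho> = nat (zorder (phi \<beta>) \<rho>)"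

definition pp_coeff :: "real \<Rightarrow> complex \<Rightarrow> nat \<Rightarrow> complex" where
  "pp_coeff \<beta> \<rho> l = fls_nth (laurent_expansion (\<lambda>z. 1 / phi \<beta> z) \<rho>) (- int l)"

definition principal_part :: "real \<Rightarrow> complex \<Rightarrow> complex \<Rightarrow> complex" where
  "principal_part \<beta> \<rho> z = (\<Sum>l=1..mult \<beta> \<rho>. pp_coeff \<beta> \<rho> l / (z - \<rho>) ^ l)"

definition u_term :: "real \<Rightarrow> complex \<Rightarrow> real \<Rightarrow> complex" where
  "u_term \<beta> \<rho> x =
     exp (\<rho> * of_real x) * (\<Sum>l=1..mult \<beta> \<rho>. pp_coeff \<beta> \<rho> l * of_real x ^ (l - 1) / fact (l - 1))"

definition B_term :: "real \<Rightarrow> complex \<Rightarrow> nat \<Rightarrow> complex" where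
  "B_term \<beta> \<rho> n =
     (\<Sum>l=1..mult \<beta> \<rho>. pp_coeff \<beta> \<rho> l / fact (l - 1)
                        * (deriv ^^ (l - 1)) (\<lambda>r. Beta (- r) (of_nat n)) \<rho>)"

definition exc_zeros :: "real \<Rightarrow> complex set" where
  "exc_zeros \<beta> = {\<rho> \<in> zeros \<beta>. \<rho> \<notin> \<real> \<or> mult \<beta> \<rho> > 1}"

definition simple_zeros :: "real \<Rightarrow> complex set" where
  "simple_zeros \<beta> = zeros \<beta> - exc_zeros \<beta>"

text \<open>The index set carries no enumeration; convergence is along the finite subsets.\<close>

definition locally_abs_unif_convergent ::
    "('s \<Rightarrow> 'x::topological_space \<Rightarrow> complex) \<Rightarrow> 's set \<Rightarrow> 'x set \<Rightarrow> bool" where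
  "locally_abs_unif_convergent f S D \<longleftrightarrow>
     (\<forall>x\<in>D. \<exists>V. open V \<and> x \<in> V \<and>
        (\<forall>y\<in>V \<inter> D. (\<lambda>s. norm (f s y)) summable_on S) \<and>
        uniform_limit (V \<inter> D) (\<lambda>F y. \<Sum>s\<in>F. f s y) (\<lambda>y. \<Sum>\<^sub>\<infinity>s\<in>S. f s y)
          (finite_subsets_at_top S))"

definition potential_density :: "real \<Rightarrow> real \<Rightarrow> complex" where
  "potential_density \<beta> x =
     1 / mu \<beta> + (\<Sum>\<rho>\<in>exc_zeros \<beta>. u_term \<beta> \<rho> x)
     + (\<Sum>\<^sub>\<infinity>s\<in>simple_zeros \<beta>. exp (s * of_real x) / deriv (phi \<beta>) s)"


section \<open>Subordinators\<close>

definition subordinator :: "'a measure \<Rightarrow> (real \<Rightarrow> 'a \<Rightarrow> real) \<Rightarrow> bool" where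
  "subordinator M \<xi> \<longleftrightarrow>
     prob_space M \<and>
     (\<forall>t\<ge>0. \<xi> t \<in> borel_measurable M) \<and>
     (AE \<omega> in M. \<xi> 0 \<omega> = 0 \<and> mono_on {0..} (\<lambda>t. \<xi> t \<omega>) \<and>
                 (\<forall>t\<ge>0. continuous (at_right t) (\<lambda>t. \<xi> t \<omega>))) \<and>
     (\<forall>k t. 0 \<le> t 0 \<and> (\<forall>i<k. t i \<le> t (Suc i)) \<longrightarrow>
        prob_space.indep_vars M (\<lambda>_. borel) (\<lambda>i \<omega>. \<xi> (t (Suc i)) \<omega> - \<xi> (t i) \<omega>) {..<k::nat}) \<and>
     (\<forall>s\<ge>0. \<forall>t\<ge>0. distr M borel (\<lambda>\<omega>. \<xi> (s + t) \<omega> - \<xi> s \<omega>) = distr M borel (\<xi> t))"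

definition has_laplace_exponent ::
    "'a measure \<Rightarrow> (real \<Rightarrow> 'a \<Rightarrow> real) \<Rightarrow> (complex \<Rightarrow> complex) \<Rightarrow> bool" where
  "has_laplace_exponent M \<xi> f \<longleftrightarrow>
     (\<forall>t\<ge>0. \<forall>z. Re z \<ge> 0 \<longrightarrow>
        (LINT \<omega>|M. exp (- z * of_real (\<xi> t \<omega>))) = exp (- of_real t * f z))"

definition potential :: "'a measure \<Rightarrow> (real \<Rightarrow> 'a \<Rightarrow> real) \<Rightarrow> real set \<Rightarrow> ennreal" where
  "potential M \<xi> A = (\<integral>\<^sup>+t\<in>{0..}. emeasure M {\<omega> \<in> space M. \<xi> t \<omega> \<in> A} \<partial>lborel)"


section \<open>Continuous-time Markov chains on a finite state space\<close>

definition transition_semigroup ::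
    "'s set \<Rightarrow> ('s \<Rightarrow> 's \<Rightarrow> real) \<Rightarrow> (real \<Rightarrow> 's \<Rightarrow> 's \<Rightarrow> real) \<Rightarrow> bool" where
  "transition_semigroup S Q p \<longleftrightarrow>
     (\<forall>t\<ge>0. \<forall>x\<in>S. (\<forall>y\<in>S. 0 \<le> p t x y) \<and> (\<Sum>y\<in>S. p t x y) = 1) \<and>
     (\<forall>x\<in>S. \<forall>y\<in>S. p 0 x y = of_bool (x = y)) \<and>
     (\<forall>s\<ge>0. \<forall>t\<ge>0. \<forall>x\<in>S. \<forall>y\<in>S. p (s + t) x y = (\<Sum>z\<in>S. p s x z * p t z y)) \<and>
     (\<forall>x\<in>S. \<forall>y\<in>S. ((\<lambda>t. p t x y) has_real_derivative Q x y) (at_right 0))"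

definition markov_chain ::
    "'a measure \<Rightarrow> 's set \<Rightarrow> ('s \<Rightarrow> 's \<Rightarrow> real) \<Rightarrow> 's \<Rightarrow> (real \<Rightarrow> 'a \<Rightarrow> 's) \<Rightarrow> bool" where
  "markov_chain M S Q x0 X \<longleftrightarrow>
     prob_space M \<and> finite S \<and>
     (\<forall>t\<ge>0. X t \<in> measurable M (count_space S)) \<and>
     (AE \<omega> in M. X 0 \<omega> = x0) \<and>
     (AE \<omega> in M. \<forall>t\<ge>0. \<forall>\<^sub>F s in at_right t. X s \<omega> = X t \<omega>) \<and>
     (\<exists>p. transition_semigroup S Q p \<and>
        (\<forall>k t x. 0 \<le> t 0 \<and> (\<forall>i<k. t i \<le> t (Suc i)) \<and> (\<forall>i\<le>k. x i \<in> S) \<longrightarrow>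
           measure M {\<omega> \<in> space M. \<forall>i\<le>k::nat. X (t i) \<omega> = x i} =
           measure M {\<omega> \<in> space M. X (t 0) \<omega> = x 0} *
             (\<Prod>i<k. p (t (Suc i) - t i) (x i) (x (Suc i)))))"


section \<open>The beta-splitting tree\<close>

definition split_prob :: "real \<Rightarrow> nat \<Rightarrow> nat \<Rightarrow> real" where
  "split_prob \<beta> m i =
     1 / (2 * Re (phi \<beta> (of_nat (m - 1)))) * real (m choose i)
       * Beta (real i + \<beta> + 1) (real (m - i) + \<beta> + 1)"

text \<open>
  The rate at which block \<open>b\<close> splits into the ordered pair \<open>(a, b - a)\<close>: the rate of the waiting time,
  times the probability of the size of \<open>a\<close>, times the uniform probability of \<open>a\<close> given its size.
\<close>

definition split_rate :: "real \<Rightarrow> 'l set \<Rightarrow> 'l set \<Rightarrow> real" where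
  "split_rate \<beta> b a =
     Re (phi \<beta> (of_nat (card b - 1))) * split_prob \<beta> (card b) (card a) / real (card b choose card a)"

text \<open>
  Independent evolution of the blocks means that the generators of the blocks add up. Each possible
  splitting of a block contributes its rate to the entry of the resulting partition and subtracts it
  from the diagonal entry; \<open>(a, b - a)\<close> and \<open>(b - a, a)\<close> lead to the same partition and both count.
\<close>

definition splitting_gen :: "real \<Rightarrow> 'l set set \<Rightarrow> 'l set set \<Rightarrow> real" where
  "splitting_gen \<beta> P P' =
     (\<Sum>b\<in>{b \<in> P. card b \<ge> 2}. \<Sum>a\<in>{a. a \<subset> b \<and> a \<noteq> {}}.
        split_rate \<beta> b a * (of_bool (P' = insert a (insert (b - a) (P - {b}))) - of_bool (P' = P)))"

definition beta_splitting_tree ::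
    "real \<Rightarrow> nat \<Rightarrow> 'b measure \<Rightarrow> (real \<Rightarrow> 'b \<Rightarrow> nat set set) \<Rightarrow> bool" where
  "beta_splitting_tree \<beta> n N X \<longleftrightarrow>
     markov_chain N {P. partition_on {1..n} P} (splitting_gen \<beta>) {{1..n}} X"

text \<open>A uniform label, chosen independently of the whole tree.\<close>

definition uniform_label ::
    "nat \<Rightarrow> 'b measure \<Rightarrow> (real \<Rightarrow> 'b \<Rightarrow> nat set set) \<Rightarrow> ('b \<Rightarrow> nat) \<Rightarrow> bool" where
  "uniform_label n N X L \<longleftrightarrow>
     L \<in> measurable N (count_space {1..n}) \<and>
     distr N (count_space {1..n}) L = uniform_count_measure {1..n} \<and>
     prob_space.indep_set N
       {L -` A \<inter> space N | A. A \<in> sets (count_space {1..n})}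
       {(\<lambda>\<omega>. \<lambda>t\<in>{0..}. X t \<omega>) -` A \<inter> space N | A.
          A \<in> sets (PiM {0..} (\<lambda>_. count_space {P. partition_on {1..n} P}))}"

definition leaf_height :: "(real \<Rightarrow> 'b \<Rightarrow> nat set set) \<Rightarrow> ('b \<Rightarrow> nat) \<Rightarrow> 'b \<Rightarrow> ennreal" where
  "leaf_height X L \<omega> = Inf {ennreal t | t. t \<ge> 0 \<and> {L \<omega>} \<in> X t \<omega>}"

end

theory Submission
  imports Defs "HOL-Real_Asymp.Real_Asymp"
begin

text \<open>
  Put \<open>C = B(\<beta> + 2, \<beta> + 1)\<close> and \<open>G z = B(z + \<beta> + 2, \<beta> + 1)\<close>, so
  that \<open>\<phi> = C - G\<close>. Expanding \<open>(1 - s) powr \<beta>\<close> binomially under the Beta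
  integral writes \<open>G\<close> as a sum of simple fractions \<open>a k / (z + \<beta> + 2 + k)\<close> with
  \<open>a k = (-1)^k (\<beta> gchoose k)\<close>. As \<open>a k\<close> decays like
  \<open>k powr (- \<beta> - 1)\<close>, positivity of \<open>\<beta>\<close> makes the residues absolutely
  summable, and everything rests on this: such a sum tends to 0 as \<open>z\<close> goes to infinity with its
  distance to the poles bounded below (\<open>cauchy_sum_small_at_infinity\<close>).

  Zeros. Far out, a zero of \<open>\<phi>\<close> must be close to some pole \<open>p\<close>, and there
  \<open>\<phi> z * (z - p)\<close> is a small perturbation of \<open>C * (z - p) - a k\<close>. Hence there is at
  most one zero near \<open>p\<close>; it is simple, it is real because zeros come in conjugate pairs, and
  \<open>1 / \<phi>'\<close> is there at most \<open>2 / C^2\<close> times \<open>\<bar>a k\<bar>\<close>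
  (\<open>zeros_far\<close>). So only finitely many zeros are exceptional, and the residues of
  \<open>1 / \<phi>\<close> at the others are absolutely summable.

  Partial fractions. The difference of the two sides of the claimed expansion has only removable singularities,
  and on circles halfway between consecutive poles each of its terms is small, because there \<open>\<phi>\<close>
  is close to \<open>C\<close>. By the maximum modulus principle the difference vanishes
  (\<open>partial_fractions\<close>).

  Potential measure. The proposed density is the termwise inverse Laplace transform of
  \<open>1 / \<phi> - 1 / C\<close>. It is nonnegative: \<open>G\<close> is the Laplace transform of a nonnegative
  function, so its values at the positive integers form a completely monotone sequence, the geometric series
  passes this on to \<open>1 / (C - G) - 1 / C\<close>, and Bernstein polynomials turn complete monotonicity of
  the moments of a continuous function into nonnegativity (\<open>nonneg_of_cm_laplace\<close>). The potential
  measure has the same exponential moments as the measure with this density and the atom \<open>1 / C\<close>, and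
  exponential moments determine a measure on the half-line (\<open>measure_eqI_tilted_exp_moments\<close>).

  Leaf height. The beta-binomial identities show that
  \<open>h (n + 1) = (\<Sum>k=1..n. (-1)^(k+1) (n choose k) / \<phi> k)\<close>, applied to the size of the block
  that contains a fixed label, is sent by the generator to \<open>-1\<close> as long as this block is not a
  singleton (\<open>splitting_gen_expected_height\<close>). Integrating this along the semigroup gives the mean
  time until the label is isolated, so the mean height of a leaf is \<open>h n\<close>. Inserting the partial
  fractions of \<open>1 / \<phi>\<close> and summing with
  \<open>(\<Sum>k\<le>n. (-1)^k (n choose k) / (k + x)) = B(x, n + 1)\<close> yields the last formula; the
  constant term is the value of \<open>1 / \<phi> z - 1 / (\<mu> z)\<close> at 0.
\<close>

section \<open>Cauchy sums with absolutely summable residues\<close>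

definition cauchy_sum :: "('i \<Rightarrow> complex) \<Rightarrow> ('i \<Rightarrow> complex) \<Rightarrow> 'i set \<Rightarrow> complex \<Rightarrow> complex" where
  "cauchy_sum c q I z = (\<Sum>\<^sub>\<infinity>i\<in>I. c i / (z - q i))"

lemma cauchy_term_bound:
  fixes c :: complex
  assumes "0 < \<delta>" "\<delta> \<le> norm (z - w)"
  shows "norm (c / (z - w)) \<le> norm c / \<delta>"
  using assms by (simp add: norm_divide frac_le)

lemma cauchy_sum_abs_summable:
  fixes c q :: "'i \<Rightarrow> complex"
  assumes "(\<lambda>i. norm (c i)) summable_on I" "0 < \<delta>" "\<And>i. i \<in> I \<Longrightarrow> \<delta> \<le> norm (z - q i)"
  shows "(\<lambda>i. norm (c i / (z - q i))) summable_on I"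
proof (rule summable_on_comparison_test)
  show "(\<lambda>i. norm (c i) / \<delta>) summable_on I"
    using summable_on_cmult_left[OF assms(1), of "inverse \<delta>"] by (simp add: field_simps)
qed (use assms cauchy_term_bound in auto)

lemma cauchy_sum_uniform_limit:
  assumes "(\<lambda>i. norm (c i)) summable_on I" "0 < \<delta>" "\<And>z i. z \<in> A \<Longrightarrow> i \<in> I \<Longrightarrow> \<delta> \<le> norm (z - q i)"
  shows "uniform_limit A (\<lambda>F z. \<Sum>i\<in>F. c i / (z - q i)) (cauchy_sum c q I) (finite_subsets_at_top I)"
  unfolding cauchy_sum_def
proof (rule Weierstrass_m_test_general)
  show "(\<lambda>i. norm (c i) / \<delta>) summable_on I"
    using summable_on_cmult_left[OF assms(1), of "inverse \<delta>"] by (simp add: field_simps)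
qed (use assms cauchy_term_bound in auto)

text \<open>
  The uniform distance to all poles is what turns absolute summability of the residues into locally uniform
  convergence.
\<close>

lemma poles_avoiding_ball:
  assumes "open D" "\<And>i. i \<in> I \<Longrightarrow> q i \<notin> D" "z \<in> (D :: complex set)"
  obtains \<delta> where "0 < \<delta>" "cball z \<delta> \<subseteq> D" "\<And>w i. w \<in> cball z \<delta> \<Longrightarrow> i \<in> I \<Longrightarrow> \<delta> \<le> norm (w - q i)"
proof -
  obtain e where e: "0 < e" "cball z e \<subseteq> D"
    using assms open_contains_cball by metis
  have "e / 2 \<le> norm (w - q i)" if w: "w \<in> cball z (e/2)" and i: "i \<in> I" for w i
  proof -
    have "q i \<notin> cball z e" using assms(2)[OF i] e by auto
    then have "e < dist z (q i)" by simp
    also have "\<dots> \<le> dist z w + dist w (q i)" by (rule dist_triangle)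
    finally show ?thesis using w by (simp add: dist_norm)
  qed
  moreover have "cball z (e/2) \<subseteq> D" using e by auto
  ultimately show thesis using that[of "e/2"] e by auto
qed

lemma cauchy_sum_holomorphic:
  assumes "(\<lambda>i. norm (c i)) summable_on I" "open D" "\<And>i. i \<in> I \<Longrightarrow> q i \<notin> D"
  shows "cauchy_sum c q I holomorphic_on D"
proof -
  have "\<exists>\<delta>>0. cauchy_sum c q I holomorphic_on ball z \<delta>" if z: "z \<in> D" for z
  proof -
    obtain \<delta> where \<delta>: "0 < \<delta>" "cball z \<delta> \<subseteq> D" "\<And>w i. w \<in> cball z \<delta> \<Longrightarrow> i \<in> I \<Longrightarrow> \<delta> \<le> norm (w - q i)"
      using poles_avoiding_ball[of D I q z, OF assms(2,3) z] by metis
    have hol: "(\<lambda>z. \<Sum>i\<in>F. c i / (z - q i)) holomorphic_on cball z \<delta>" if "F \<subseteq> I" for F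
      using \<delta>(1) \<delta>(3)[of "q i" i for i] that by (intro holomorphic_intros) auto
    have "\<forall>\<^sub>F F in finite_subsets_at_top I. continuous_on (cball z \<delta>) (\<lambda>z. \<Sum>i\<in>F. c i / (z - q i)) \<and>
             (\<lambda>z. \<Sum>i\<in>F. c i / (z - q i)) holomorphic_on ball z \<delta>"
      using holomorphic_on_imp_continuous_on[OF hol] holomorphic_on_subset[OF hol ball_subset_cball]
      by (intro eventually_finite_subsets_at_top_weakI) auto
    then have "cauchy_sum c q I holomorphic_on ball z \<delta>"
      using cauchy_sum_uniform_limit[OF assms(1) \<delta>(1,3), where A = "cball z \<delta>"]
      by (rule holomorphic_uniform_limit) auto
    then show ?thesis using \<delta> by auto
  qed
  then have "cauchy_sum c q I analytic_on D"
    unfolding analytic_on_def by blast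
  then show ?thesis by (rule analytic_imp_holomorphic)
qed

lemma cauchy_sum_locally_abs_unif_convergent:
  assumes "(\<lambda>i. norm (c i)) summable_on I" "open D" "\<And>i. i \<in> I \<Longrightarrow> q i \<notin> D"
  shows "locally_abs_unif_convergent (\<lambda>i z. c i / (z - q i)) I D"
  unfolding locally_abs_unif_convergent_def
proof
  fix z assume z: "z \<in> D"
  obtain \<delta> where \<delta>: "0 < \<delta>" "cball z \<delta> \<subseteq> D" "\<And>w i. w \<in> cball z \<delta> \<Longrightarrow> i \<in> I \<Longrightarrow> \<delta> \<le> norm (w - q i)"
    using poles_avoiding_ball[of D I q z, OF assms(2,3) z] by metis
  have b: "\<delta> \<le> norm (w - q i)" if "w \<in> ball z \<delta> \<inter> D" "i \<in> I" for w i
    using \<delta>(3)[of w i] that by auto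
  show "\<exists>V. open V \<and> z \<in> V \<and> (\<forall>y\<in>V \<inter> D. (\<lambda>s. norm (c s / (y - q s))) summable_on I) \<and>
     uniform_limit (V \<inter> D) (\<lambda>F y. \<Sum>s\<in>F. c s / (y - q s)) (\<lambda>y. \<Sum>\<^sub>\<infinity>s\<in>I. c s / (y - q s)) (finite_subsets_at_top I)"
    using \<delta>(1) cauchy_sum_abs_summable[OF assms(1) \<delta>(1) b]
      cauchy_sum_uniform_limit[OF assms(1) \<delta>(1) b, where A = "ball z \<delta> \<inter> D"]
    unfolding cauchy_sum_def by (intro exI[of _ "ball z \<delta>"]) auto
qed

text \<open>
  Finitely many terms carry all but a small part of the residues and decay as \<open>z\<close> grows; the
  remaining terms are controlled by the distance \<open>\<delta>\<close> to the poles. The radius does not depend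
  on the subset \<open>J\<close>, so that poles can be left out depending on \<open>z\<close>.
\<close>

lemma cauchy_sum_small_at_infinity:
  assumes c: "(\<lambda>i. norm (c i)) summable_on I" and \<epsilon>: "0 < \<epsilon>" and \<delta>: "0 < \<delta>"
  shows "\<exists>R. \<forall>J z. J \<subseteq> I \<longrightarrow> R \<le> norm z \<longrightarrow> (\<forall>i\<in>J. \<delta> \<le> norm (z - q i)) \<longrightarrow> norm (cauchy_sum c q J z) < \<epsilon>"
proof -
  obtain F where F: "finite F" "F \<subseteq> I" and tail: "dist (\<Sum>i\<in>F. norm (c i)) (\<Sum>\<^sub>\<infinity>i\<in>I. norm (c i)) \<le> \<epsilon> * \<delta> / 4"
    using infsum_finite_approximation[OF c, of "\<epsilon> * \<delta> / 4"] \<epsilon> \<delta> by auto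
  define S where "S = (\<Sum>i\<in>F. norm (c i))"
  define M where "M = (\<Sum>i\<in>F. norm (q i))"
  have S: "0 \<le> S" unfolding S_def by (simp add: sum_nonneg)
  have M: "norm (q i) \<le> M" if "i \<in> F" for i
    unfolding M_def using F(1) that by (intro member_le_sum) auto
  have "(\<Sum>\<^sub>\<infinity>i\<in>I. norm (c i)) = S + (\<Sum>\<^sub>\<infinity>i\<in>I-F. norm (c i))"
    unfolding S_def using infsum_Un_disjoint[of "\<lambda>i. norm (c i)" F "I - F"] F c
    by (simp add: summable_on_subset_banach[OF c] Un_absorb1)
  with tail have tail': "(\<Sum>\<^sub>\<infinity>i\<in>I-F. norm (c i)) \<le> \<epsilon> * \<delta> / 4"
    unfolding S_def[symmetric] by (simp add: dist_real_def)
  show ?thesis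
  proof (intro exI[of _ "M + 4 * (S + 1) / \<epsilon>"] allI impI)
    fix J z assume J: "J \<subseteq> I" and z: "M + 4 * (S + 1) / \<epsilon> \<le> norm z" and far: "\<forall>i\<in>J. \<delta> \<le> norm (z - q i)"
    have cJ: "(\<lambda>i. norm (c i)) summable_on K" if "K \<subseteq> I" for K
      by (rule summable_on_subset_banach[OF c that])
    have sJ: "(\<lambda>i. norm (c i / (z - q i))) summable_on K" if "K \<subseteq> J" for K
      by (rule cauchy_sum_abs_summable[OF cJ \<delta>]) (use that far J in auto)
    have "norm (cauchy_sum c q J z) \<le> (\<Sum>\<^sub>\<infinity>i\<in>J. norm (c i / (z - q i)))"
      unfolding cauchy_sum_def by (rule norm_infsum_bound) (rule sJ, simp)
    also have "\<dots> = (\<Sum>i\<in>J \<inter> F. norm (c i / (z - q i))) + (\<Sum>\<^sub>\<infinity>i\<in>J-F. norm (c i / (z - q i)))"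
      using infsum_Un_disjoint[of "\<lambda>i. norm (c i / (z - q i))" "J \<inter> F" "J - F"] F sJ[of "J-F"]
      by (simp add: Int_Diff_Un Int_Diff_disjoint)
    also have "(\<Sum>i\<in>J \<inter> F. norm (c i / (z - q i))) \<le> (\<Sum>i\<in>J\<inter>F. norm (c i) / (4 * (S + 1) / \<epsilon>))"
    proof (rule sum_mono, rule cauchy_term_bound)
      fix i assume "i \<in> J \<inter> F"
      then have "norm z \<le> norm (z - q i) + M"
        using M[of i] norm_triangle_sub[of z "q i"] by auto
      then show "4 * (S + 1) / \<epsilon> \<le> norm (z - q i)" using z by auto
    qed (use S \<epsilon> in auto)
    also have "\<dots> \<le> S / (4 * (S + 1) / \<epsilon>)"
      unfolding S_def sum_divide_distrib[symmetric] using F S \<epsilon>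
      by (intro divide_right_mono sum_mono2) (auto simp: S_def[symmetric])
    also have "\<dots> \<le> \<epsilon> / 4"
      using S \<epsilon> by (simp add: field_simps)
    also have "(\<Sum>\<^sub>\<infinity>i\<in>J-F. norm (c i / (z - q i))) \<le> (\<Sum>\<^sub>\<infinity>i\<in>J-F. norm (c i) / \<delta>)"
      using J far \<delta> summable_on_cmult_left[OF cJ[of "J - F"], of "inverse \<delta>"]
      by (intro infsum_mono sJ cauchy_term_bound) (auto simp: field_simps)
    also have "\<dots> = (\<Sum>\<^sub>\<infinity>i\<in>J-F. norm (c i)) / \<delta>"
      using infsum_cmult_left'[of "\<lambda>i. norm (c i)" "inverse \<delta>" "J - F"] by (simp add: field_simps)
    also have "(\<Sum>\<^sub>\<infinity>i\<in>J-F. norm (c i)) / \<delta> \<le> (\<epsilon> * \<delta> / 4) / \<delta>"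
    proof (rule divide_right_mono)
      have "(\<Sum>\<^sub>\<infinity>i\<in>J-F. norm (c i)) \<le> (\<Sum>\<^sub>\<infinity>i\<in>I-F. norm (c i))"
        using J by (intro infsum_mono2 cJ) auto
      with tail' show "(\<Sum>\<^sub>\<infinity>i\<in>J-F. norm (c i)) \<le> \<epsilon> * \<delta> / 4" by linarith
    qed (use \<delta> in auto)
    finally show "norm (cauchy_sum c q J z) < \<epsilon>"
      using \<epsilon> \<delta> by simp
  qed
qed

lemma cauchy_sum_split:
  assumes "(\<lambda>i. norm (c i)) summable_on I" "0 < \<delta>" "\<And>i. i \<in> I - {k} \<Longrightarrow> \<delta> \<le> norm (z - q i)" "k \<in> I"
  shows "cauchy_sum c q I z = c k / (z - q k) + cauchy_sum c q (I - {k}) z"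
proof -
  have "(\<lambda>i. norm (c i / (z - q i))) summable_on (I - {k})"
    by (rule cauchy_sum_abs_summable[OF summable_on_subset_banach[OF assms(1)] assms(2,3)]) auto
  then have "(\<lambda>i. c i / (z - q i)) summable_on (I - {k})"
    by (rule abs_summable_summable)
  then have "(\<Sum>\<^sub>\<infinity>i\<in>{k} \<union> (I - {k}). c i / (z - q i)) = c k / (z - q k) + cauchy_sum c q (I - {k}) z"
    unfolding cauchy_sum_def by (subst infsum_Un_disjoint) auto
  then show ?thesis using assms(4) unfolding cauchy_sum_def by (simp add: insert_absorb)
qed

section \<open>Laplace transforms of exponential sums\<close>

lemma tendsto_power_times_exp_at_top:
  assumes "Re r < 0"
  shows "((\<lambda>x. of_real x ^ n * exp (r * of_real x)) \<longlongrightarrow> 0) at_top"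
proof (rule tendsto_norm_zero_cancel)
  have "((\<lambda>x. x ^ n * exp (Re r * x)) \<longlongrightarrow> 0) at_top"
    using assms by real_asymp
  then show "((\<lambda>x. norm (of_real x ^ n * exp (r * of_real x))) \<longlongrightarrow> 0) at_top"
    by (rule Lim_transform_eventually)
      (auto intro!: eventually_mono[OF eventually_ge_at_top[of 0]] simp: norm_mult norm_power)
qed

lemma power_times_exp_integrable:
  assumes "Re r < 0"
  shows "set_integrable lborel {0<..} (\<lambda>x. of_real x ^ n * exp (r * of_real x))"
proof -
  define \<kappa> where "\<kappa> = - Re r"
  have \<kappa>: "\<kappa> > 0" using assms by (simp add: \<kappa>_def)
  have "set_integrable lborel {0<..} (\<lambda>x. x ^ n * exp (- (\<kappa> * x)))"
  proof -
    have "(\<integral>\<^sup>+x. ennreal (erlang_density n \<kappa> x) \<partial>lborel) = 1"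
      using \<kappa> nn_integral_erlang_ith_moment[of \<kappa> n 0] by simp
    then have "integrable lborel (erlang_density n \<kappa>)"
      using \<kappa> by (intro integrableI_nonneg) (auto simp: erlang_density_def)
    then have "integrable lborel (\<lambda>x. fact n / \<kappa> ^ (n+1) * erlang_density n \<kappa> x)"
      by (rule integrable_mult_right)
    then have "set_integrable lborel {0<..} (\<lambda>x. fact n / \<kappa> ^ (n+1) * erlang_density n \<kappa> x)"
      unfolding set_integrable_def by (intro integrable_mult_indicator) auto
    then show ?thesis
      by (rule iffD1[OF set_integrable_cong, rotated -1]) (use \<kappa> in \<open>auto simp: erlang_density_def\<close>)
  qed
  then show ?thesis
    by (rule set_integrable_bound)
      (auto simp: set_borel_measurable_def norm_mult norm_power \<kappa>_def)
qed

text \<open>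
  Induction by parts: the derivative of \<open>x^m * exp (r x)\<close> integrates to its boundary values.
\<close>

lemma laplace_power:
  assumes "Re r < 0"
  shows "(LBINT x:{0<..}. of_real x ^ n * exp (r * of_real x)) = fact n / (- r) ^ Suc n"
proof (induction n)
  have r0: "r \<noteq> 0" using assms by auto
  have ftc: "(LBINT x:{0<..}. of_nat m * of_real x ^ (m - 1) * exp (r * of_real x) + r * (of_real x ^ m * exp (r * of_real x))) = 0 - 0 ^ m"
    for m
  proof -
    let ?F = "\<lambda>x::real. of_real x ^ m * exp (r * of_real x)"
    let ?f = "\<lambda>x::real. of_nat m * of_real x ^ (m - 1) * exp (r * of_real x) + r * (of_real x ^ m * exp (r * of_real x))"
    have int: "set_integrable lborel {0<..} ?f"
      using power_times_exp_integrable[OF assms, of "m - 1"] power_times_exp_integrable[OF assms, of m]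
      by (intro set_integral_add set_integrable_mult_right) (auto simp: mult.assoc)
    have "(LBINT x=0..\<infinity>. ?f x) = 0 - 0 ^ m"
    proof (rule interval_integral_FTC_integrable)
      show "(?F has_vector_derivative ?f x) (at x)" for x
        by (rule derivative_eq_intros refl | simp add: field_simps)+
          (auto intro!: derivative_eq_intros has_vector_derivative_real_field simp: algebra_simps)
      show "isCont ?f x" for x by (intro continuous_intros)
      show "set_integrable lborel (einterval 0 \<infinity>) ?f"
        using int by (simp add: zero_ereal_def)
      have "(?F \<longlongrightarrow> 0 ^ m) (at_right 0)"
        by (auto intro!: tendsto_eq_intros)
      then show "((?F \<circ> real_of_ereal) \<longlongrightarrow> 0 ^ m) (at_right 0)"
        unfolding zero_ereal_def ereal_tendsto_simps1 by (simp add: o_def)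
      show "((?F \<circ> real_of_ereal) \<longlongrightarrow> 0) (at_left \<infinity>)"
        unfolding ereal_tendsto_simps1 using tendsto_power_times_exp_at_top[OF assms] by simp
    qed simp
    then show ?thesis by (simp add: interval_lebesgue_integral_0_infty)
  qed
  {
    case 0
    show ?case using ftc[of 0] r0 by (simp add: field_simps eq_neg_iff_add_eq_0)
  next
    case (Suc n)
    have "0 = (LBINT x:{0<..}. of_nat (Suc n) * (of_real x ^ n * exp (r * of_real x)) + r * (of_real x ^ Suc n * exp (r * of_real x)))"
      using ftc[of "Suc n"] by (simp add: mult.assoc del: of_nat_Suc power_Suc)
    also have "\<dots> = (LBINT x:{0<..}. of_nat (Suc n) * (of_real x ^ n * exp (r * of_real x))) + (LBINT x:{0<..}. r * (of_real x ^ Suc n * exp (r * of_real x)))"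
      by (intro set_integral_add set_integrable_mult_right power_times_exp_integrable assms)
    also have "\<dots> = of_nat (Suc n) * (fact n / (- r) ^ Suc n) + r * (LBINT x:{0<..}. of_real x ^ Suc n * exp (r * of_real x))"
      using Suc by (simp del: of_nat_Suc power_Suc)
    finally show ?case using r0 by (simp add: field_simps eq_neg_iff_add_eq_0)
  }
qed

text \<open>
  The gap \<open>\<kappa>\<close> leaves, after dividing the sum by \<open>exp (- \<kappa> x)\<close>, a series
  that converges uniformly on the whole half-line; the integrable factor \<open>exp (- \<kappa> x)\<close> then
  justifies termwise integration.
\<close>

lemma exp_sum_properties:
  fixes c r :: "'i \<Rightarrow> complex"
  assumes c: "(\<lambda>i. norm (c i)) summable_on I" and \<kappa>: "0 < \<kappa>" and r: "\<And>i. i \<in> I \<Longrightarrow> Re (r i) \<le> - \<kappa>"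
  defines "f \<equiv> \<lambda>x::real. \<Sum>\<^sub>\<infinity>i\<in>I. c i * exp (r i * of_real x)"
  shows "set_integrable lborel {0<..} f"
    and "(LBINT x:{0<..}. f x) = (\<Sum>\<^sub>\<infinity>i\<in>I. c i / (- r i))"
proof -
  \<comment> \<open>All exponents of \<open>g\<close> still have nonpositive real part.\<close>
  define g where "g x = (\<Sum>\<^sub>\<infinity>i\<in>I. c i * exp ((r i + of_real \<kappa>) * of_real x))" for x :: real
  have term_le: "norm (c i * exp ((r i + of_real \<kappa>) * of_real x)) \<le> norm (c i)" if "i \<in> I" "x \<in> {0..}" for i x
  proof -
    have "(Re (r i) + \<kappa>) * x \<le> 0" using r[OF that(1)] that(2) by (intro mult_nonpos_nonneg) auto
    then show ?thesis by (simp add: norm_mult mult_left_le)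
  qed
  have unif: "uniform_limit {0..} (\<lambda>F x. \<Sum>i\<in>F. c i * exp ((r i + of_real \<kappa>) * of_real x)) g (finite_subsets_at_top I)"
    unfolding g_def by (rule Weierstrass_m_test_general[OF term_le c])
  have cont_g: "continuous_on {0..} g"
    by (rule uniform_limit_theorem[OF _ unif]) (auto intro!: always_eventually continuous_intros)
  have fg: "f x = exp (- (\<kappa> * x)) * g x" for x
    unfolding f_def g_def
    by (subst infsum_cmult_right'[symmetric]) (simp add: exp_of_real[symmetric] exp_add[symmetric] algebra_simps del: exp_of_real)
  have g_le: "norm (g x) \<le> (\<Sum>\<^sub>\<infinity>i\<in>I. norm (c i))" if "x > 0" for x
  proof -
    have "(\<lambda>i. norm (c i * exp ((r i + of_real \<kappa>) * of_real x))) summable_on I"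
      by (rule summable_on_comparison_test[OF c]) (use term_le that in auto)
    then show ?thesis
      using order_trans[OF norm_infsum_bound infsum_mono[OF _ c]] term_le that unfolding g_def by force
  qed
  have int_exp: "set_integrable lborel {0<..} (\<lambda>x. C * exp (- (\<kappa> * x)))" for C :: complex
    using set_integrable_mult_right[OF power_times_exp_integrable[of "- of_real \<kappa>" 0], of C] \<kappa> by (simp add: exp_of_real[symmetric] del: exp_of_real)
  have "continuous_on {0<..} f"
    unfolding fg by (intro continuous_intros continuous_on_subset[OF cont_g]) auto
  then have meas: "set_borel_measurable lborel {0<..} f"
    unfolding set_borel_measurable_def by (simp add: borel_measurable_continuous_on_indicator)
  show int: "set_integrable lborel {0<..} f"
  proof (rule set_integrable_bound[OF int_exp[of "of_real (\<Sum>\<^sub>\<infinity>i\<in>I. norm (c i))"] meas], intro AE_I2 impI)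
    fix x :: real assume "x \<in> {0<..}"
    then show "norm (f x) \<le> norm (of_real (\<Sum>\<^sub>\<infinity>i\<in>I. norm (c i)) * complex_of_real (exp (- (\<kappa> * x))))"
      using g_le[of x] infsum_nonneg[of I "\<lambda>i. norm (c i)"] unfolding fg by (simp add: norm_mult mult.commute)
  qed
  have fin: "set_integrable lborel {0<..} (\<lambda>x. \<Sum>i\<in>F. c i * exp (r i * of_real x)) \<and>
      (LBINT x:{0<..}. \<Sum>i\<in>F. c i * exp (r i * of_real x)) = (\<Sum>i\<in>F. c i / (- r i))"
    if "finite F" "F \<subseteq> I" for F
    using that
  proof (induction F rule: finite_induct)
    case (insert i F)
    have ri: "Re (r i) < 0" using r[of i] \<kappa> insert.prems by auto
    have *: "set_integrable lborel {0<..} (\<lambda>x. c i * exp (r i * of_real x))"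
      using set_integrable_mult_right[OF power_times_exp_integrable[OF ri, of 0], of "c i"] by simp
    have "set_integrable lborel {0<..} (\<lambda>x. \<Sum>i\<in>F. c i * exp (r i * of_real x))"
      using insert by auto
    then show ?case
      using insert laplace_power[OF ri, of 0] * by (simp add: set_integral_add)
  qed (auto simp: set_integrable_def set_lebesgue_integral_def)
  have "((\<lambda>F. \<Sum>i\<in>F. c i / (- r i)) \<longlongrightarrow> (LBINT x:{0<..}. f x)) (finite_subsets_at_top I)"
  proof (rule tendstoI)
    fix e :: real assume e: "0 < e"
    have "\<forall>\<^sub>F F in finite_subsets_at_top I. \<forall>x\<in>{0..}. dist (\<Sum>i\<in>F. c i * exp ((r i + of_real \<kappa>) * of_real x)) (g x) < e * \<kappa> / 2"
      using uniform_limitD[OF unif, of "e * \<kappa> / 2"] e \<kappa> by auto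
    moreover have "\<forall>\<^sub>F F in finite_subsets_at_top I. finite F \<and> F \<subseteq> I"
      by (rule eventually_finite_subsets_at_top_weakI) auto
    ultimately show "\<forall>\<^sub>F F in finite_subsets_at_top I. dist (\<Sum>i\<in>F. c i / (- r i)) (LBINT x:{0<..}. f x) < e"
    proof eventually_elim
      case (elim F)
      define h where "h x = (\<Sum>i\<in>F. c i * exp (r i * of_real x)) - f x" for x
      have h: "norm (h x) \<le> e * \<kappa> / 2 * exp (- (\<kappa> * x))" if "x > 0" for x
      proof -
        have "h x = exp (- (\<kappa> * x)) * ((\<Sum>i\<in>F. c i * exp ((r i + of_real \<kappa>) * of_real x)) - g x)"
          unfolding h_def fg right_diff_distrib sum_distrib_left
          by (simp add: exp_of_real[symmetric] exp_add[symmetric] algebra_simps del: exp_of_real)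
        then show ?thesis using elim(1) that by (auto simp: norm_mult dist_norm mult.commute less_imp_le)
      qed
      have hint: "set_integrable lborel {0<..} h"
        unfolding h_def using fin[of F] int elim(2) by (simp add: set_integral_diff)
      have rint: "set_integrable lborel {0<..} (\<lambda>x. e * \<kappa> / 2 * exp (- (\<kappa> * x)))"
        using set_integrable_norm[OF int_exp[of "of_real (e * \<kappa> / 2)"]] e \<kappa> by (simp add: norm_mult abs_mult)
      have "norm (LBINT x:{0<..}. h x) \<le> (LBINT x:{0<..}. norm (h x))"
        by (rule set_integral_norm_bound[OF hint])
      also have "\<dots> \<le> (LBINT x:{0<..}. e * \<kappa> / 2 * exp (- (\<kappa> * x)))"
        using h by (intro set_integral_mono set_integrable_norm hint rint) auto
      also have "\<dots> = e / 2"
      proof -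
        have "of_real (LBINT x:{0<..}. exp (- (\<kappa> * x))) = (1 / of_real \<kappa> :: complex)"
          using laplace_power[of "- of_real \<kappa>" 0] \<kappa>
          by (simp add: set_integral_complex_of_real[symmetric] exp_of_real[symmetric] del: exp_of_real)
        then have "(LBINT x:{0<..}. exp (- (\<kappa> * x))) = 1 / \<kappa>"
          by (metis of_real_divide of_real_eq_iff of_real_1)
        then show ?thesis using \<kappa> by simp
      qed
      also have "\<dots> < e" using e by simp
      finally show ?case
        using fin[of F] int elim(2) unfolding h_def by (simp add: dist_norm set_integral_diff)
    qed
  qed
  then have "((\<lambda>i. c i / (- r i)) has_sum (LBINT x:{0<..}. f x)) I"
    unfolding has_sum_def .
  then show "(LBINT x:{0<..}. f x) = (\<Sum>\<^sub>\<infinity>i\<in>I. c i / (- r i))"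
    by (simp add: has_sum_iff)
qed

section \<open>Functions determined by their Laplace transform at the integers\<close>

lemma set_integral_finite_sum:
  fixes f :: "'i \<Rightarrow> 'a \<Rightarrow> 'b::{banach, second_countable_topology}"
  assumes "\<And>i. i \<in> I \<Longrightarrow> set_integrable M A (f i)"
  shows "set_integrable M A (\<lambda>x. \<Sum>i\<in>I. f i x)"
    and "(LINT x:A|M. (\<Sum>i\<in>I. f i x)) = (\<Sum>i\<in>I. LINT x:A|M. f i x)"
  using assms unfolding set_integrable_def set_lebesgue_integral_def scaleR_sum_right
  by (auto intro!: Bochner_Integration.integral_sum)

lemma laplace_exp_integrable: "set_integrable lborel {0<..} (\<lambda>x::real. exp (- x))"
  using set_integrable_norm[OF power_times_exp_integrable[of "-1" 0]] by simp

lemma laplace_exp: "(LBINT x:{0<..}. exp (- x :: real)) = 1"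
proof -
  have "of_real (LBINT x:{0<..}. exp (- x)) = (1 :: complex)"
    using laplace_power[of "-1" 0] by (simp add: set_integral_complex_of_real[symmetric] exp_of_real[symmetric] del: exp_of_real)
  then show ?thesis by simp
qed

lemma laplace_bounded_integrable:
  fixes w :: "real \<Rightarrow> real"
  assumes "continuous_on {0<..} w" "\<And>x. 0 < x \<Longrightarrow> \<bar>w x\<bar> \<le> K"
  shows "set_integrable lborel {0<..} (\<lambda>x. exp (- x) * w x)"
proof (rule set_integrable_bound)
  show "set_integrable lborel {0<..} (\<lambda>x. K * exp (- x))"
    using laplace_exp_integrable by simp
  have "continuous_on {0<..} (\<lambda>x. exp (- x) * w x)"
    by (intro continuous_intros assms)
  then show "set_borel_measurable lborel {0<..} (\<lambda>x. exp (- x) * w x)"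
    unfolding set_borel_measurable_def
    using borel_measurable_continuous_on_indicator[of "{0<..}" "\<lambda>x. exp (- x) * w x"] by simp
  show "AE x in lborel. x \<in> {0<..} \<longrightarrow> norm (exp (- x) * w x) \<le> norm (K * exp (- x))"
    using assms(2) by (intro AE_I2) (fastforce simp: abs_mult)
qed

lemma continuous_nonneg_integral_zero:
  fixes f :: "real \<Rightarrow> real"
  assumes f_cont: "continuous_on {0<..} f" and f_nonneg: "\<And>x. 0 < x \<Longrightarrow> 0 \<le> f x"
    and f_int: "set_integrable lborel {0<..} f" and f_le: "(LBINT x:{0<..}. f x) \<le> 0" and y: "0 < y"
  shows "f y = 0"
proof -
  have sub: "{y..y+1} \<subseteq> {0<..}" using y by auto
  have fy_int: "set_integrable lborel {y..y+1} f"
    by (rule set_integrable_subset[OF f_int _ sub]) auto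
  have "integral {y..y+1} f \<le> integral {0<..} f"
    using set_borel_integral_eq_integral(1)[OF f_int] set_borel_integral_eq_integral(1)[OF fy_int] sub f_nonneg
    by (intro integral_subset_le) auto
  also have "\<dots> \<le> 0" using f_le set_borel_integral_eq_integral(2)[OF f_int] by simp
  finally have "integral {y..y+1} f = 0"
    using integral_nonneg[OF set_borel_integral_eq_integral(1)[OF fy_int]] f_nonneg y by force
  then have "(f has_integral 0) (cbox y (y+1))"
    using set_borel_integral_eq_integral(1)[OF fy_int] by (simp add: has_integral_iff)
  then show "f y = 0"
    using continuous_on_subset[OF f_cont sub] f_nonneg y
    by (intro has_integral_0_cbox_imp_0[of y "y+1" f]) auto
qed

lemma exp_neg_power_le_one: "0 \<le> (x::real) \<Longrightarrow> exp (- x) ^ k * (1 - exp (- x)) ^ i \<le> 1"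
  by (intro mult_le_one power_le_one) auto

lemma laplace_kernel_integrable:
  fixes w :: "real \<Rightarrow> real"
  assumes "continuous_on {0<..} w" "\<And>x. 0 < x \<Longrightarrow> \<bar>w x\<bar> \<le> K"
  shows "set_integrable lborel {0<..} (\<lambda>x. exp (- x) ^ Suc k * (1 - exp (- x)) ^ i * w x)"
proof -
  have "set_integrable lborel {0<..} (\<lambda>x. exp (- x) * (exp (- x) ^ k * (1 - exp (- x)) ^ i * w x))"
  proof (rule laplace_bounded_integrable)
    show "continuous_on {0<..} (\<lambda>x. exp (- x) ^ k * (1 - exp (- x)) ^ i * w x)"
      by (intro continuous_intros assms)
    fix x :: real assume x: "0 < x"
    have "\<bar>exp (- x) ^ k * (1 - exp (- x)) ^ i * w x\<bar> = exp (- x) ^ k * (1 - exp (- x)) ^ i * \<bar>w x\<bar>"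
      using x by (simp add: abs_mult)
    also have "\<dots> \<le> 1 * \<bar>w x\<bar>"
      using x by (intro mult_right_mono exp_neg_power_le_one) auto
    finally show "\<bar>exp (- x) ^ k * (1 - exp (- x)) ^ i * w x\<bar> \<le> K" using assms(2)[OF x] by simp
  qed
  then show ?thesis by (simp add: mult.assoc)
qed

text \<open>
  The substitution \<open>y = exp (- x)\<close> takes the half-line to the unit interval, where Bernstein
  polynomials apply; the factor \<open>y\<close> removes the discontinuity at \<open>y = 0\<close>, that is, at
  \<open>x = \<infinity>\<close>.
\<close>

lemma continuous_on_log_reparametrization:
  fixes u :: "real \<Rightarrow> real"
  assumes cont: "continuous_on {0..} u" and bound: "\<And>x. 0 \<le> x \<Longrightarrow> \<bar>u x\<bar> \<le> B"
  shows "continuous_on {0..1} (\<lambda>y. y * u (- ln y))"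
proof -
  have "continuous (at y within {0..1}) (\<lambda>y. y * u (- ln y))" if y: "y \<in> {0..1}" for y
  proof (cases "y = 0")
    case False
    have "continuous_on {0<..1} (\<lambda>y. y * u (- ln y))"
      by (intro continuous_intros continuous_on_compose2[OF cont]) auto
    then have "continuous (at y within {0<..1}) (\<lambda>y. y * u (- ln y))"
      using y False by (simp add: continuous_on_eq_continuous_within)
    moreover have "at y within {0<..1} = at y within {0..1}"
      using y False by (intro at_within_nhd[of _ "{0<..}"]) auto
    ultimately show ?thesis by simp
  next
    case True
    have "((\<lambda>y. y * u (- ln y)) \<longlongrightarrow> 0) (at 0 within {0..1})"
    proof (rule tendsto_0_le[where K = B])
      show "((\<lambda>y::real. y) \<longlongrightarrow> 0) (at 0 within {0..1})" by (rule tendsto_ident_at)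
      show "\<forall>\<^sub>F y in at 0 within {0..1}. norm (y * u (- ln y)) \<le> norm y * B"
        using bound by (auto simp: eventually_at_filter abs_mult intro!: always_eventually mult_left_mono)
    qed
    then show ?thesis using True by (simp add: continuous_within)
  qed
  then show ?thesis by (simp add: continuous_on_eq_continuous_within)
qed

text \<open>
  Uniform limits of nonnegative combinations of the kernels \<open>y^k (1 - y)^i\<close>,
  \<open>y = exp (- x)\<close>, are all nonnegative continuous functions on the unit interval. Testing
  \<open>u\<close> against its own negative part, in the weighted form \<open>h\<close>, shows that the square of
  this negative part has integral at most 0.
\<close>

lemma nonneg_of_bernstein_moments:
  fixes u :: "real \<Rightarrow> real"
  assumes cont: "continuous_on {0..} u" and bound: "\<And>x. 0 \<le> x \<Longrightarrow> \<bar>u x\<bar> \<le> B"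
    and mom: "\<And>k i. 0 \<le> (LBINT x:{0<..}. exp (- x) ^ Suc k * (1 - exp (- x)) ^ i * u x)"
    and "0 \<le> x"
  shows "0 \<le> u x"
proof -
  \<comment> \<open>At \<open>y = exp (- x)\<close> this is the negative part of \<open>exp (- x) * u x\<close>.\<close>
  define h where "h y = max 0 (- (y * u (- ln y)))" for y
  have cont': "continuous_on {0<..} u" by (rule continuous_on_subset[OF cont]) auto
  have cont_h: "continuous_on {0..1} h"
    unfolding h_def by (intro continuous_intros continuous_on_log_reparametrization[OF cont bound])
  have h0: "0 \<le> h y" for y by (simp add: h_def)
  have h_exp: "h (exp (- x)) = max 0 (- (exp (- x) * u x))" for x by (simp add: h_def)
  have B: "0 \<le> B" using bound[of 0] by simp
  have h_le: "h y \<le> B" if "y \<in> {0..1}" for y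
  proof -
    have "\<bar>y * u (- ln y)\<bar> \<le> 1 * B"
      using that bound[of "- ln y"] B mult_mono[of y 1 "\<bar>u (- ln y)\<bar>" B]
      by (cases "y = 0") (auto simp: abs_mult)
    then show ?thesis using B by (auto simp: h_def)
  qed
  have uh_int: "set_integrable lborel {0<..} (\<lambda>x. exp (- x) * (u x * h (exp (- x))))"
  proof (rule laplace_bounded_integrable)
    show "continuous_on {0<..} (\<lambda>x. u x * h (exp (- x)))"
      unfolding h_exp by (intro continuous_intros cont')
    show "\<bar>u x * h (exp (- x))\<bar> \<le> B * B" if "0 < x" for x
      unfolding abs_mult using that bound[of x] h_le[of "exp (- x)"] h0 B by (intro mult_mono) auto
  qed
  have "0 \<le> (LBINT x:{0<..}. exp (- x) * (u x * h (exp (- x)))) + e * B" if e: "0 < e" for e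
  proof -
    obtain n where n: "\<And>y. y \<in> {0..1} \<Longrightarrow> \<bar>h y - (\<Sum>k\<le>n. h (k / n) * Bernstein n k y)\<bar> < e"
      using Bernstein_Weierstrass[OF cont_h e] by blast
    define p where "p y = (\<Sum>k\<le>n. h (k / n) * Bernstein n k y)" for y
    have kern: "exp (- x) * (u x * p (exp (- x))) =
      (\<Sum>k\<le>n. h (k / n) * (n choose k) * (exp (- x) ^ Suc k * (1 - exp (- x)) ^ (n - k) * u x))" for x
      unfolding p_def Bernstein_def sum_distrib_left by (intro sum.cong) (auto simp: algebra_simps)
    have p_int: "set_integrable lborel {0<..} (\<lambda>x. exp (- x) * (u x * p (exp (- x))))"
      unfolding kern using bound set_integrable_mult_right[OF laplace_kernel_integrable[OF cont', of B]]
      by (intro set_integral_finite_sum(1)) (auto simp del: power_Suc)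
    have "0 \<le> (\<Sum>k\<le>n. h (k / n) * (n choose k) * (LBINT x:{0<..}. exp (- x) ^ Suc k * (1 - exp (- x)) ^ (n - k) * u x))"
      by (intro sum_nonneg mult_nonneg_nonneg h0 mom) auto
    also have "\<dots> = (LBINT x:{0<..}. exp (- x) * (u x * p (exp (- x))))"
      unfolding kern using bound
      by (subst set_integral_finite_sum(2))
        (auto intro!: set_integrable_mult_right laplace_kernel_integrable[where K = B] cont' simp del: power_Suc)
    also have "\<dots> \<le> (LBINT x:{0<..}. exp (- x) * (u x * h (exp (- x))) + e * B * exp (- x))"
    proof (rule set_integral_mono[OF p_int])
      show "set_integrable lborel {0<..} (\<lambda>x. exp (- x) * (u x * h (exp (- x))) + e * B * exp (- x))"
        by (intro set_integral_add uh_int set_integrable_mult_right laplace_exp_integrable)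
      fix x :: real assume "x \<in> {0<..}"
      then have "\<bar>u x * (p (exp (- x)) - h (exp (- x)))\<bar> \<le> B * e"
        unfolding abs_mult using bound[of x] n[of "exp (- x)"] e unfolding p_def
        by (intro mult_mono) (auto simp: abs_minus_commute less_imp_le)
      then have "u x * p (exp (- x)) \<le> u x * h (exp (- x)) + e * B"
        by (simp add: algebra_simps)
      then have "exp (- x) * (u x * p (exp (- x))) \<le> exp (- x) * (u x * h (exp (- x)) + e * B)"
        by (intro mult_left_mono) auto
      then show "exp (- x) * (u x * p (exp (- x))) \<le> exp (- x) * (u x * h (exp (- x))) + e * B * exp (- x)"
        by (simp add: algebra_simps)
    qed
    also have "\<dots> = (LBINT x:{0<..}. exp (- x) * (u x * h (exp (- x)))) + e * B"
      using laplace_exp by (subst set_integral_add) (auto intro!: uh_int laplace_exp_integrable)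
    finally show ?thesis .
  qed
  then have "0 \<le> (LBINT x:{0<..}. exp (- x) * (u x * h (exp (- x))))"
  proof -
    assume *: "\<And>e. 0 < e \<Longrightarrow> 0 \<le> (LBINT x:{0<..}. exp (- x) * (u x * h (exp (- x)))) + e * B"
    have "((\<lambda>e. (LBINT x:{0<..}. exp (- x) * (u x * h (exp (- x)))) + e * B) \<longlongrightarrow>
            (LBINT x:{0<..}. exp (- x) * (u x * h (exp (- x)))) + 0 * B) (at_right 0)"
      by (intro tendsto_intros)
    then show ?thesis
      using * by (intro tendsto_lowerbound[of _ _ "at_right (0::real)"])
        (auto simp: eventually_at_right_less intro: eventually_mono[OF eventually_at_right_less])
  qed
  moreover define f where "f x = (max 0 (- (exp (- x) * u x)))\<^sup>2" for x
  have uh: "exp (- x) * (u x * h (exp (- x))) = - f x" for x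
    unfolding h_exp f_def by (auto simp: max_def power2_eq_square)
  ultimately have f_le: "(LBINT x:{0<..}. f x) \<le> 0"
    unfolding uh by (simp add: set_lebesgue_integral_def)
  have f_int: "set_integrable lborel {0<..} f"
    using set_integrable_mult_right[OF uh_int, of "-1"] unfolding uh by simp
  have f_cont: "continuous_on {0<..} f"
    unfolding f_def by (intro continuous_intros cont')
  have pos: "0 \<le> u y" if y: "0 < y" for y
  proof -
    have "f y = 0"
      by (rule continuous_nonneg_integral_zero[OF f_cont _ f_int f_le y]) (simp add: f_def)
    then show ?thesis by (auto simp: f_def max_def mult_le_0_iff split: if_splits)
  qed
  show "0 \<le> u x"
  proof (cases "x = 0")
    case True
    have "(u \<longlongrightarrow> u 0) (at 0 within {0..})" using cont by (simp add: continuous_on_def)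
    then have "(u \<longlongrightarrow> u 0) (at_right 0)" by (rule tendsto_within_subset) auto
    then show ?thesis unfolding True
      using pos by (intro tendsto_lowerbound[of u "u 0" "at_right 0"])
        (auto intro: eventually_mono[OF eventually_at_right_less])
  qed (use pos assms(4) in auto)
qed

section \<open>Completely monotone sequences\<close>

definition fdiff :: "(nat \<Rightarrow> real) \<Rightarrow> nat \<Rightarrow> real" where
  "fdiff f k = f k - f (Suc k)"

text \<open>
  Completely monotone in Hausdorff's sense: all iterated differences, taken with alternating signs, are
  nonnegative.
\<close>

definition cm_seq :: "(nat \<Rightarrow> real) \<Rightarrow> bool" where
  "cm_seq f \<longleftrightarrow> (\<forall>i k. 0 \<le> (fdiff ^^ i) f k)"

lemma fdiff_pow_Suc: "(fdiff ^^ Suc i) f = (fdiff ^^ i) (fdiff f)"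
  by (simp add: funpow_swap1)

lemma fdiff_pow_add: "(fdiff ^^ i) (\<lambda>k. f k + g k) k = (fdiff ^^ i) f k + (fdiff ^^ i) g k"
  by (induction i arbitrary: k) (auto simp: fdiff_def)

lemma fdiff_pow_cmult: "(fdiff ^^ i) (\<lambda>k. c * f k) k = c * (fdiff ^^ i) f k"
  by (induction i arbitrary: k) (auto simp: fdiff_def algebra_simps)

lemma fdiff_pow_shift: "(fdiff ^^ i) (\<lambda>k. f (Suc k)) k = (fdiff ^^ i) f (Suc k)"
  by (induction i arbitrary: k) (auto simp: fdiff_def)

lemma fdiff_pow_tendsto:
  assumes "\<And>k. (\<lambda>n. f n k) \<longlonglongrightarrow> g k"
  shows "(\<lambda>n. (fdiff ^^ i) (f n) k) \<longlonglongrightarrow> (fdiff ^^ i) g k"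
  by (induction i arbitrary: k) (auto simp: fdiff_def intro!: tendsto_diff assms)

text \<open>
  The Leibniz rule \<open>\<Delta> (f g) = f \<Delta> g + \<Delta> f (E g)\<close>, with the shift
  \<open>E\<close>, reduces the order of the difference by one.
\<close>

lemma cm_seq_mult:
  assumes "cm_seq f" "cm_seq g"
  shows "cm_seq (\<lambda>k. f k * g k)"
proof -
  have "0 \<le> (fdiff ^^ i) (\<lambda>k. f k * g k) k" if "cm_seq f" "cm_seq g" for i k f g
    using that
  proof (induction i arbitrary: f g k)
    case 0
    have "0 \<le> (fdiff ^^ 0) f k" "0 \<le> (fdiff ^^ 0) g k" using 0 unfolding cm_seq_def by blast+
    then show ?case by simp
  next
    case (Suc i)
    have cm: "cm_seq (fdiff f)" "cm_seq (fdiff g)"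
      using Suc.prems fdiff_pow_Suc unfolding cm_seq_def by metis+
    have cm': "cm_seq (\<lambda>k. g (Suc k))"
      using Suc.prems unfolding cm_seq_def by (simp add: fdiff_pow_shift)
    have "fdiff (\<lambda>k. f k * g k) = (\<lambda>k. f k * fdiff g k + fdiff f k * g (Suc k))"
      by (auto simp: fdiff_def algebra_simps)
    then show ?case
      using Suc.IH[OF Suc.prems(1) cm(2)] Suc.IH[OF cm(1) cm'] unfolding fdiff_pow_Suc
      by (simp add: fdiff_pow_add)
  qed
  then show ?thesis using assms unfolding cm_seq_def by blast
qed

lemma cm_seq_add: "cm_seq f \<Longrightarrow> cm_seq g \<Longrightarrow> cm_seq (\<lambda>k. f k + g k)"
  unfolding cm_seq_def by (simp add: fdiff_pow_add)

lemma cm_seq_cmult: "cm_seq f \<Longrightarrow> 0 \<le> c \<Longrightarrow> cm_seq (\<lambda>k. c * f k)"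
  unfolding cm_seq_def by (simp add: fdiff_pow_cmult)

lemma cm_seq_limit:
  assumes "\<And>k. (\<lambda>n. f n k) \<longlonglongrightarrow> g k" "\<And>n. cm_seq (f n)"
  shows "cm_seq g"
  unfolding cm_seq_def
proof (intro allI)
  fix i k show "0 \<le> (fdiff ^^ i) g k"
    by (rule LIMSEQ_le_const[OF fdiff_pow_tendsto[OF assms(1)]]) (use assms(2) cm_seq_def in auto)
qed

text \<open>
  \<open>1 / (C - g) - 1 / C\<close> is the geometric series of the \<open>g^(m+1) / C^(m+2)\<close>, whose terms
  are products of completely monotone sequences. In probabilistic terms this is the renewal series of a compound
  Poisson subordinator.
\<close>

lemma cm_seq_renewal:
  assumes g: "cm_seq g" and lt: "\<And>k. g k < C"
  shows "cm_seq (\<lambda>k. 1 / (C - g k) - 1 / C)"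
proof (rule cm_seq_limit)
  have g0: "0 \<le> g k" for k using g unfolding cm_seq_def by (metis funpow_0)
  have C: "0 < C" using g0 lt le_less_trans by blast
  have cm_pow: "cm_seq (\<lambda>k. g k ^ Suc m)" for m
  proof (induction m)
    case (Suc m)
    then show ?case using cm_seq_mult[OF g Suc] by simp
  qed (use g in simp)
  show "cm_seq (\<lambda>k. \<Sum>m<n. g k ^ Suc m / C ^ Suc (Suc m))" for n
  proof (induction n)
    case 0
    have "(fdiff ^^ i) (\<lambda>k. 0) k = 0" for i k by (induction i arbitrary: k) (auto simp: fdiff_def)
    then show ?case by (simp add: cm_seq_def)
  next
    case (Suc n)
    have "cm_seq (\<lambda>k. inverse (C ^ Suc (Suc n)) * g k ^ Suc n)"
      by (rule cm_seq_cmult[OF cm_pow]) (use C in auto)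
    then show ?case using cm_seq_add[OF Suc] by (simp add: divide_inverse mult.commute)
  qed
  fix k
  have q: "\<bar>g k / C\<bar> < 1" using g0[of k] lt[of k] C by simp
  have "(\<lambda>m. g k / C^2 * (g k / C) ^ m) sums (g k / C^2 * (1 / (1 - g k / C)))"
    using q by (intro sums_mult geometric_sums) auto
  also have "(\<lambda>m. g k / C^2 * (g k / C) ^ m) = (\<lambda>m. g k ^ Suc m / C ^ Suc (Suc m))"
    using C by (simp add: field_simps power2_eq_square)
  also have "g k / C^2 * (1 / (1 - g k / C)) = 1 / (C - g k) - 1 / C"
    using C lt[of k] by (simp add: field_simps power2_eq_square)
  finally show "(\<lambda>n. \<Sum>m<n. g k ^ Suc m / C ^ Suc (Suc m)) \<longlonglongrightarrow> 1 / (C - g k) - 1 / C"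
    by (simp add: sums_def)
qed

text \<open>
  Taking a difference multiplies the integrand by \<open>1 - exp (- x)\<close>, so iterated differences of
  exponential moments are moments against Bernstein kernels.
\<close>

lemma fdiff_pow_laplace:
  fixes w :: "real \<Rightarrow> real"
  assumes "continuous_on {0<..} w" "\<And>x. 0 < x \<Longrightarrow> \<bar>w x\<bar> \<le> K"
  shows "(fdiff ^^ i) (\<lambda>k. LBINT x:{0<..}. exp (- x) ^ Suc k * w x) k =
    (LBINT x:{0<..}. exp (- x) ^ Suc k * (1 - exp (- x)) ^ i * w x)"
proof (induction i arbitrary: k)
  case (Suc i)
  note int = laplace_kernel_integrable[OF assms]
  have "(fdiff ^^ Suc i) (\<lambda>k. LBINT x:{0<..}. exp (- x) ^ Suc k * w x) k =
     (LBINT x:{0<..}. exp (- x) ^ Suc k * (1 - exp (- x)) ^ i * w x) -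
     (LBINT x:{0<..}. exp (- x) ^ Suc (Suc k) * (1 - exp (- x)) ^ i * w x)"
    unfolding funpow.simps o_apply fdiff_def[of "(fdiff ^^ i) f" for f] Suc ..
  also have "\<dots> = (LBINT x:{0<..}. exp (- x) ^ Suc k * (1 - exp (- x)) ^ i * w x - exp (- x) ^ Suc (Suc k) * (1 - exp (- x)) ^ i * w x)"
    by (rule set_integral_diff(2)[symmetric, OF int int])
  also have "\<dots> = (LBINT x:{0<..}. exp (- x) ^ Suc k * (1 - exp (- x)) ^ Suc i * w x)"
    by (intro arg_cong2[where f = "set_lebesgue_integral lborel"] refl ext) (simp add: algebra_simps)
  finally show ?case .
qed simp

lemma cm_seq_laplace:
  fixes w :: "real \<Rightarrow> real"
  assumes "continuous_on {0<..} w" "\<And>x. 0 < x \<Longrightarrow> \<bar>w x\<bar> \<le> K" "\<And>x. 0 < x \<Longrightarrow> 0 \<le> w x"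
  shows "cm_seq (\<lambda>k. LBINT x:{0<..}. exp (- x) ^ Suc k * w x)"
proof -
  have "0 \<le> (LBINT x:{0<..}. exp (- x) ^ Suc k * (1 - exp (- x)) ^ i * w x)" for k i
    unfolding set_lebesgue_integral_def using assms(3)
    by (intro integral_nonneg_AE AE_I2) (auto simp: indicator_def intro!: mult_nonneg_nonneg)
  then show ?thesis
    unfolding cm_seq_def using fdiff_pow_laplace[OF assms(1,2)] by simp
qed

lemma nonneg_of_cm_laplace:
  fixes u :: "real \<Rightarrow> real"
  assumes "continuous_on {0..} u" "\<And>x. 0 \<le> x \<Longrightarrow> \<bar>u x\<bar> \<le> B"
    "cm_seq (\<lambda>k. LBINT x:{0<..}. exp (- x) ^ Suc k * u x)" "0 \<le> x"
  shows "0 \<le> u x"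
proof (rule nonneg_of_bernstein_moments[OF assms(1,2) _ assms(4)])
  have c: "continuous_on {0<..} u" by (rule continuous_on_subset[OF assms(1)]) auto
  show "0 \<le> (LBINT x:{0<..}. exp (- x) ^ Suc k * (1 - exp (- x)) ^ i * u x)" for k i
    using assms(3) assms(2) unfolding cm_seq_def
    by (subst fdiff_pow_laplace[OF c, where K = B, symmetric]) auto
qed

section \<open>Measures on the half-line determined by exponential moments\<close>

text \<open>
  The moments fix the integrals of all polynomials in \<open>exp (- x)\<close>, hence by the Weierstrass theorem
  those of all continuous functions of \<open>exp (- x)\<close>; piecewise linear functions increase to the
  indicator functions of half-lines.
\<close>

lemma measure_eqI_exp_moments:
  fixes M N :: "real measure"
  assumes sets: "sets M = sets borel" "sets N = sets borel"
    and pos: "AE x in M. 0 \<le> x" "AE x in N. 0 \<le> x"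
    and mom: "\<And>j::nat. (\<integral>\<^sup>+x. ennreal (exp (- x) ^ j) \<partial>M) = (\<integral>\<^sup>+x. ennreal (exp (- x) ^ j) \<partial>N)"
    and fin: "emeasure M UNIV < \<infinity>"
  shows "M = N"
proof -
  have space: "space M = UNIV" "space N = UNIV"
    using sets_eq_imp_space_eq[OF sets(1)] sets_eq_imp_space_eq[OF sets(2)] by auto
  have finN: "emeasure N UNIV = emeasure M UNIV"
    using mom[of 0] space by simp
  interpret M: finite_measure M by standard (use fin space in auto)
  interpret N: finite_measure N by standard (use fin finN space in auto)
  note [measurable_cong] = sets
  have eq_poly: "integrable M (\<lambda>x. exp (- x) ^ k * (1 - exp (- x)) ^ m) \<and> integrable N (\<lambda>x. exp (- x) ^ k * (1 - exp (- x)) ^ m) \<and>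
      (\<integral>x. exp (- x) ^ k * (1 - exp (- x)) ^ m \<partial>M) = (\<integral>x. exp (- x) ^ k * (1 - exp (- x)) ^ m \<partial>N)" for k m
  proof (induction m arbitrary: k)
    case 0
    have "AE x in M. norm (exp (- x) ^ k) \<le> 1" "AE x in N. norm (exp (- x) ^ k) \<le> 1"
      using pos by (auto elim!: eventually_mono simp: power_le_one)
    then have "integrable M (\<lambda>x. exp (- x) ^ k)" "integrable N (\<lambda>x. exp (- x) ^ k)"
      by (auto intro!: M.integrable_const_bound[where B = 1] N.integrable_const_bound[where B = 1])
    then show ?case using mom[of k] by (simp add: integral_eq_nn_integral)
  next
    case (Suc m)
    have "exp (- x) ^ k * (1 - exp (- x)) ^ Suc m = exp (- x) ^ k * (1 - exp (- x)) ^ m - exp (- x) ^ Suc k * (1 - exp (- x)) ^ m" for x :: real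
      by (simp add: algebra_simps)
    then show ?case using Suc[of k] Suc[of "Suc k"] by (simp del: power_Suc)
  qed
  have eq_cont: "(\<integral>x. h (exp (- x)) \<partial>M) = (\<integral>x. h (exp (- x)) \<partial>N)"
    if h: "continuous_on {0..1} h" "h \<in> borel_measurable borel" "\<And>y. \<bar>h y\<bar> \<le> 1" for h :: "real \<Rightarrow> real"
  proof -
    have "\<bar>(\<integral>x. h (exp (- x)) \<partial>M) - (\<integral>x. h (exp (- x)) \<partial>N)\<bar> \<le> e * (measure M UNIV + measure N UNIV)" if e: "0 < e" for e
    proof -
      note [measurable] = h(2)
      obtain n where n: "\<And>y. y \<in> {0..1} \<Longrightarrow> \<bar>h y - (\<Sum>k\<le>n. h (k / n) * Bernstein n k y)\<bar> < e"
        using Bernstein_Weierstrass[OF h(1) e] by blast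
      define p where "p x = (\<Sum>k\<le>n. h (k / n) * (n choose k) * (exp (- x) ^ k * (1 - exp (- x)) ^ (n - k)))" for x
      have p: "integrable M p" "integrable N p" "(\<integral>x. p x \<partial>M) = (\<integral>x. p x \<partial>N)"
        unfolding p_def using eq_poly by (auto intro!: integrable_mult_right simp: Bochner_Integration.integral_sum)
      have hp: "\<bar>h (exp (- x)) - p x\<bar> \<le> e" if "0 \<le> x" for x
        using n[of "exp (- x)"] that unfolding p_def Bernstein_def by (simp add: mult.assoc)
      have hint: "integrable M (\<lambda>x. h (exp (- x)))" "integrable N (\<lambda>x. h (exp (- x)))"
        using h(3) by (auto intro!: M.integrable_const_bound[where B = 1] N.integrable_const_bound[where B = 1])
      have "\<bar>(\<integral>x. h (exp (- x)) \<partial>K) - (\<integral>x. p x \<partial>K)\<bar> \<le> e * measure K UNIV"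
        if K: "finite_measure K" "AE x in K. 0 \<le> x" "integrable K (\<lambda>x. h (exp (- x)))" "integrable K p" "space K = UNIV" for K
      proof -
        have "\<bar>\<integral>x. h (exp (- x)) - p x \<partial>K\<bar> \<le> (\<integral>x. \<bar>h (exp (- x)) - p x\<bar> \<partial>K)"
          by (rule integral_abs_bound)
        also have "\<dots> \<le> (\<integral>x. e \<partial>K)"
          using K hp by (intro integral_mono_AE) (auto intro: finite_measure.integrable_const elim!: eventually_mono)
        finally show ?thesis using K by (simp add: mult.commute)
      qed
      from this[OF M.finite_measure_axioms pos(1) hint(1) p(1) space(1)] this[OF N.finite_measure_axioms pos(2) hint(2) p(2) space(2)] p(3)
      show ?thesis by (simp add: algebra_simps)
    qed
    then have "\<bar>(\<integral>x. h (exp (- x)) \<partial>M) - (\<integral>x. h (exp (- x)) \<partial>N)\<bar> \<le> 0"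
    proof -
      assume *: "\<And>e. 0 < e \<Longrightarrow> \<bar>(\<integral>x. h (exp (- x)) \<partial>M) - (\<integral>x. h (exp (- x)) \<partial>N)\<bar> \<le> e * (measure M UNIV + measure N UNIV)"
      have "((\<lambda>e. e * (measure M UNIV + measure N UNIV)) \<longlongrightarrow> 0 * (measure M UNIV + measure N UNIV)) (at_right 0)"
        by (intro tendsto_intros)
      then show ?thesis
        using * by (intro tendsto_lowerbound[of _ 0 "at_right (0::real)"])
          (auto intro: eventually_mono[OF eventually_at_right_less])
    qed
    then show ?thesis by simp
  qed
  have em: "emeasure K {c<..} = (SUP n. ennreal (\<integral>x. min 1 (real n * max 0 (exp (- c) - exp (- x))) \<partial>K))"
    if K: "finite_measure K" and sK[measurable_cong]: "sets K = sets borel" for K c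
  proof -
    interpret K: finite_measure K by (rule K)
    \<comment> \<open>Continuous functions of \<open>exp (- x)\<close> that increase to the indicator function of \<open>{c<..}\<close>.\<close>
    define h where "h n x = min 1 (real n * max 0 (exp (- c) - exp (- x)))" for n x
    have [measurable]: "h n \<in> borel_measurable borel" for n unfolding h_def by measurable
    have sup: "(SUP n. ennreal (h n x)) = indicator {c<..} x" for x
    proof (rule antisym)
      show "(SUP n. ennreal (h n x)) \<le> indicator {c<..} x"
        by (rule SUP_least) (auto simp: h_def indicator_def)
      show "indicator {c<..} x \<le> (SUP n. ennreal (h n x))"
      proof (cases "c < x")
        case True
        then have d: "0 < exp (- c) - exp (- x)" by simp
        obtain n where "1 < real n * (exp (- c) - exp (- x))"
          using reals_Archimedean3[OF d] by blast
        then have "h n x = 1" using d by (simp add: h_def)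
        then have "ennreal (h n x) = 1" by simp
        then show ?thesis using True by (auto intro: SUP_upper2[of n])
      qed auto
    qed
    have "emeasure K {c<..} = (\<integral>\<^sup>+x. (SUP n. ennreal (h n x)) \<partial>K)"
      unfolding sup by simp
    also have "\<dots> = (SUP n. \<integral>\<^sup>+x. ennreal (h n x) \<partial>K)"
    proof (rule nn_integral_monotone_convergence_SUP)
      show "incseq (\<lambda>n x. ennreal (h n x))"
        unfolding incseq_def le_fun_def h_def by (intro allI impI ennreal_leI min.mono mult_right_mono) auto
    qed measurable
    also have "\<dots> = (SUP n. ennreal (\<integral>x. h n x \<partial>K))"
      by (intro SUP_cong refl nn_integral_eq_integral K.integrable_const_bound[where B = 1]) (auto simp: h_def)
    finally show ?thesis unfolding h_def .
  qed
  show "M = N"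
  proof (rule measure_eqI_lessThan)
    show "emeasure M {c<..} < \<infinity>" for c using M.emeasure_finite[of "{c<..}"] by (simp add: less_top[symmetric])
    show "emeasure M {c<..} = emeasure N {c<..}" for c
    proof -
      have "continuous_on {0..1} (\<lambda>y. min 1 (real n * max 0 (exp (- c) - y)))" for n
        by (intro continuous_intros)
      from eq_cont[OF this] have "(\<integral>x. min 1 (real n * max 0 (exp (- c) - exp (- x))) \<partial>M) =
          (\<integral>x. min 1 (real n * max 0 (exp (- c) - exp (- x))) \<partial>N)" for n
        by simp
      then show ?thesis
        unfolding em[OF M.finite_measure_axioms sets(1)] em[OF N.finite_measure_axioms sets(2)] by simp
    qed
  qed (use sets in auto)
qed

section \<open>The Laplace exponent as a sum over its poles\<close>

locale beta_exponent =
  fixes \<beta> :: real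
  assumes \<beta>_pos: "0 < \<beta>"
begin

text \<open>
  \<open>rc k\<close> is the residue of \<open>G\<close> at the pole \<open>pol k\<close>. For integral
  \<open>\<beta>\<close> only finitely many residues are nonzero and the remaining points are not poles;
  \<open>J\<close> keeps the genuine ones.
\<close>

definition rc :: "nat \<Rightarrow> real" where "rc k = (-1) ^ k * (\<beta> gchoose k)"
definition pol :: "nat \<Rightarrow> complex" where "pol k = - of_real (\<beta> + 2 + real k)"
definition J :: "nat set" where "J = {k. rc k \<noteq> 0}"
definition C :: real where "C = Beta (\<beta> + 2) (\<beta> + 1)"
definition G :: "complex \<Rightarrow> complex" where "G = cauchy_sum (\<lambda>k. of_real (rc k)) pol J"

lemma C_pos: "0 < C"
  unfolding C_def Beta_def using \<beta>_pos by (intro divide_pos_pos mult_pos_pos Gamma_real_pos) auto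

text \<open>
  Classical asymptotics of the generalised binomial coefficients; the exponent is below \<open>-1\<close> because
  \<open>\<beta> > 0\<close>.
\<close>

lemma rc_bound: obtains K where "0 \<le> K" "\<And>k. 1 \<le> k \<Longrightarrow> \<bar>rc k\<bar> \<le> K * real k powr - (\<beta> + 1)"
proof -
  have "convergent (\<lambda>n. (\<beta> gchoose n) / ((-1) ^ n / exp ((\<beta> + 1) * of_real (ln (real n)))))"
    using gbinomial_asymptotic[of \<beta>] convergentI by blast
  then have "Bseq (\<lambda>n. (\<beta> gchoose n) / ((-1) ^ n / exp ((\<beta> + 1) * of_real (ln (real n)))))"
    by (rule convergent_imp_Bseq)
  then obtain K where K: "0 < K" "\<And>n. norm ((\<beta> gchoose n) / ((-1) ^ n / exp ((\<beta> + 1) * of_real (ln (real n))))) \<le> K"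
    by (auto elim: BseqE)
  have "\<bar>rc k\<bar> \<le> K * real k powr - (\<beta> + 1)" if "1 \<le> k" for k
  proof -
    have "\<bar>\<beta> gchoose k\<bar> * exp ((\<beta> + 1) * ln (real k)) \<le> K"
      using K(2)[of k] by (simp add: abs_mult)
    then have "\<bar>\<beta> gchoose k\<bar> \<le> K * inverse (exp ((\<beta> + 1) * ln (real k)))"
      by (simp add: field_simps)
    also have "inverse (exp ((\<beta> + 1) * ln (real k))) = real k powr - (\<beta> + 1)"
      using that by (simp add: powr_def exp_minus[symmetric] algebra_simps)
    finally show ?thesis by (simp add: rc_def abs_mult)
  qed
  then show thesis using that K(1) by (meson less_imp_le)
qed

lemma rc_summable: "summable (\<lambda>k. \<bar>rc k\<bar>)"
proof -
  obtain K where K: "0 \<le> K" "\<And>k. 1 \<le> k \<Longrightarrow> \<bar>rc k\<bar> \<le> K * real k powr - (\<beta> + 1)" by (rule rc_bound) blast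
  show ?thesis
  proof (rule summable_comparison_test_ev)
    show "\<forall>\<^sub>F k in sequentially. norm \<bar>rc k\<bar> \<le> K * real k powr - (\<beta> + 1)"
      using eventually_ge_at_top[of 1] by eventually_elim (use K in auto)
    show "summable (\<lambda>k. K * real k powr - (\<beta> + 1))"
      using \<beta>_pos by (intro summable_mult) (simp add: summable_real_powr_iff)
  qed
qed

lemma coeff_abs_summable: "(\<lambda>k. norm (complex_of_real (rc k))) summable_on K"
proof -
  have "(\<lambda>k. norm (complex_of_real (rc k))) summable_on UNIV"
    by (rule norm_summable_imp_summable_on) (simp add: rc_summable)
  then show ?thesis by (rule summable_on_subset_banach) simp
qed

lemma pol_dist: "j \<noteq> k \<Longrightarrow> 1 \<le> norm (pol j - pol k)"
proof -
  assume "j \<noteq> k"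
  have "pol j - pol k = of_real (real k - real j)" by (simp add: pol_def)
  then have "norm (pol j - pol k) = \<bar>real k - real j\<bar>" by (simp only: norm_of_real)
  then show ?thesis using \<open>j \<noteq> k\<close> by linarith
qed

lemma closed_pol: "closed (pol ` K)"
proof -
  have "pol ` K = (\<lambda>z. - of_real (\<beta> + 2) + z) ` (of_int ` ((\<lambda>k. - int k) ` K))"
    by (auto simp: pol_def image_iff)
  then show ?thesis using closed_translation[OF closed_of_int_image] by metis
qed

lemma G_holomorphic: "G holomorphic_on - pol ` J"
  unfolding G_def using closed_pol[of J]
  by (intro cauchy_sum_holomorphic coeff_abs_summable) auto

lemma Re_pol: "Re (pol k) \<le> - (\<beta> + 2)" by (simp add: pol_def)

lemma has_sum_J_iff: "((\<lambda>k. of_real (rc k) * f k) has_sum s) J \<longleftrightarrow> ((\<lambda>k. of_real (rc k) * f k :: 'b::real_normed_field) has_sum s) UNIV"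
  by (rule has_sum_cong_neutral) (auto simp: J_def)

text \<open>
  Binomial series under the Beta integral. Absolute summability of the coefficients makes the series of integrands
  converge uniformly on the closed interval, including the endpoint 1, where the binomial series is at the
  boundary of its disc of convergence.
\<close>

lemma Beta_real_series:
  assumes "0 \<le> x"
  shows "(\<lambda>k. rc k / (x + \<beta> + 2 + real k)) sums Beta (x + \<beta> + 2) (\<beta> + 1)"
proof -
  define f where "f n t = (\<Sum>k<n. rc k * t powr (x + \<beta> + 1 + real k))" for n t
  have "uniform_limit {0..1} f (\<lambda>t. \<Sum>k. rc k * t powr (x + \<beta> + 1 + real k)) sequentially"
    unfolding f_def
  proof (rule Weierstrass_m_test[OF _ rc_summable])
    fix n t assume "t \<in> {0..1::real}"
    then have "t powr (x + \<beta> + 1 + real n) \<le> 1"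
      using assms \<beta>_pos by (intro powr_le1) auto
    then show "norm (rc n * t powr (x + \<beta> + 1 + real n)) \<le> \<bar>rc n\<bar>"
      by (simp add: abs_mult mult_left_le)
  qed
  moreover have "continuous_on {0..1} (f n)" for n
    unfolding f_def using assms \<beta>_pos by (intro continuous_intros continuous_on_powr') auto
  ultimately obtain I L where I: "\<And>n. (f n has_integral I n) {0..1}"
    and L: "((\<lambda>t. \<Sum>k. rc k * t powr (x + \<beta> + 1 + real k)) has_integral L) {0..1}" and IL: "I \<longlonglongrightarrow> L"
    by (rule uniform_limit_integral[OF _ _ sequentially_bot]) blast
  have "(f n has_integral (\<Sum>k<n. rc k / (x + \<beta> + 2 + real k))) {0..1}" for n
    unfolding f_def
  proof (rule has_integral_sum)
    fix k assume "k \<in> {..<n}"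
    have "((\<lambda>t. t powr (x + \<beta> + 1 + real k)) has_integral (1 powr (x + \<beta> + 1 + real k + 1) / (x + \<beta> + 1 + real k + 1))) {0..1}"
      using assms \<beta>_pos by (intro has_integral_powr_from_0) auto
    from has_integral_mult_right[OF this, of "rc k"]
    show "((\<lambda>t. rc k * t powr (x + \<beta> + 1 + real k)) has_integral rc k / (x + \<beta> + 2 + real k)) {0..1}"
      by (simp add: algebra_simps)
  qed simp
  then have "I = (\<lambda>n. \<Sum>k<n. rc k / (x + \<beta> + 2 + real k))"
    using has_integral_unique[OF I] by blast
  then have "(\<lambda>k. rc k / (x + \<beta> + 2 + real k)) sums L" using IL by (simp add: sums_def)
  moreover have "((\<lambda>t. t powr (x + \<beta> + 2 - 1) * (1 - t) powr (\<beta> + 1 - 1)) has_integral L) {0..1}"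
  proof (rule has_integral_spike_finite[OF _ _ L])
    show "finite {0, 1::real}" by simp
    fix t :: real assume t: "t \<in> {0..1} - {0, 1}"
    have "(\<lambda>k. (\<beta> gchoose k) * (- t) ^ k) sums (1 + - t) powr \<beta>"
      using t by (intro gen_binomial_real) auto
    from sums_mult[OF this, of "t powr (x + \<beta> + 1)"]
    have "(\<lambda>k. rc k * t powr (x + \<beta> + 1 + real k)) sums (t powr (x + \<beta> + 1) * (1 - t) powr \<beta>)"
      using t by (simp add: rc_def powr_add powr_realpow power_minus[of t] mult_ac)
    then show "t powr (x + \<beta> + 2 - 1) * (1 - t) powr (\<beta> + 1 - 1) = (\<Sum>k. rc k * t powr (x + \<beta> + 1 + real k))"
      by (simp add: sums_iff algebra_simps)
  qed
  moreover have "((\<lambda>t. t powr (x + \<beta> + 2 - 1) * (1 - t) powr (\<beta> + 1 - 1)) has_integral Beta (x + \<beta> + 2) (\<beta> + 1)) {0..1}"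
    using assms \<beta>_pos by (intro has_integral_Beta_real) auto
  ultimately show ?thesis using has_integral_unique by blast
qed

lemma G_of_real:
  assumes "0 \<le> x"
  shows "G (of_real x) = of_real (Beta (x + \<beta> + 2) (\<beta> + 1))"
proof -
  have "summable (\<lambda>k. norm (rc k / (x + \<beta> + 2 + real k)))"
  proof (rule summable_comparison_test'[OF rc_summable])
    fix k :: nat
    show "norm (norm (rc k / (x + \<beta> + 2 + real k))) \<le> \<bar>rc k\<bar>"
      using assms \<beta>_pos by (simp add: divide_le_eq mult_le_cancel_left1)
  qed
  then have "((\<lambda>k. rc k / (x + \<beta> + 2 + real k)) has_sum Beta (x + \<beta> + 2) (\<beta> + 1)) UNIV"
    by (rule norm_summable_imp_has_sum[OF _ Beta_real_series[OF assms]])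
  then have "((\<lambda>k. complex_of_real (rc k / (x + \<beta> + 2 + real k))) has_sum of_real (Beta (x + \<beta> + 2) (\<beta> + 1))) UNIV"
    by (simp only: has_sum_of_real_iff)
  also have "(\<lambda>k. complex_of_real (rc k / (x + \<beta> + 2 + real k))) = (\<lambda>k. of_real (rc k) * (1 / (of_real x - pol k)))"
    by (auto simp: pol_def algebra_simps)
  finally have "((\<lambda>k. of_real (rc k) * (1 / (of_real x - pol k))) has_sum complex_of_real (Beta (x + \<beta> + 2) (\<beta> + 1))) J"
    by (simp only: has_sum_J_iff)
  then show ?thesis unfolding G_def cauchy_sum_def by (simp add: infsumI)
qed

lemma G_zero: "G 0 = of_real C"
  using G_of_real[of 0] by (simp add: C_def)

lemma nonpos_Int_iff_pole: "z + of_real \<beta> + 2 \<in> \<int>\<^sub>\<le>\<^sub>0 \<longleftrightarrow> z \<in> range pol"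
proof -
  have "z + of_real \<beta> + 2 = - of_nat n \<longleftrightarrow> z = pol n" for n
    by (simp add: pol_def complex_eq_iff) linarith
  moreover have "w \<in> \<int>\<^sub>\<le>\<^sub>0 \<longleftrightarrow> (\<exists>n. w = - of_nat n)" for w :: complex
    by (auto elim!: nonpos_Ints_cases')
  ultimately show ?thesis by auto
qed

text \<open>
  Both sides are holomorphic off a countable closed set, whose complement is connected, and they agree on the
  positive real axis.
\<close>

lemma Beta_eq_G:
  assumes "z \<notin> range pol"
  shows "Beta (z + of_real \<beta> + 2) (of_real \<beta> + 1) = G z"
proof -
  have pos: "of_real x \<notin> range pol" if "0 < x" for x
    using that \<beta>_pos by (auto simp: pol_def complex_eq_iff)
  have "Beta (z + of_real \<beta> + 2) (of_real \<beta> + 1) - G z = 0"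
  proof (rule analytic_continuation[of "\<lambda>z. Beta (z + of_real \<beta> + 2) (of_real \<beta> + 1) - G z" "- range pol" "of_real ` {0<..}" 1])
    have "complex_of_real \<beta> + 1 \<notin> \<int>\<^sub>\<le>\<^sub>0"
      using \<beta>_pos by (auto elim!: nonpos_Ints_cases' simp: complex_eq_iff)
    then show "(\<lambda>z. Beta (z + of_real \<beta> + 2) (of_real \<beta> + 1) - G z) holomorphic_on - range pol"
      using nonpos_Int_iff_pole holomorphic_on_subset[OF G_holomorphic, of "- range pol"]
      by (intro holomorphic_intros) auto
    show "open (- range pol)" using closed_pol by blast
    have "path_connected (- range pol)" by (rule path_connected_complement_countable) auto
    then show "connected (- range pol)" by (rule path_connected_imp_connected)
    show "complex_of_real ` {0<..} \<subseteq> - range pol"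
    proof
      fix w :: complex assume "w \<in> of_real ` {0<..}"
      then obtain x where "w = of_real x" "0 < x" by force
      then show "w \<in> - range pol" using pos[of x] by simp
    qed
    show "1 \<in> - range pol" using pos[of 1] by simp
    show "(1::complex) islimpt complex_of_real ` {0<..}"
      unfolding islimpt_approachable
    proof (intro allI impI)
      fix e :: real assume "0 < e"
      moreover have "dist (complex_of_real (1 + e/2)) 1 = \<bar>e / 2\<bar>"
        by (simp add: dist_norm norm_divide)
      ultimately show "\<exists>x'\<in>complex_of_real ` {0<..}. x' \<noteq> 1 \<and> dist x' 1 < e"
        by (intro bexI[of _ "complex_of_real (1 + e/2)"] imageI) auto
    qed
    fix w :: complex assume "w \<in> of_real ` {0<..}"
    then obtain x where x: "w = of_real x" "0 < x" by force
    have "Beta (complex_of_real (x + \<beta> + 2)) (of_real (\<beta> + 1)) = of_real (Beta (x + \<beta> + 2) (\<beta> + 1))"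
      by (rule Beta_complex_of_real)
    then show "Beta (w + of_real \<beta> + 2) (of_real \<beta> + 1) - G w = 0"
      using x G_of_real[of x] by simp
  qed (use assms in auto)
  then show ?thesis by simp
qed

lemma G_split:
  assumes "k \<in> J" "norm (z - pol k) < 1"
  shows "G z = of_real (rc k) / (z - pol k) + cauchy_sum (\<lambda>k. of_real (rc k)) pol (J - {k}) z"
  unfolding G_def
proof (rule cauchy_sum_split[OF coeff_abs_summable])
  \<comment> \<open>Distinct poles have distance at least 1, which leaves this much for the others.\<close>
  show "0 < 1 - norm (z - pol k)" using assms by simp
  fix i assume "i \<in> J - {k}"
  then have "1 \<le> norm (pol i - pol k)" by (intro pol_dist) auto
  then show "1 - norm (z - pol k) \<le> norm (z - pol i)"
    using norm_triangle_ineq4[of "z - pol k" "z - pol i"] by simp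
qed (use assms in auto)

lemma rest_holomorphic: "cauchy_sum (\<lambda>k. of_real (rc k)) pol (J - {k}) holomorphic_on ball (pol k) 1"
proof (rule cauchy_sum_holomorphic[OF coeff_abs_summable])
  fix i assume "i \<in> J - {k}"
  then show "pol i \<notin> ball (pol k) 1" using pol_dist[of i k] by (auto simp: dist_norm norm_minus_commute)
qed auto

lemma G_pole:
  assumes "k \<in> J"
  shows "is_pole (\<lambda>z. of_real C - G z) (pol k)"
proof -
  define r where "r = cauchy_sum (\<lambda>k. of_real (rc k)) pol (J - {k})"
  have "isCont r (pol k)"
    using holomorphic_on_imp_continuous_on[OF rest_holomorphic[of k]] unfolding r_def
    by (simp add: continuous_on_eq_continuous_at)
  then have lim: "((\<lambda>z. of_real C - r z) \<longlongrightarrow> of_real C - r (pol k)) (at (pol k))"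
    by (intro tendsto_intros) (simp add: isCont_def)
  have "is_pole (\<lambda>z. - of_real (rc k) * (1 / (z - pol k))) (pol k)"
    using assms is_pole_inverse[of "pol k"] by (subst is_pole_cmult_iff) (auto simp: J_def)
  then have "is_pole (\<lambda>z. (of_real C - r z) + - of_real (rc k) * (1 / (z - pol k))) (pol k)"
    unfolding is_pole_def by (rule tendsto_add_filterlim_at_infinity[OF lim])
  moreover have "\<forall>\<^sub>F z in at (pol k). (of_real C - r z) + - of_real (rc k) * (1 / (z - pol k)) = of_real C - G z"
    using eventually_at_ball[of 1 "pol k" UNIV]
    by (simp add: eventually_mono G_split[OF assms] r_def dist_norm norm_minus_commute)
  ultimately show ?thesis by (rule is_pole_transform) auto
qed

text \<open>
  Where the nominal pole \<open>pol k\<close> has residue 0, removing singularities restores the value of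
  \<open>C - G\<close>; at the genuine poles it produces the value 0.
\<close>

lemma phi_eq: "phi \<beta> z = (if z \<in> pol ` J then 0 else of_real C - G z)"
proof -
  have "\<forall>\<^sub>F w in at z. w \<in> - range pol"
  proof -
    have "range pol - {z} = pol ` {k. pol k \<noteq> z}" by auto
    then have "open (- (range pol - {z}))" using closed_pol by (metis open_Compl)
    then have "\<forall>\<^sub>F w in nhds z. w \<in> - (range pol - {z})"
      by (rule eventually_nhds_in_open) simp
    then show ?thesis by (auto simp: eventually_at_filter elim: eventually_mono)
  qed
  then have "\<forall>\<^sub>F w in at z. Beta (of_real \<beta> + 2) (of_real \<beta> + 1) - Beta (w + of_real \<beta> + 2) (of_real \<beta> + 1) = of_real C - G w"
  proof eventually_elim
    case (elim w)
    have "Beta (complex_of_real (\<beta> + 2)) (of_real (\<beta> + 1)) = of_real C"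
      unfolding C_def by (rule Beta_complex_of_real)
    then show ?case using Beta_eq_G[of w] elim by simp
  qed
  then have eq: "phi \<beta> z = remove_sings (\<lambda>z. of_real C - G z) z"
    unfolding phi_def by (rule remove_sings_cong) simp
  show ?thesis
  proof (cases "z \<in> pol ` J")
    case True
    then show ?thesis using eq G_pole by auto
  next
    case False
    then have "(\<lambda>z. of_real C - G z) analytic_on {z}"
      using G_holomorphic closed_pol[of J]
      by (intro analytic_intros analytic_on_subset[of G "- pol ` J" "{z}"])
        (auto simp: analytic_on_open[OF open_Compl])
    then show ?thesis using eq False by simp
  qed
qed

lemma eventually_not_pole: "\<forall>\<^sub>F w in at z. w \<notin> pol ` J"
proof -
  have "pol ` J - {z} = pol ` {k \<in> J. pol k \<noteq> z}" by auto
  then have "open (- (pol ` J - {z}))" using closed_pol by (metis open_Compl)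
  then have "\<forall>\<^sub>F w in nhds z. w \<in> - (pol ` J - {z})"
    by (rule eventually_nhds_in_open) simp
  then show ?thesis by (auto simp: eventually_at_filter elim: eventually_mono)
qed

lemma phi_holomorphic: "phi \<beta> holomorphic_on - pol ` J"
proof -
  have "(\<lambda>z. of_real C - G z) holomorphic_on - pol ` J"
    by (intro holomorphic_intros G_holomorphic)
  then show ?thesis by (rule holomorphic_transform) (simp add: phi_eq)
qed

lemma phi_analytic: "z \<notin> pol ` J \<Longrightarrow> phi \<beta> analytic_on {z}"
  using phi_holomorphic closed_pol[of J]
  by (intro analytic_on_subset[of "phi \<beta>" "- pol ` J" "{z}"]) (auto simp: analytic_on_open[OF open_Compl])

lemma phi_pole: "z \<in> pol ` J \<Longrightarrow> is_pole (phi \<beta>) z"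
  using G_pole is_pole_cong[OF eventually_mono[OF eventually_not_pole[of z]], of "phi \<beta>" "\<lambda>z. of_real C - G z" z]
  by (auto simp: phi_eq)

lemma is_pole_phi_iff: "is_pole (phi \<beta>) z \<longleftrightarrow> z \<in> pol ` J"
  using phi_pole phi_analytic analytic_at not_is_pole_holomorphic by metis

lemma phi_nicely_meromorphic: "phi \<beta> nicely_meromorphic_on UNIV"
proof (rule nicely_meromorphic_onI_open[where pts = "pol ` J"])
  show "phi \<beta> analytic_on UNIV - pol ` J"
    using phi_holomorphic closed_pol[of J] by (simp add: analytic_on_open[OF open_Compl] Compl_eq_Diff_UNIV[symmetric])
  show "is_pole (phi \<beta>) x \<and> phi \<beta> x = 0" if "x \<in> pol ` J" for x
    using phi_pole[OF that] that by (simp add: phi_eq)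
  show "isolated_singularity_at (phi \<beta>) x" for x
  proof -
    have "pol ` J - {x} = pol ` {k \<in> J. pol k \<noteq> x}" by auto
    then have op: "open (- (pol ` J - {x}))" using closed_pol by (metis open_Compl)
    show ?thesis
      by (rule isolated_singularity_at_holomorphic[of _ "- (pol ` J - {x})"])
        (use op in \<open>auto intro: holomorphic_on_subset[OF phi_holomorphic]\<close>)
  qed
qed auto

lemma zeros_iff: "z \<in> zeros \<beta> \<longleftrightarrow> z \<noteq> 0 \<and> z \<notin> pol ` J \<and> G z = of_real C"
  by (auto simp: zeros_def is_pole_phi_iff phi_eq)

lemma zero_not_pole: "0 \<notin> pol ` J"
  using \<beta>_pos by (auto simp: pol_def complex_eq_iff)

lemma phi_zero: "phi \<beta> 0 = 0"
  using zero_not_pole by (simp add: phi_eq G_zero)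

section \<open>The Levy density\<close>

lemma set_integrable_Re:
  fixes f :: "'a \<Rightarrow> complex"
  assumes "set_integrable M A f"
  shows "set_integrable M A (\<lambda>x. Re (f x))"
  using integrable_Re[OF assms[unfolded set_integrable_def]] unfolding set_integrable_def by simp

text \<open>
  The Levy density of the subordinator: the Beta integral under \<open>s = exp (- x)\<close>.
\<close>

definition levy :: "real \<Rightarrow> real" where
  "levy x = exp (- ((\<beta> + 2) * x)) * (1 - exp (- x)) powr \<beta>"

lemma levy_nonneg: "0 \<le> levy x" by (simp add: levy_def)

lemma levy_pos: "0 < x \<Longrightarrow> 0 < levy x" by (simp add: levy_def)

lemma levy_le_one: "0 < x \<Longrightarrow> levy x \<le> 1"
  unfolding levy_def using \<beta>_pos by (intro mult_le_one powr_le1) auto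

lemma levy_continuous: "continuous_on {0<..} levy"
  unfolding levy_def by (intro continuous_intros) auto

lemma levy_series:
  assumes "0 < x"
  shows "(\<Sum>\<^sub>\<infinity>k\<in>J. of_real (rc k) * exp ((pol k - z) * of_real x)) = exp (- z * of_real x) * of_real (levy x)"
proof -
  have e: "\<bar>- exp (- x)\<bar> < 1" using assms by simp
  have s1: "(\<lambda>k. rc k * exp (- ((\<beta> + 2 + real k) * x))) sums levy x"
  proof -
    have "(\<lambda>k. exp (- ((\<beta> + 2) * x)) * ((\<beta> gchoose k) * (- exp (- x)) ^ k)) sums levy x"
      using sums_mult[OF gen_binomial_real[OF e, of \<beta>], of "exp (- ((\<beta> + 2) * x))"] by (simp add: levy_def)
    moreover have "exp (- ((\<beta> + 2) * x)) * ((\<beta> gchoose k) * (- exp (- x)) ^ k) = rc k * exp (- ((\<beta> + 2 + real k) * x))" for k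
    proof -
      have "(- exp (- x)) ^ k = (- 1) ^ k * exp (- (real k * x))"
        by (simp add: power_minus[of "exp (- x)"] exp_of_nat_mult[symmetric])
      moreover have "exp (- ((\<beta> + 2) * x)) * exp (- (real k * x)) = exp (- ((\<beta> + 2 + real k) * x))"
        by (simp add: exp_add[symmetric] algebra_simps)
      ultimately show ?thesis by (simp add: rc_def algebra_simps)
    qed
    ultimately show ?thesis by simp
  qed
  have "summable (\<lambda>k. norm (rc k * exp (- ((\<beta> + 2 + real k) * x))))"
  proof (rule summable_comparison_test'[OF rc_summable])
    fix k :: nat
    have "0 \<le> (\<beta> + 2 + real k) * x" using assms \<beta>_pos by simp
    then show "norm (norm (rc k * exp (- ((\<beta> + 2 + real k) * x)))) \<le> \<bar>rc k\<bar>"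
      by (simp add: abs_mult mult_left_le)
  qed
  from norm_summable_imp_has_sum[OF this s1]
  have "((\<lambda>k. complex_of_real (rc k * exp (- ((\<beta> + 2 + real k) * x)))) has_sum of_real (levy x)) UNIV"
    by (simp only: has_sum_of_real_iff)
  from has_sum_cmult_right[OF this, of "exp (- z * of_real x)"]
  have "((\<lambda>k. of_real (rc k) * exp ((pol k - z) * of_real x)) has_sum (exp (- z * of_real x) * of_real (levy x))) UNIV"
  proof (rule has_sum_cong[THEN iffD1, rotated])
    fix k
    have "(pol k - z) * of_real x = - z * of_real x + of_real (- ((\<beta> + 2 + real k) * x))"
      by (simp add: pol_def algebra_simps)
    then have "exp ((pol k - z) * of_real x) = exp (- z * of_real x) * of_real (exp (- ((\<beta> + 2 + real k) * x)))"
      by (simp only: exp_add exp_of_real)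
    then show "exp (- z * of_real x) * of_real (rc k * exp (- ((\<beta> + 2 + real k) * x))) = of_real (rc k) * exp ((pol k - z) * of_real x)"
      by simp
  qed
  then show ?thesis by (intro infsumI) (simp only: has_sum_J_iff)
qed

lemma G_laplace:
  assumes "0 \<le> Re z"
  shows "set_integrable lborel {0<..} (\<lambda>x. exp (- z * of_real x) * of_real (levy x))"
    and "G z = (LBINT x:{0<..}. exp (- z * of_real x) * of_real (levy x))"
proof -
  have r: "Re (pol k - z) \<le> - (\<beta> + 2)" for k using Re_pol[of k] assms by simp
  have \<kappa>: "0 < \<beta> + 2" using \<beta>_pos by simp
  note E = exp_sum_properties[where r = "\<lambda>k. pol k - z" and I = J, OF coeff_abs_summable \<kappa> r]
  show "set_integrable lborel {0<..} (\<lambda>x. exp (- z * of_real x) * of_real (levy x))"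
    using E(1) by (rule iffD1[OF set_integrable_cong, rotated -1]) (simp_all add: levy_series)
  have "(LBINT x:{0<..}. exp (- z * of_real x) * of_real (levy x)) =
     (LBINT x:{0<..}. \<Sum>\<^sub>\<infinity>k\<in>J. of_real (rc k) * exp ((pol k - z) * of_real x))"
    by (rule set_lebesgue_integral_cong) (auto simp: levy_series)
  also have "\<dots> = G z" unfolding E(2) G_def cauchy_sum_def by simp
  finally show "G z = (LBINT x:{0<..}. exp (- z * of_real x) * of_real (levy x))" ..
qed

lemma levy_laplace_real:
  assumes "0 \<le> s"
  shows "set_integrable lborel {0<..} (\<lambda>x. exp (- s * x) * levy x)"
    and "G (of_real s) = of_real (LBINT x:{0<..}. exp (- s * x) * levy x)"
proof -
  have *: "exp (- of_real s * of_real x) * complex_of_real (levy x) = of_real (exp (- s * x) * levy x)" for x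
    by (simp add: exp_of_real[symmetric] del: exp_of_real)
  have "set_integrable lborel {0<..} (\<lambda>x. complex_of_real (exp (- s * x) * levy x))"
    using G_laplace(1)[of "of_real s"] assms unfolding * by simp
  from set_integrable_Re[OF this] show "set_integrable lborel {0<..} (\<lambda>x. exp (- s * x) * levy x)" by simp
  show "G (of_real s) = of_real (LBINT x:{0<..}. exp (- s * x) * levy x)"
    by (subst G_laplace(2)) (use assms in simp, simp only: * set_integral_complex_of_real)
qed

text \<open>
  \<open>C - Re (G z)\<close> is the integral of the nonnegative function \<open>f\<close>. If it were not
  positive, \<open>f\<close> would vanish identically, so that \<open>exp (- z x)\<close> would have real part 1
  for all \<open>x > 0\<close>, which happens for \<open>z = 0\<close> only.
\<close>

lemma Re_G_less_C:
  assumes "0 \<le> Re z" "z \<noteq> 0"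
  shows "Re (G z) < C"
proof (rule ccontr)
  assume "\<not> Re (G z) < C"
  define f where "f x = (1 - Re (exp (- z * of_real x))) * levy x" for x
  have int: "set_integrable lborel {0<..} (\<lambda>x. Re (exp (- z * of_real x) * of_real (levy x)))"
    by (rule set_integrable_Re[OF G_laplace(1)[OF assms(1)]])
  have "Re (G z) = (LBINT x:{0<..}. Re (exp (- z * of_real x) * of_real (levy x)))"
    unfolding G_laplace(2)[OF assms(1)] using G_laplace(1)[OF assms(1)]
    unfolding set_lebesgue_integral_def set_integrable_def by (subst integral_Re[symmetric]) auto
  moreover have "C = (LBINT x:{0<..}. levy x)"
    using levy_laplace_real(2)[of 0] G_zero by simp
  moreover have "f = (\<lambda>x. levy x - Re (exp (- z * of_real x) * of_real (levy x)))"
    by (auto simp: f_def algebra_simps)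
  ultimately have f: "set_integrable lborel {0<..} f" "(LBINT x:{0<..}. f x) = C - Re (G z)"
    using levy_laplace_real(1)[of 0] int by (auto simp: set_integral_diff)
  have "Re (exp (- z * of_real x)) = 1" if x: "0 < x" for x
  proof -
    have "f x = 0"
    proof (rule continuous_nonneg_integral_zero[OF _ _ f(1) _ x])
      show "continuous_on {0<..} f" unfolding f_def by (intro continuous_intros levy_continuous)
      show "(LBINT x:{0<..}. f x) \<le> 0" using f(2) \<open>\<not> Re (G z) < C\<close> by simp
      fix x :: real assume "0 < x"
      then have "norm (exp (- z * of_real x)) \<le> 1" using assms by simp
      then have "Re (exp (- z * of_real x)) \<le> 1" by (meson complex_Re_le_cmod order_trans)
      then show "0 \<le> f x" unfolding f_def using levy_nonneg by (intro mult_nonneg_nonneg) auto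
    qed
    then show ?thesis using levy_pos[OF x] by (simp add: f_def)
  qed
  then have *: "exp (- (Re z * x)) * cos (Im z * x) = 1" if "0 < x" for x
    using that by (simp add: Re_exp)
  \<comment> \<open>The point \<open>x = 1\<close> forces \<open>Re z = 0\<close>; at \<open>x = pi / \<bar>Im z\<bar>\<close> the cosine is \<open>-1\<close>.\<close>
  have "exp (- Re z) * cos (Im z) = 1" using *[of 1] by simp
  moreover have "exp (- Re z) * cos (Im z) \<le> exp (- Re z) * 1"
    by (intro mult_left_mono) auto
  ultimately have a: "Re z = 0" using assms(1) by simp
  then have b: "Im z \<noteq> 0" using assms(2) by (simp add: complex_eq_iff)
  have "cos (Im z * (pi / \<bar>Im z\<bar>)) = 1" using *[of "pi / \<bar>Im z\<bar>"] a b by simp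
  moreover have "Im z * (pi / \<bar>Im z\<bar>) = pi \<or> Im z * (pi / \<bar>Im z\<bar>) = - pi"
    using b by (auto simp: abs_if)
  ultimately show False by auto
qed

lemma zeros_Re_neg: "z \<in> zeros \<beta> \<Longrightarrow> Re z < 0"
  using Re_G_less_C[of z] by (auto simp: zeros_iff not_less[symmetric])

lemma phi_of_real:
  assumes "0 < s"
  shows "phi \<beta> (of_real s) = of_real (C - (LBINT x:{0<..}. exp (- s * x) * levy x))"
    and "(LBINT x:{0<..}. exp (- s * x) * levy x) < C"
proof -
  have np: "complex_of_real s \<notin> pol ` J" using assms \<beta>_pos by (auto simp: pol_def complex_eq_iff)
  show "phi \<beta> (of_real s) = of_real (C - (LBINT x:{0<..}. exp (- s * x) * levy x))"
    using np levy_laplace_real(2)[of s] assms by (simp add: phi_eq)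
  show "(LBINT x:{0<..}. exp (- s * x) * levy x) < C"
    using Re_G_less_C[of "of_real s"] levy_laplace_real(2)[of s] assms by simp
qed

text \<open>
  The difference quotient of \<open>\<phi>\<close> at 0 along the positive reals is bounded below by a positive
  constant, obtained from \<open>1 - exp (- s x) \<ge> s x exp (- s x) \<ge> s x exp (- x)\<close> for
  \<open>s \<le> 1\<close>.
\<close>

lemma mu_nonzero: "mu \<beta> \<noteq> 0"
proof -
  \<comment> \<open>The factor \<open>exp (- x)\<close> makes integrability immediate.\<close>
  define m where "m = (LBINT x:{0<..}. x * (exp (- x) * levy x))"
  have int: "set_integrable lborel {0<..} (\<lambda>x. x * (exp (- x) * levy x))"
  proof (rule set_integrable_bound[OF levy_laplace_real(1)[of 0]])
    have "continuous_on {0<..} (\<lambda>x. x * (exp (- x) * levy x))" by (intro continuous_intros levy_continuous)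
    then show "set_borel_measurable lborel {0<..} (\<lambda>x. x * (exp (- x) * levy x))"
      unfolding set_borel_measurable_def
      using borel_measurable_continuous_on_indicator[of "{0<..}" "\<lambda>x. x * (exp (- x) * levy x)"] by simp
    show "AE x in lborel. x \<in> {0<..} \<longrightarrow> norm (x * (exp (- x) * levy x)) \<le> norm (exp (- 0 * x) * levy x)"
    proof (intro AE_I2 impI)
      fix x :: real assume "x \<in> {0<..}"
      have "x \<le> exp x" using exp_ge_add_one_self[of x] by linarith
      then have "x * exp (- x) \<le> 1" by (simp add: exp_minus field_simps)
      then show "norm (x * (exp (- x) * levy x)) \<le> norm (exp (- 0 * x) * levy x)"
        using \<open>x \<in> {0<..}\<close> levy_nonneg[of x] mult_right_mono[of "x * exp (- x)" 1 "levy x"] by (simp add: abs_mult mult.assoc)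
    qed
  qed simp
  have "0 < m"
  proof (rule ccontr)
    assume "\<not> 0 < m"
    then have "1 * (exp (- 1) * levy 1) = 0"
      unfolding m_def using levy_nonneg
      by (intro continuous_nonneg_integral_zero[OF _ _ int]) (auto intro!: continuous_intros levy_continuous)
    then show False using levy_pos[of 1] by simp
  qed
  have ineq: "m \<le> Re (phi \<beta> (of_real s) / of_real s)" if s: "0 < s" "s \<le> 1" for s
  proof -
    have "s * m = (LBINT x:{0<..}. s * (x * (exp (- x) * levy x)))" unfolding m_def by simp
    also have "\<dots> \<le> (LBINT x:{0<..}. levy x - exp (- s * x) * levy x)"
    proof (rule set_integral_mono)
      show "set_integrable lborel {0<..} (\<lambda>x. s * (x * (exp (- x) * levy x)))" using int by simp
      show "set_integrable lborel {0<..} (\<lambda>x. levy x - exp (- s * x) * levy x)"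
        using levy_laplace_real(1)[of 0] levy_laplace_real(1)[of s] s by (auto intro: set_integral_diff)
      fix x :: real assume x: "x \<in> {0<..}"
      have "1 + s * x \<le> exp (s * x)" by (rule exp_ge_add_one_self)
      then have "s * x * exp (- (s * x)) \<le> 1 - exp (- (s * x))"
        by (simp add: exp_minus field_simps)
      moreover have "s * x * exp (- x) \<le> s * x * exp (- (s * x))"
        using x s by (intro mult_left_mono) (auto simp: mult_left_le_one_le)
      ultimately have "(s * x * exp (- x)) * levy x \<le> (1 - exp (- (s * x))) * levy x"
        using levy_nonneg by (intro mult_right_mono) auto
      then show "s * (x * (exp (- x) * levy x)) \<le> levy x - exp (- s * x) * levy x"
        by (simp add: algebra_simps)
    qed
    also have "\<dots> = C - (LBINT x:{0<..}. exp (- s * x) * levy x)"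
      using levy_laplace_real[of 0] levy_laplace_real(1)[of s] s G_zero by (subst set_integral_diff) auto
    finally show ?thesis
      unfolding phi_of_real(1)[OF s(1)] of_real_divide[symmetric] Re_complex_of_real using s by (simp add: field_simps)
  qed
  have "(phi \<beta> has_field_derivative mu \<beta>) (at 0)"
    unfolding mu_def using phi_analytic[OF zero_not_pole] by (simp add: analytic_derivI)
  then have "((\<lambda>h. phi \<beta> h / h) \<longlongrightarrow> mu \<beta>) (at 0)"
    using phi_zero by (simp add: DERIV_def)
  moreover have "filterlim complex_of_real (at 0) (at_right 0)"
    unfolding filterlim_at by (auto simp: eventually_at_filter intro!: tendsto_eq_intros)
  ultimately have "((\<lambda>s. phi \<beta> (of_real s) / of_real s) \<longlongrightarrow> mu \<beta>) (at_right 0)"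
    by (rule filterlim_compose)
  then have "((\<lambda>s. Re (phi \<beta> (of_real s) / of_real s)) \<longlongrightarrow> Re (mu \<beta>)) (at_right 0)"
    by (rule tendsto_Re)
  moreover have "\<forall>\<^sub>F s in at_right 0. m \<le> Re (phi \<beta> (of_real s) / of_real s)"
    using ineq by (auto simp: eventually_at_right_field intro: exI[of _ 1])
  ultimately have "m \<le> Re (mu \<beta>)" by (rule tendsto_lowerbound) simp
  then show ?thesis using \<open>0 < m\<close> by auto
qed

end

context beta_exponent
begin

section \<open>Location of the zeros\<close>

lemma phi_zero_sparse: "{z. phi \<beta> z = 0} sparse_in UNIV"
proof -
  have "(\<forall>x\<in>UNIV. phi \<beta> x = 0) \<or> (\<forall>\<^sub>\<approx>x\<in>UNIV. phi \<beta> x \<noteq> 0)"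
    by (rule nicely_meromorphic_imp_constant_or_avoid[OF phi_nicely_meromorphic]) auto
  moreover have "phi \<beta> (of_real 1) \<noteq> 0"
    using phi_of_real[of 1] by (simp del: of_real_1 of_real_eq_1_iff of_real_diff)
  ultimately have "\<forall>\<^sub>\<approx>x\<in>UNIV. phi \<beta> x \<noteq> 0" by blast
  then show ?thesis by (simp add: eventually_cosparse)
qed

lemma zeros_sparse: "zeros \<beta> sparse_in UNIV"
  by (rule sparse_in_subset2[OF phi_zero_sparse]) (auto simp: zeros_def)

lemma finite_zeros_compact: "compact K \<Longrightarrow> finite (zeros \<beta> \<inter> K)"
  using sparse_in_compact_finite[OF sparse_in_subset[OF zeros_sparse]] by (simp add: Int_commute)

lemma closed_zeros_subset: "A \<subseteq> zeros \<beta> \<Longrightarrow> closed A"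
  using sparse_in_UNIV_imp_closed sparse_in_subset2[OF zeros_sparse] by blast

lemma eventually_phi_nonzero: "\<forall>\<^sub>F w in at z. phi \<beta> w \<noteq> 0"
  using phi_zero_sparse by (auto simp: sparse_in_eventually_iff)

lemma G_cnj: "G (cnj z) = cnj (G z)"
  unfolding G_def cauchy_sum_def infsum_cnj[symmetric] by (simp add: pol_def)

lemma pol_real: "pol k \<in> \<real>" by (simp add: pol_def)

lemma zeros_cnj: "z \<in> zeros \<beta> \<Longrightarrow> cnj z \<in> zeros \<beta>"
proof -
  assume z: "z \<in> zeros \<beta>"
  have "cnj z \<notin> pol ` J"
  proof
    assume "cnj z \<in> pol ` J"
    then obtain k where "k \<in> J" "cnj z = pol k" by auto
    then have "z = pol k" using pol_real[of k] by (metis Reals_cnj_iff complex_cnj_cnj)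
    then show False using z \<open>k \<in> J\<close> by (auto simp: zeros_iff)
  qed
  then show ?thesis using z by (simp add: zeros_iff G_cnj)
qed

text \<open>
  With \<open>r\<close> the sum over the other poles, \<open>\<phi> z * (z - pol k) = N z - rc k\<close> for
  \<open>N z = (z - pol k) * (C - r z)\<close>. If \<open>r\<close> is small then so is its derivative by Cauchy's
  estimate, \<open>N\<close> is close to the linear map \<open>C * (z - pol k)\<close>, and therefore injective
  with derivative close to \<open>C\<close>. The bounds keep all constants explicit so that they are uniform in
  \<open>k\<close>.
\<close>

lemma phi_near_pole:
  assumes k: "k \<in> J"
    and small: "\<And>z. norm (z - pol k) \<le> 1/2 \<Longrightarrow> norm (cauchy_sum (\<lambda>k. of_real (rc k)) pol (J - {k}) z) \<le> C / 8"
  obtains N N' where "\<And>z. norm (z - pol k) < 1/4 \<Longrightarrow> (N has_field_derivative N' z) (at z)"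
    and "\<And>z. norm (z - pol k) < 1/4 \<Longrightarrow> norm (N' z - of_real C) \<le> C / 4"
    and "\<And>z. norm (z - pol k) < 1/4 \<Longrightarrow> z \<noteq> pol k \<Longrightarrow> phi \<beta> z * (z - pol k) = N z - of_real (rc k)"
    and "\<And>z. norm (z - pol k) < 1/4 \<Longrightarrow> 3 * C / 4 * norm (z - pol k) \<le> norm (N z)"
    and "\<And>z w. norm (z - pol k) < 1/4 \<Longrightarrow> norm (w - pol k) < 1/4 \<Longrightarrow> N z = N w \<Longrightarrow> z = w"
proof -
  define r where "r = cauchy_sum (\<lambda>k. of_real (rc k)) pol (J - {k})"
  define N where "N z = (z - pol k) * (of_real C - r z)" for z
  define N' where "N' z = of_real C - r z - (z - pol k) * deriv r z" for z
  have hol: "r holomorphic_on ball (pol k) 1" unfolding r_def by (rule rest_holomorphic)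
  have dr: "(r has_field_derivative deriv r z) (at z)" if "norm (z - pol k) < 1/4" for z
    using that by (intro holomorphic_derivI[OF hol]) (auto simp: dist_norm norm_minus_commute)
  have dN: "(N has_field_derivative N' z) (at z)" if "norm (z - pol k) < 1/4" for z
    unfolding N_def N'_def by (rule derivative_eq_intros dr that refl | simp add: algebra_simps)+
  have r_small: "norm (r z) \<le> C / 8" if "norm (z - pol k) \<le> 1/2" for z
    using small[OF that] by (simp add: r_def)
  have dr_small: "norm (deriv r z) \<le> C / 2" if z: "norm (z - pol k) < 1/4" for z
  proof -
    have sub: "cball z (1/4) \<subseteq> ball (pol k) 1"
    proof
      fix w assume "w \<in> cball z (1/4)"
      then show "w \<in> ball (pol k) 1"
        using z norm_triangle_ineq[of "w - z" "z - pol k"] by (auto simp: dist_norm norm_minus_commute)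
    qed
    have "norm ((deriv ^^ 1) r z) \<le> fact 1 * (C / 8) / (1/4) ^ 1"
    proof (rule Cauchy_inequality)
      show "r holomorphic_on ball z (1/4)" using hol sub by (meson ball_subset_cball holomorphic_on_subset)
      show "continuous_on (cball z (1/4)) r" using hol sub by (meson holomorphic_on_imp_continuous_on continuous_on_subset)
      fix w assume "norm (z - w) = 1/4"
      then show "norm (r w) \<le> C / 8"
        using z norm_triangle_ineq[of "w - z" "z - pol k"] by (intro r_small) (auto simp: norm_minus_commute)
    qed simp
    then show ?thesis by simp
  qed
  have N'_small: "norm (N' z - of_real C) \<le> C / 4" if z: "norm (z - pol k) < 1/4" for z
  proof -
    have "norm (N' z - of_real C) = norm (r z + (z - pol k) * deriv r z)"
      unfolding N'_def by (subst norm_minus_cancel[symmetric]) (simp add: algebra_simps)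
    also have "\<dots> \<le> norm (r z) + norm (z - pol k) * norm (deriv r z)"
      using norm_triangle_ineq[of "r z" "(z - pol k) * deriv r z"] by (simp add: norm_mult)
    also have "\<dots> \<le> C / 8 + 1/4 * (C / 2)"
      using z by (intro add_mono mult_mono r_small dr_small) auto
    finally show ?thesis by simp
  qed
  have lip: "norm ((N z - of_real C * z) - (N w - of_real C * w)) \<le> C / 4 * norm (z - w)"
    if z: "norm (z - pol k) < 1/4" and w: "norm (w - pol k) < 1/4" for z w
  proof (rule field_differentiable_bound[where S = "ball (pol k) (1/4)" and f' = "\<lambda>z. N' z - of_real C"])
    fix x assume "x \<in> ball (pol k) (1/4)"
    then have x: "norm (x - pol k) < 1/4" by (simp add: dist_norm norm_minus_commute)
    show "((\<lambda>z. N z - of_real C * z) has_field_derivative N' x - of_real C) (at x within ball (pol k) (1/4))"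
      by (rule derivative_eq_intros DERIV_subset[OF dN[OF x]] refl | simp)+
    show "norm (N' x - of_real C) \<le> C / 4" by (rule N'_small[OF x])
  qed (use z w in \<open>auto simp: dist_norm norm_minus_commute\<close>)
  show thesis
  proof (rule that[of N N'])
    fix z assume z: "norm (z - pol k) < 1/4"
    show "(N has_field_derivative N' z) (at z)" by (rule dN[OF z])
    show "norm (N' z - of_real C) \<le> C / 4" by (rule N'_small[OF z])
    show "phi \<beta> z * (z - pol k) = N z - of_real (rc k)" if ne: "z \<noteq> pol k"
    proof -
      have "z \<notin> pol ` J"
      proof
        assume "z \<in> pol ` J"
        then obtain j where "j \<in> J" "z = pol j" by auto
        then show False using pol_dist[of j k] ne z by force
      qed
      moreover have "G z = of_real (rc k) / (z - pol k) + r z"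
        unfolding r_def using z by (intro G_split[OF k]) simp
      ultimately show ?thesis using ne by (simp add: phi_eq N_def field_simps)
    qed
    have "norm (complex_of_real C) - norm (r z) \<le> norm (of_real C - r z)"
      by (rule norm_triangle_ineq2)
    then have "7 * C / 8 \<le> norm (of_real C - r z)"
      using r_small[of z] z C_pos by simp
    then have "3 * C / 4 \<le> norm (of_real C - r z)" using C_pos by simp
    from mult_right_mono[OF this, of "norm (z - pol k)"]
    show "3 * C / 4 * norm (z - pol k) \<le> norm (N z)"
      by (simp add: N_def norm_mult mult.commute)
  next
    fix z w assume "norm (z - pol k) < 1/4" "norm (w - pol k) < 1/4" and eq: "N z = N w"
    from lip[OF this(1,2)] have "norm (of_real C * (w - z)) \<le> C / 4 * norm (z - w)"
      unfolding eq by (simp add: algebra_simps)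
    then have "C * norm (z - w) \<le> C / 4 * norm (z - w)"
      using C_pos by (simp add: norm_mult norm_minus_commute)
    then have "norm (z - w) \<le> 0" using C_pos by (simp add: field_simps)
    then show "z = w" by simp
  qed
qed

text \<open>
  A zero \<open>z\<close> near \<open>pol k\<close> solves \<open>N z = rc k\<close>, so it is unique by
  injectivity of \<open>N\<close>, and real since its conjugate is another zero equally close to the real point
  \<open>pol k\<close>. Differentiating \<open>\<phi> z * (z - pol k) = N z - rc k\<close> at the zero gives
  \<open>\<phi>' z * (z - pol k) = N' z\<close>, and \<open>\<bar>z - pol k\<bar>\<close> is at most of the order
  \<open>\<bar>rc k\<bar> / C\<close>; hence the bound for \<open>1 / \<phi>'\<close>.
\<close>

lemma zeros_far:
  obtains R where "\<And>z. z \<in> zeros \<beta> \<Longrightarrow> R \<le> norm z \<Longrightarrow> \<exists>k\<in>J. norm (z - pol k) < 1/4"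
    and "\<And>z k. \<lbrakk>z \<in> zeros \<beta>; R \<le> norm z; k \<in> J; norm (z - pol k) < 1/4\<rbrakk> \<Longrightarrow>
        z \<in> \<real> \<and> deriv (phi \<beta>) z \<noteq> 0 \<and> norm (1 / deriv (phi \<beta>) z) \<le> 2 / C\<^sup>2 * \<bar>rc k\<bar>"
    and "\<And>z w k. \<lbrakk>z \<in> zeros \<beta>; R \<le> norm z; w \<in> zeros \<beta>; k \<in> J; norm (z - pol k) < 1/4; norm (w - pol k) < 1/4\<rbrakk> \<Longrightarrow> w = z"
proof -
  obtain R1 where R1: "\<And>K z. R1 \<le> norm z \<Longrightarrow> (\<forall>i\<in>K. 1/2 \<le> norm (z - pol i)) \<Longrightarrow>
      norm (cauchy_sum (\<lambda>k. of_real (rc k)) pol K z) < C / 8"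
    using cauchy_sum_small_at_infinity[OF coeff_abs_summable[of UNIV], of "C / 8" "1/2" pol] C_pos by auto
  obtain R2 where R2: "\<And>K z. R2 \<le> norm z \<Longrightarrow> (\<forall>i\<in>K. 1/4 \<le> norm (z - pol i)) \<Longrightarrow>
      norm (cauchy_sum (\<lambda>k. of_real (rc k)) pol K z) < C"
    using cauchy_sum_small_at_infinity[OF coeff_abs_summable[of UNIV], of "C" "1/4" pol] C_pos by auto
  \<comment> \<open>A point within \<open>1/2\<close> of a pole that is within \<open>1/4\<close> of \<open>z\<close> has norm at least \<open>norm z - 1\<close>.\<close>
  define R where "R = max (R1 + 1) R2"
  have near: "\<exists>k\<in>J. norm (z - pol k) < 1/4" if z: "z \<in> zeros \<beta>" "R \<le> norm z" for z
  proof (rule ccontr)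
    assume "\<not> ?thesis"
    then have "norm (G z) < C" unfolding G_def using z by (intro R2) (auto simp: R_def not_less)
    then show False using z C_pos by (simp add: zeros_iff)
  qed
  have small: "norm (cauchy_sum (\<lambda>k. of_real (rc k)) pol (J - {k}) w) \<le> C / 8"
    if z: "R \<le> norm z" "norm (z - pol k) < 1/4" and w: "norm (w - pol k) \<le> 1/2" for z w k
  proof (rule less_imp_le, rule R1)
    have "norm z \<le> norm (z - pol k) + norm (pol k)" "norm (pol k) \<le> norm (w - pol k) + norm w"
      using norm_triangle_sub[of z "pol k"] norm_triangle_sub[of "pol k" w] by (auto simp: norm_minus_commute)
    then show "R1 \<le> norm w" using z w by (simp add: R_def)
    show "\<forall>i\<in>J - {k}. 1/2 \<le> norm (w - pol i)"
    proof
      fix i assume "i \<in> J - {k}"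
      then have "1 \<le> norm (pol i - pol k)" by (intro pol_dist) auto
      then show "1/2 \<le> norm (w - pol i)"
        using w norm_triangle_ineq4[of "w - pol k" "w - pol i"] by simp
    qed
  qed
  have not_pol: "z \<noteq> pol k" if "z \<in> zeros \<beta>" "k \<in> J" for z k
    using that by (auto simp: zeros_iff)
  have uniq: "w = z" if "z \<in> zeros \<beta>" "R \<le> norm z" "w \<in> zeros \<beta>" "k \<in> J" "norm (z - pol k) < 1/4" "norm (w - pol k) < 1/4" for z w k
  proof -
    note prems = that
    obtain N N' where N: "\<And>z. norm (z - pol k) < 1/4 \<Longrightarrow> z \<noteq> pol k \<Longrightarrow> phi \<beta> z * (z - pol k) = N z - of_real (rc k)"
      and inj: "\<And>z w. norm (z - pol k) < 1/4 \<Longrightarrow> norm (w - pol k) < 1/4 \<Longrightarrow> N z = N w \<Longrightarrow> z = w"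
      using phi_near_pole[OF prems(4) small[OF prems(2,5)]] by metis
    have "N z = of_real (rc k)" "N w = of_real (rc k)"
      using N[of z] N[of w] that not_pol by (auto simp: zeros_def)
    then show "w = z" using inj[of w z] that by simp
  qed
  have main: "z \<in> \<real> \<and> deriv (phi \<beta>) z \<noteq> 0 \<and> norm (1 / deriv (phi \<beta>) z) \<le> 2 / C\<^sup>2 * \<bar>rc k\<bar>"
    if z: "z \<in> zeros \<beta>" "R \<le> norm z" "k \<in> J" "norm (z - pol k) < 1/4" for z k
  proof -
    have "cnj z - pol k = cnj (z - pol k)" using pol_real[of k] by (simp add: Reals_cnj_iff)
    then have "norm (cnj z - pol k) < 1/4" using z(4) by (simp only: complex_mod_cnj)
    from uniq[OF z(1,2) zeros_cnj[OF z(1)] z(3,4) this] have real: "z \<in> \<real>" by (simp add: Reals_cnj_iff)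
    obtain N N' where dN: "(N has_field_derivative N' z) (at z)"
      and N': "norm (N' z - of_real C) \<le> C / 4"
      and N: "\<And>z. norm (z - pol k) < 1/4 \<Longrightarrow> z \<noteq> pol k \<Longrightarrow> phi \<beta> z * (z - pol k) = N z - of_real (rc k)"
      and lower: "3 * C / 4 * norm (z - pol k) \<le> norm (N z)"
      using phi_near_pole[OF z(3) small[OF z(2,4)]] z(4) by metis
    have Nz: "N z = of_real (rc k)" using N[OF z(4) not_pol[OF z(1,3)]] z(1) by (simp add: zeros_def)
    have dphi: "(phi \<beta> has_field_derivative deriv (phi \<beta>) z) (at z)"
      using phi_analytic[of z] z(1) by (intro analytic_derivI) (simp add: zeros_iff)
    have "((\<lambda>z. phi \<beta> z * (z - pol k)) has_field_derivative deriv (phi \<beta>) z * (z - pol k)) (at z)"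
      using z(1) by (auto intro!: derivative_eq_intros dphi simp: zeros_def)
    moreover have "((\<lambda>z. phi \<beta> z * (z - pol k)) has_field_derivative N' z) (at z)"
    proof (rule DERIV_cong_ev[THEN iffD1, OF refl _ refl])
      show "((\<lambda>z. N z - of_real (rc k)) has_field_derivative N' z) (at z)"
        using dN by (auto intro!: derivative_eq_intros)
      have "open (ball (pol k) (1/4) - {pol k})" by auto
      moreover have "z \<in> ball (pol k) (1/4) - {pol k}"
        using z not_pol[OF z(1,3)] by (auto simp: dist_norm norm_minus_commute)
      ultimately have "\<forall>\<^sub>F w in nhds z. w \<in> ball (pol k) (1/4) - {pol k}"
        by (rule eventually_nhds_in_open)
      then show "\<forall>\<^sub>F w in nhds z. N w - of_real (rc k) = phi \<beta> w * (w - pol k)"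
        by eventually_elim (simp add: N dist_norm norm_minus_commute)
    qed
    ultimately have eq: "deriv (phi \<beta>) z * (z - pol k) = N' z" by (rule DERIV_unique)
    have "norm (complex_of_real C) \<le> norm (N' z) + norm (N' z - of_real C)"
      using norm_triangle_sub[of "of_real C" "N' z"] by (simp add: norm_minus_commute)
    then have lower': "3 * C / 4 \<le> norm (deriv (phi \<beta>) z) * norm (z - pol k)"
      using N' C_pos unfolding norm_mult[symmetric] eq by simp
    then have pos: "0 < norm (deriv (phi \<beta>) z)" using C_pos by (cases "deriv (phi \<beta>) z = 0") auto
    have "3 * C / 4 * (3 * C / 4) \<le> (norm (deriv (phi \<beta>) z) * norm (z - pol k)) * (3 * C / 4)"
      using lower' C_pos by (intro mult_right_mono) auto
    also have "\<dots> = norm (deriv (phi \<beta>) z) * (3 * C / 4 * norm (z - pol k))" by simp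
    also have "\<dots> \<le> norm (deriv (phi \<beta>) z) * \<bar>rc k\<bar>"
      using lower Nz by (intro mult_left_mono) auto
    finally have "C\<^sup>2 / 2 \<le> norm (deriv (phi \<beta>) z) * \<bar>rc k\<bar>"
      by (simp add: power2_eq_square) (use C_pos in \<open>smt (verit) mult_pos_pos\<close>)
    then have "norm (1 / deriv (phi \<beta>) z) \<le> 2 / C\<^sup>2 * \<bar>rc k\<bar>"
      using pos C_pos by (simp add: norm_divide field_simps)
    then show ?thesis using real pos by simp
  qed
  show thesis by (rule that[of R]) (use near main uniq in blast)+
qed

text \<open>
  The order of the zero is the order of the power series of \<open>\<phi>\<close> there, whose linear coefficient
  is the derivative.
\<close>

lemma mult_le_1_iff:
  assumes "z \<notin> pol ` J" "phi \<beta> z = 0"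
  shows "mult \<beta> z \<le> 1 \<longleftrightarrow> deriv (phi \<beta>) z \<noteq> 0" and "1 \<le> mult \<beta> z"
    and "0 < zorder (phi \<beta>) z"
proof -
  have an: "phi \<beta> analytic_on {z}" and 0: "phi \<beta> z = 0"
    using assms phi_analytic by auto
  have nz: "\<exists>\<^sub>F w in at z. phi \<beta> w \<noteq> 0"
    using eventually_phi_nonzero[of z] by (simp add: eventually_frequently)
  have pos: "0 < zorder (phi \<beta>) z" using zorder_pos_iff'[OF an nz] 0 by simp
  have F: "(\<lambda>w. phi \<beta> (z + w)) has_fps_expansion fps_expansion (phi \<beta>) z"
    by (rule analytic_at_imp_has_fps_expansion[OF an])
  have F0: "fps_expansion (phi \<beta>) z \<noteq> 0"
  proof
    assume eq: "fps_expansion (phi \<beta>) z = 0"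
    have "\<forall>\<^sub>F w in nhds 0. eval_fps (fps_expansion (phi \<beta>) z) w = phi \<beta> (z + w)"
      using F unfolding has_fps_expansion_def by simp
    then have "\<forall>\<^sub>F w in nhds z. phi \<beta> w = 0"
      unfolding eq nhds_to_0[of z] eventually_filtermap by (auto elim: eventually_mono simp: add.commute)
    then have "\<forall>\<^sub>F w in at z. phi \<beta> w = 0" by (simp add: eventually_at_filter eventually_mono)
    with nz show False by (simp add: frequently_def)
  qed
  have sub: "zorder (phi \<beta>) z = int (subdegree (fps_expansion (phi \<beta>) z))"
    by (rule has_fps_expansion_zorder[OF F F0])
  show "mult \<beta> z \<le> 1 \<longleftrightarrow> deriv (phi \<beta>) z \<noteq> 0"
  proof
    assume "mult \<beta> z \<le> 1"
    then have "subdegree (fps_expansion (phi \<beta>) z) = 1" using sub pos by (simp add: mult_def)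
    then have "fps_nth (fps_expansion (phi \<beta>) z) 1 \<noteq> 0" using F0 by (metis nth_subdegree_nonzero)
    then show "deriv (phi \<beta>) z \<noteq> 0" by (simp add: fps_expansion_def)
  next
    assume "deriv (phi \<beta>) z \<noteq> 0"
    then have "zorder (phi \<beta>) z = 1"
      using 0 by (intro zorder_zero_eqI'[OF an]) auto
    then show "mult \<beta> z \<le> 1" by (simp add: mult_def)
  qed
  show "0 < zorder (phi \<beta>) z" "1 \<le> mult \<beta> z" using pos by (auto simp: mult_def)
qed

lemma zeros_phi_zero: "z \<in> zeros \<beta> \<Longrightarrow> z \<notin> pol ` J" "z \<in> zeros \<beta> \<Longrightarrow> phi \<beta> z = 0"
  by (auto simp: zeros_iff phi_eq)

lemma simple_zeros_deriv: "s \<in> simple_zeros \<beta> \<Longrightarrow> s \<in> zeros \<beta> \<and> s \<in> \<real> \<and> deriv (phi \<beta>) s \<noteq> 0"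
  using mult_le_1_iff(1)[OF zeros_phi_zero, of s] by (auto simp: simple_zeros_def exc_zeros_def not_less)

text \<open>
  Far zeros are real and simple, so the exceptional ones lie in a compact set, where the isolated zeros of
  \<open>\<phi>\<close> are finite in number.
\<close>

lemma finite_exc_zeros: "finite (exc_zeros \<beta>)"
proof -
  obtain R where near: "\<And>z. z \<in> zeros \<beta> \<Longrightarrow> R \<le> norm z \<Longrightarrow> \<exists>k\<in>J. norm (z - pol k) < 1/4"
    and str: "\<And>z k. \<lbrakk>z \<in> zeros \<beta>; R \<le> norm z; k \<in> J; norm (z - pol k) < 1/4\<rbrakk> \<Longrightarrow>
        z \<in> \<real> \<and> deriv (phi \<beta>) z \<noteq> 0 \<and> norm (1 / deriv (phi \<beta>) z) \<le> 2 / C\<^sup>2 * \<bar>rc k\<bar>"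
    by (rule zeros_far) blast
  have "exc_zeros \<beta> \<subseteq> zeros \<beta> \<inter> cball 0 R"
  proof
    fix z assume z: "z \<in> exc_zeros \<beta>"
    then have zz: "z \<in> zeros \<beta>" by (simp add: exc_zeros_def)
    have "norm z < R"
    proof (rule ccontr)
      assume "\<not> norm z < R"
      then have "R \<le> norm z" by simp
      with near[OF zz] str[OF zz] have "z \<in> \<real> \<and> deriv (phi \<beta>) z \<noteq> 0" by blast
      then show False using z mult_le_1_iff(1)[OF zeros_phi_zero[OF zz]] by (auto simp: exc_zeros_def)
    qed
    then show "z \<in> zeros \<beta> \<inter> cball 0 R" using zz by simp
  qed
  then show ?thesis using finite_zeros_compact[of "cball 0 R"] by (rule finite_subset) simp
qed

text \<open>
  Assigning to each far zero the nearby pole is injective, which bounds the sum of the residues of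
  \<open>1 / \<phi>\<close> by a multiple of the sum of the \<open>\<bar>rc k\<bar>\<close>.
\<close>

lemma residues_abs_summable: "(\<lambda>s. norm (1 / deriv (phi \<beta>) s)) summable_on simple_zeros \<beta>"
proof -
  obtain R where near: "\<And>z. z \<in> zeros \<beta> \<Longrightarrow> R \<le> norm z \<Longrightarrow> \<exists>k\<in>J. norm (z - pol k) < 1/4"
    and str: "\<And>z k. \<lbrakk>z \<in> zeros \<beta>; R \<le> norm z; k \<in> J; norm (z - pol k) < 1/4\<rbrakk> \<Longrightarrow>
        z \<in> \<real> \<and> deriv (phi \<beta>) z \<noteq> 0 \<and> norm (1 / deriv (phi \<beta>) z) \<le> 2 / C\<^sup>2 * \<bar>rc k\<bar>"
    and uniq: "\<And>z w k. \<lbrakk>z \<in> zeros \<beta>; R \<le> norm z; w \<in> zeros \<beta>; k \<in> J; norm (z - pol k) < 1/4; norm (w - pol k) < 1/4\<rbrakk> \<Longrightarrow> w = z"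
    by (rule zeros_far) blast
  define Z where "Z = {z \<in> zeros \<beta>. R \<le> norm z}"
  obtain \<kappa> where \<kappa>: "\<And>z. z \<in> Z \<Longrightarrow> \<kappa> z \<in> J \<and> norm (z - pol (\<kappa> z)) < 1/4"
    using near unfolding Z_def by (metis (mono_tags, lifting) mem_Collect_eq)
  have inj: "inj_on \<kappa> Z"
  proof
    fix z w assume zw: "z \<in> Z" "w \<in> Z" "\<kappa> z = \<kappa> w"
    then show "z = w" using uniq[of w z "\<kappa> z"] \<kappa>[of z] \<kappa>[of w] by (auto simp: Z_def)
  qed
  have "(\<lambda>k. norm (complex_of_real (rc k))) summable_on \<kappa> ` Z" by (rule coeff_abs_summable)
  then have "(\<lambda>z. \<bar>rc (\<kappa> z)\<bar>) summable_on Z"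
    using summable_on_reindex[OF inj, of "\<lambda>k. \<bar>rc k\<bar>"] by (simp add: o_def)
  then have "(\<lambda>z. 2 / C\<^sup>2 * \<bar>rc (\<kappa> z)\<bar>) summable_on Z" by (rule summable_on_cmult_right)
  then have far: "(\<lambda>s. norm (1 / deriv (phi \<beta>) s)) summable_on Z"
    by (rule summable_on_comparison_test) (use str \<kappa> in \<open>auto simp: Z_def\<close>)
  have "finite (zeros \<beta> \<inter> cball 0 R)" by (rule finite_zeros_compact) simp
  then have "finite (simple_zeros \<beta> - Z)"
    by (rule rev_finite_subset) (auto simp: simple_zeros_def Z_def)
  then have "(\<lambda>s. norm (1 / deriv (phi \<beta>) s)) summable_on (simple_zeros \<beta> - Z) \<union> (simple_zeros \<beta> \<inter> Z)"
    using summable_on_subset_banach[OF far, of "simple_zeros \<beta> \<inter> Z"] by (intro summable_on_Un_disjoint) auto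
  then show ?thesis by (simp add: Un_Diff_Int)
qed

end

section \<open>Partial fractions\<close>

text \<open>
  Subtracting the negative part leaves a Laurent series without negative powers, which has a limit at the centre.
\<close>

lemma subtract_principal_part_tendsto:
  assumes "isolated_singularity_at f \<rho>" "not_essential f \<rho>" and "\<And>l. l > m \<Longrightarrow> fls_nth (laurent_expansion f \<rho>) (- int l) = 0"
  shows "\<exists>c. (\<lambda>z. f z - (\<Sum>l=1..m. fls_nth (laurent_expansion f \<rho>) (- int l) / (z - \<rho>) ^ l)) \<midarrow>\<rho>\<rightarrow> c"
proof -
  define F where "F = laurent_expansion f \<rho>"
  define P where "P = (\<Sum>l=1..m. fls_const (fls_nth F (- int l)) * fls_X_inv ^ l)"
  have F: "(\<lambda>w. f (\<rho> + w)) has_laurent_expansion F"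
    unfolding F_def using assms(1,2) by (rule not_essential_has_laurent_expansion)
  have "(\<lambda>w. f (\<rho> + w) - (\<Sum>l=1..m. fls_nth F (- int l) * inverse w ^ l)) has_laurent_expansion F - P"
    unfolding P_def by (intro laurent_expansion_intros F)
  then have "(\<lambda>w. f (\<rho> + w) - (\<Sum>l=1..m. fls_nth F (- int l) / (\<rho> + w - \<rho>) ^ l)) has_laurent_expansion F - P"
    by (simp add: divide_inverse power_inverse)
  moreover have "fls_nth (F - P) n = 0" if n: "n < 0" for n
  proof -
    define l where "l = nat (- n)"
    have l: "n = - int l" "1 \<le> l" using n by (auto simp: l_def)
    have "fls_nth P n = (\<Sum>j=1..m. fls_nth F (- int j) * (if l = j then 1 else 0))"
      unfolding P_def fls_nth_sum l(1) by (intro sum.cong refl) auto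
    also have "\<dots> = (if l \<le> m then fls_nth F (- int l) else 0)"
      using l(2) by (simp add: if_distrib cong: if_cong)
    also have "\<dots> = fls_nth F n" using assms(3)[of l] l by (auto simp: F_def)
    finally show ?thesis by simp
  qed
  then have "0 \<le> fls_subdegree (F - P)" by (rule fls_subdegree_ge0I)
  ultimately show ?thesis
    unfolding F_def[symmetric]
    using has_laurent_expansion_imp_tendsto[of "\<lambda>z. f z - (\<Sum>l=1..m. fls_nth F (- int l) / (z - \<rho>) ^ l)" \<rho>] by blast
qed

context beta_exponent
begin

lemma phi_meromorphic: "phi \<beta> meromorphic_on A"
  using phi_nicely_meromorphic meromorphic_on_subset unfolding nicely_meromorphic_on_def by blast

lemma inv_phi_singularity:
  "isolated_singularity_at (\<lambda>z. 1 / phi \<beta> z) \<rho>" "not_essential (\<lambda>z. 1 / phi \<beta> z) \<rho>"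
proof -
  have "(\<lambda>z. 1 / phi \<beta> z) meromorphic_on {\<rho>}"
    by (intro meromorphic_intros phi_meromorphic)
  then show "isolated_singularity_at (\<lambda>z. 1 / phi \<beta> z) \<rho>" "not_essential (\<lambda>z. 1 / phi \<beta> z) \<rho>"
    by (auto simp: meromorphic_at_iff)
qed

lemma zorder_inv_phi: "zorder (\<lambda>z. 1 / phi \<beta> z) \<rho> = - zorder (phi \<beta>) \<rho>"
proof -
  have "phi \<beta> meromorphic_on {\<rho>}" by (rule phi_meromorphic)
  moreover have "\<exists>\<^sub>F w in at \<rho>. phi \<beta> w \<noteq> 0"
    using eventually_phi_nonzero[of \<rho>] by (simp add: eventually_frequently)
  ultimately show ?thesis
    using zorder_inverse[of "phi \<beta>" \<rho>] by (simp add: meromorphic_at_iff inverse_eq_divide)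
qed

lemma laurent_inv_phi: "(\<lambda>w. 1 / phi \<beta> (\<rho> + w)) has_laurent_expansion laurent_expansion (\<lambda>z. 1 / phi \<beta> z) \<rho>"
  using not_essential_has_laurent_expansion[OF inv_phi_singularity] .

lemma pp_coeff_beyond_mult:
  assumes "\<rho> \<notin> pol ` J" "phi \<beta> \<rho> = 0" "mult \<beta> \<rho> < l"
  shows "pp_coeff \<beta> \<rho> l = 0"
proof (cases "laurent_expansion (\<lambda>z. 1 / phi \<beta> z) \<rho> = 0")
  case False
  have "fls_subdegree (laurent_expansion (\<lambda>z. 1 / phi \<beta> z) \<rho>) = - zorder (phi \<beta>) \<rho>"
    using has_laurent_expansion_zorder[OF laurent_inv_phi False] zorder_inv_phi by simp
  moreover have "zorder (phi \<beta>) \<rho> < int l"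
    using mult_le_1_iff(3)[OF assms(1,2)] assms(3) by (simp add: mult_def)
  ultimately show ?thesis unfolding pp_coeff_def by (intro fls_eq0_below_subdegree) simp
qed (simp add: pp_coeff_def)

lemma inv_phi_minus_principal_part:
  assumes "\<rho> \<notin> pol ` J" "phi \<beta> \<rho> = 0"
  shows "\<exists>c. (\<lambda>z. 1 / phi \<beta> z - principal_part \<beta> \<rho> z) \<midarrow>\<rho>\<rightarrow> c"
  using subtract_principal_part_tendsto[OF inv_phi_singularity, of "mult \<beta> \<rho>" \<rho>] pp_coeff_beyond_mult[OF assms]
  unfolding principal_part_def pp_coeff_def by blast

lemma principal_part_simple:
  assumes "\<rho> \<notin> pol ` J" "phi \<beta> \<rho> = 0" "deriv (phi \<beta>) \<rho> \<noteq> 0"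
  shows "principal_part \<beta> \<rho> z = 1 / deriv (phi \<beta>) \<rho> / (z - \<rho>)"
proof -
  have m: "mult \<beta> \<rho> = 1" using mult_le_1_iff[OF assms(1,2)] assms(3) by simp
  have "open (- pol ` J)" using closed_pol by blast
  then obtain e where e: "0 < e" "ball \<rho> e \<subseteq> - pol ` J"
    using assms(1) by (meson ComplI open_contains_ball)
  have "residue (\<lambda>w. 1 / phi \<beta> w) \<rho> = 1 / deriv (phi \<beta>) \<rho>"
  proof (rule residue_simple_pole_deriv[of _ "ball \<rho> e"])
    show "phi \<beta> holomorphic_on ball \<rho> e" by (rule holomorphic_on_subset[OF phi_holomorphic e(2)])
    show "(phi \<beta> has_field_derivative deriv (phi \<beta>) \<rho>) (at \<rho>)"
      by (rule analytic_derivI[OF phi_analytic[OF assms(1)]])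
  qed (use e assms in auto)
  then have "pp_coeff \<beta> \<rho> 1 = 1 / deriv (phi \<beta>) \<rho>"
    using has_laurent_expansion_residue[OF laurent_inv_phi[of \<rho>]] by (simp add: pp_coeff_def)
  then show ?thesis unfolding principal_part_def m by simp
qed

text \<open>
  At the poles of \<open>\<phi>\<close> the total function \<open>1 / \<phi>\<close> takes the value
  \<open>1 / 0 = 0\<close>, which is the correct one, so analyticity holds there too.
\<close>

lemma inv_phi_analytic:
  assumes "z \<notin> zeros \<beta>" "z \<noteq> 0"
  shows "(\<lambda>z. 1 / phi \<beta> z) analytic_on {z}"
proof -
  have "\<not> isolated_zero (phi \<beta>) z"
  proof
    assume iz: "isolated_zero (phi \<beta>) z"
    then have "\<not> is_pole (phi \<beta>) z" using pole_is_not_zero by blast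
    then have an: "phi \<beta> analytic_on {z}" using phi_analytic is_pole_phi_iff by blast
    then have "phi \<beta> z = 0" using iz zero_isolated_zero_analytic by blast
    then show False using assms \<open>\<not> is_pole (phi \<beta>) z\<close> by (simp add: zeros_def)
  qed
  then have "\<not> is_pole (\<lambda>z. inverse (phi \<beta> z)) z" by (simp add: is_pole_inverse_iff)
  then have "(\<lambda>z. inverse (phi \<beta> z)) analytic_on {z}"
    by (intro nicely_meromorphic_on_imp_analytic_at[OF nicely_meromorphic_on_inverse[OF phi_nicely_meromorphic]]) auto
  then show ?thesis by (simp add: inverse_eq_divide)
qed

definition exc_part :: "complex \<Rightarrow> complex" where
  "exc_part z = (\<Sum>\<rho>\<in>exc_zeros \<beta>. principal_part \<beta> \<rho> z)"

definition simple_part :: "complex \<Rightarrow> complex" where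
  "simple_part = cauchy_sum (\<lambda>s. 1 / deriv (phi \<beta>) s) (\<lambda>s. s) (simple_zeros \<beta>)"

definition defect :: "complex \<Rightarrow> complex" where
  "defect z = 1 / phi \<beta> z - 1 / of_real C - 1 / (mu \<beta> * z) - exc_part z - simple_part z"

lemma principal_part_analytic: "z \<noteq> \<rho> \<Longrightarrow> principal_part \<beta> \<rho> analytic_on {z}"
  unfolding principal_part_def[abs_def] by (intro analytic_intros) auto

lemma zeros_split: "zeros \<beta> = exc_zeros \<beta> \<union> simple_zeros \<beta>" "exc_zeros \<beta> \<inter> simple_zeros \<beta> = {}"
  by (auto simp: simple_zeros_def exc_zeros_def)

lemma exc_part_analytic: "z \<notin> exc_zeros \<beta> \<Longrightarrow> exc_part analytic_on {z}"
  unfolding exc_part_def[abs_def] by (intro analytic_intros principal_part_analytic) auto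

lemma simple_part_holomorphic:
  assumes A: "A \<subseteq> simple_zeros \<beta>"
  shows "cauchy_sum (\<lambda>s. 1 / deriv (phi \<beta>) s) (\<lambda>s. s) A holomorphic_on - A" and "open (- A)"
proof -
  have "A \<subseteq> zeros \<beta>" using A zeros_split(1) by blast
  from closed_zeros_subset[OF this] show "open (- A)" by (rule open_Compl)
  then show "cauchy_sum (\<lambda>s. 1 / deriv (phi \<beta>) s) (\<lambda>s. s) A holomorphic_on - A"
    by (rule cauchy_sum_holomorphic[OF summable_on_subset_banach[OF residues_abs_summable A]]) simp
qed

lemma simple_part_analytic:
  "A \<subseteq> simple_zeros \<beta> \<Longrightarrow> z \<notin> A \<Longrightarrow> cauchy_sum (\<lambda>s. 1 / deriv (phi \<beta>) s) (\<lambda>s. s) A analytic_on {z}"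
  using simple_part_holomorphic[of A] by (meson ComplI holomorphic_on_imp_analytic_at)

lemma zero_notin_zeros: "0 \<notin> zeros \<beta>" by (simp add: zeros_def)

lemma analytic_at_tendsto: "f analytic_on {z} \<Longrightarrow> \<exists>c. f \<midarrow>z\<rightarrow> c"
  using analytic_at_imp_isCont isContD by blast

lemma defect_analytic: "z \<notin> zeros \<beta> \<Longrightarrow> z \<noteq> 0 \<Longrightarrow> defect analytic_on {z}"
  unfolding defect_def[abs_def] simple_part_def using mu_nonzero zeros_split
  by (intro analytic_intros inv_phi_analytic exc_part_analytic simple_part_analytic) auto

lemma tendsto_const_ex: "\<exists>c. ((\<lambda>x. k) \<longlongrightarrow> c) F"
  using tendsto_const by blast

lemma tendsto_diff_ex: "\<exists>c. (f \<longlongrightarrow> c) F \<Longrightarrow> \<exists>c. (g \<longlongrightarrow> c) F \<Longrightarrow> \<exists>c. ((\<lambda>x. f x - g x :: complex) \<longlongrightarrow> c) F"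
  using tendsto_diff by blast

lemma simple_part_split:
  assumes "s \<in> simple_zeros \<beta>"
  obtains e where "0 < e" "\<And>z. norm (z - s) < e \<Longrightarrow>
    simple_part z = 1 / deriv (phi \<beta>) s / (z - s) + cauchy_sum (\<lambda>s. 1 / deriv (phi \<beta>) s) (\<lambda>s. s) (simple_zeros \<beta> - {s}) z"
proof -
  have "closed (simple_zeros \<beta> - {s})" by (rule closed_zeros_subset) (auto simp: simple_zeros_def)
  then obtain e where e: "0 < e" "cball s e \<subseteq> - (simple_zeros \<beta> - {s})"
    by (metis Compl_iff Diff_iff insertI1 open_Compl open_contains_cball)
  have "simple_part z = 1 / deriv (phi \<beta>) s / (z - s) + cauchy_sum (\<lambda>s. 1 / deriv (phi \<beta>) s) (\<lambda>s. s) (simple_zeros \<beta> - {s}) z"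
    if z: "norm (z - s) < e / 2" for z
    unfolding simple_part_def
  proof (rule cauchy_sum_split[OF residues_abs_summable])
    show "0 < e / 2" using e by simp
    fix i assume "i \<in> simple_zeros \<beta> - {s}"
    then have "i \<notin> cball s e" using e by blast
    then have "e < norm (i - s)" by (simp add: dist_norm norm_minus_commute)
    then show "e / 2 \<le> norm (z - i)"
      using z norm_triangle_ineq4[of "z - s" "z - i"] by simp
  qed (rule assms)
  then show thesis using that[of "e/2"] e by simp
qed

text \<open>
  Near each zero exactly one summand of the expansion is singular apart from \<open>1 / \<phi>\<close> itself, and
  it is the principal part of \<open>1 / \<phi>\<close> there; at 0 the principal part is
  \<open>1 / (\<mu> z)\<close>. The remaining summands are analytic at that point.
\<close>

lemma defect_tendsto: "\<exists>c. defect \<midarrow>w\<rightarrow> c"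
proof -
  consider "w \<notin> zeros \<beta>" "w \<noteq> 0" | "w = 0" | "w \<in> exc_zeros \<beta>" | "w \<in> simple_zeros \<beta>"
    using zeros_split by blast
  then show ?thesis
  proof cases
    case 1
    then show ?thesis by (intro analytic_at_tendsto defect_analytic)
  next
    case 2
    have np: "0 \<notin> exc_zeros \<beta>" "0 \<notin> simple_zeros \<beta>" using zero_notin_zeros zeros_split by auto
    have pp: "principal_part \<beta> 0 z = 1 / (mu \<beta> * z)" for z
      using principal_part_simple[OF zero_not_pole phi_zero] mu_nonzero by (simp add: mu_def)
    have "\<exists>c. (\<lambda>z. (1 / phi \<beta> z - principal_part \<beta> 0 z) - 1 / of_real C - exc_part z - simple_part z) \<midarrow>0\<rightarrow> c"
      unfolding simple_part_def using np
      by (intro tendsto_diff_ex inv_phi_minus_principal_part zero_not_pole phi_zero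
          analytic_at_tendsto[OF exc_part_analytic] analytic_at_tendsto[OF simple_part_analytic] tendsto_const_ex) auto
    then show ?thesis unfolding 2 defect_def[abs_def] pp by (simp add: algebra_simps)
  next
    case 3
    then have w: "w \<in> zeros \<beta>" "w \<notin> simple_zeros \<beta>" "w \<noteq> 0" using zeros_split zero_notin_zeros by auto
    define E where "E z = (\<Sum>\<rho>\<in>exc_zeros \<beta> - {w}. principal_part \<beta> \<rho> z)" for z
    have E: "exc_part z = principal_part \<beta> w z + E z" for z
      unfolding exc_part_def E_def by (rule sum.remove[OF finite_exc_zeros 3])
    have E_an: "E analytic_on {w}"
      unfolding E_def[abs_def] by (intro analytic_intros principal_part_analytic) auto
    have mu_an: "(\<lambda>z. 1 / (mu \<beta> * z)) analytic_on {w}" using mu_nonzero w by (intro analytic_intros) auto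
    have "\<exists>c. (\<lambda>z. (1 / phi \<beta> z - principal_part \<beta> w z) - 1 / of_real C - 1 / (mu \<beta> * z) - E z - simple_part z) \<midarrow>w\<rightarrow> c"
      unfolding simple_part_def using w
      by (intro tendsto_diff_ex inv_phi_minus_principal_part zeros_phi_zero analytic_at_tendsto[OF E_an]
          analytic_at_tendsto[OF mu_an] analytic_at_tendsto[OF simple_part_analytic] tendsto_const_ex) auto
    then show ?thesis unfolding defect_def[abs_def] E by (simp add: algebra_simps)
  next
    case 4
    then have w: "w \<in> zeros \<beta>" "w \<notin> exc_zeros \<beta>" "w \<noteq> 0" using zeros_split zero_notin_zeros by auto
    define T where "T = cauchy_sum (\<lambda>s. 1 / deriv (phi \<beta>) s) (\<lambda>s. s) (simple_zeros \<beta> - {w})"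
    have pp: "principal_part \<beta> w z = 1 / deriv (phi \<beta>) w / (z - w)" for z
      using simple_zeros_deriv[OF 4] by (intro principal_part_simple zeros_phi_zero) auto
    obtain e where e: "0 < e" "\<And>z. norm (z - w) < e \<Longrightarrow> simple_part z = principal_part \<beta> w z + T z"
      using simple_part_split[OF 4] unfolding T_def pp by metis
    have T_an: "T analytic_on {w}" unfolding T_def by (rule simple_part_analytic) auto
    have mu_an: "(\<lambda>z. 1 / (mu \<beta> * z)) analytic_on {w}" using mu_nonzero w by (intro analytic_intros) auto
    have "\<exists>c. (\<lambda>z. (1 / phi \<beta> z - principal_part \<beta> w z) - 1 / of_real C - 1 / (mu \<beta> * z) - exc_part z - T z) \<midarrow>w\<rightarrow> c"
      using w
      by (intro tendsto_diff_ex inv_phi_minus_principal_part zeros_phi_zero analytic_at_tendsto[OF T_an]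
          analytic_at_tendsto[OF mu_an] analytic_at_tendsto[OF exc_part_analytic] tendsto_const_ex) auto
    then obtain c where c: "(\<lambda>z. (1 / phi \<beta> z - principal_part \<beta> w z) - 1 / of_real C - 1 / (mu \<beta> * z) - exc_part z - T z) \<midarrow>w\<rightarrow> c"
      by blast
    have "defect \<midarrow>w\<rightarrow> c"
    proof (rule Lim_transform_eventually[OF c])
      have "\<forall>\<^sub>F z in at w. norm (z - w) < e"
        using eventually_at_ball[OF e(1), of w UNIV] by (simp add: dist_norm norm_minus_commute)
      then show "\<forall>\<^sub>F z in at w. 1 / phi \<beta> z - principal_part \<beta> w z - 1 / of_real C - 1 / (mu \<beta> * z) - exc_part z - T z = defect z"
        by eventually_elim (simp add: defect_def e(2) algebra_simps)
    qed
    then show ?thesis ..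
  qed
qed

lemma defect_extension_holomorphic: "remove_sings defect holomorphic_on UNIV"
proof -
  have "remove_sings defect analytic_on {w}" for w
  proof -
    have cl: "closed ((zeros \<beta> \<union> {0}) - {w})"
    proof -
      have "closed (zeros \<beta> - {w})" by (rule closed_zeros_subset) auto
      moreover have "closed ({0} - {w})" by (intro finite_imp_closed) simp
      ultimately show ?thesis unfolding Un_Diff by (rule closed_Un)
    qed
    have "isolated_singularity_at defect w"
    proof (rule isolated_singularity_at_holomorphic)
      show "open (- ((zeros \<beta> \<union> {0}) - {w}))" using cl by blast
      have "defect analytic_on (- ((zeros \<beta> \<union> {0}) - {w})) - {w}"
        by (subst analytic_on_analytic_at) (use defect_analytic in auto)
      then show "defect holomorphic_on (- ((zeros \<beta> \<union> {0}) - {w})) - {w}"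
        by (rule analytic_imp_holomorphic)
    qed simp
    moreover obtain c where "defect \<midarrow>w\<rightarrow> c" using defect_tendsto by blast
    ultimately show ?thesis by (rule remove_sings_analytic_at)
  qed
  then have "remove_sings defect analytic_on UNIV" by (subst analytic_on_analytic_at) blast
  then show ?thesis by (rule analytic_imp_holomorphic)
qed

lemma principal_part_tendsto_0: "(principal_part \<beta> \<rho> \<longlongrightarrow> 0) at_infinity"
proof -
  have "((\<lambda>z. pp_coeff \<beta> \<rho> l / (z - \<rho>) ^ l) \<longlongrightarrow> 0) at_infinity" if "l \<in> {1..mult \<beta> \<rho>}" for l
  proof -
    have "filterlim (\<lambda>z. - \<rho> + z) at_infinity at_infinity"
      by (rule tendsto_add_filterlim_at_infinity[OF tendsto_const filterlim_ident])
    then have "filterlim (\<lambda>z. (- \<rho> + z) ^ l) at_infinity at_infinity"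
      by (rule Limits.filterlim_power_at_infinity) (use that in simp)
    then show ?thesis by (intro tendsto_divide_0[OF tendsto_const]) simp
  qed
  then show ?thesis unfolding principal_part_def[abs_def] by (intro tendsto_null_sum) auto
qed

lemma exc_part_tendsto_0: "(exc_part \<longlongrightarrow> 0) at_infinity"
  unfolding exc_part_def[abs_def] by (intro tendsto_null_sum principal_part_tendsto_0)

lemma inv_phi_near_eta:
  assumes "0 < \<epsilon>"
  shows "\<exists>R. \<forall>z. R \<le> norm z \<longrightarrow> (\<forall>k. 1/2 \<le> norm (z - pol k)) \<longrightarrow> norm (1 / phi \<beta> z - 1 / of_real C) < \<epsilon>"
proof -
  define d where "d = min (C / 2) (\<epsilon> * C\<^sup>2 / 2)"
  have d: "0 < d" "d \<le> C / 2" "d \<le> \<epsilon> * C\<^sup>2 / 2" using C_pos assms by (auto simp: d_def)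
  obtain R where R: "\<And>z. R \<le> norm z \<Longrightarrow> (\<forall>k\<in>J. 1/2 \<le> norm (z - pol k)) \<Longrightarrow> norm (G z) < d"
    using cauchy_sum_small_at_infinity[OF coeff_abs_summable[of J] d(1), of "1/2" pol] unfolding G_def by auto
  show ?thesis
  proof (intro exI[of _ R] allI impI)
    fix z assume z: "R \<le> norm z" "\<forall>k. 1/2 \<le> norm (z - pol k)"
    have "z \<notin> pol ` J"
    proof
      assume "z \<in> pol ` J"
      then obtain k where "z = pol k" by blast
      then show False using z(2)[rule_format, of k] by simp
    qed
    then have phi: "phi \<beta> z = of_real C - G z" by (simp add: phi_eq)
    have g: "norm (G z) < d" using R z by blast
    have "C - norm (G z) \<le> norm (phi \<beta> z)"
      unfolding phi using norm_triangle_ineq2[of "complex_of_real C" "G z"] C_pos by simp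
    then have phi_ge: "C / 2 < norm (phi \<beta> z)" using g d by linarith
    then have nz: "phi \<beta> z \<noteq> 0" using C_pos by auto
    have "1 / phi \<beta> z - 1 / of_real C = G z / (phi \<beta> z * of_real C)"
      using nz C_pos by (simp add: field_simps phi)
    then have "norm (1 / phi \<beta> z - 1 / of_real C) = norm (G z) / (norm (phi \<beta> z) * C)"
      using C_pos by (simp add: norm_divide norm_mult)
    also have "\<dots> < d / (C / 2 * C)"
      using g phi_ge C_pos d by (intro frac_less mult_strict_right_mono less_imp_le[OF mult_strict_right_mono]) auto
    also have "\<dots> \<le> \<epsilon>" using d C_pos by (simp add: power2_eq_square field_simps)
    finally show "norm (1 / phi \<beta> z - 1 / of_real C) < \<epsilon>" .
  qed
qed

text \<open>
  Each of the four parts of the defect is made smaller than \<open>\<epsilon> / 4\<close>. Zeros far out are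
  within \<open>1/4\<close> of a pole, so points at distance at least \<open>1/2\<close> from all poles keep
  distance \<open>1/4\<close> from the zeros.
\<close>

lemma defect_small_on_circles:
  assumes "0 < \<epsilon>"
  shows "\<exists>R. \<forall>z. R \<le> norm z \<longrightarrow> (\<forall>k. 1/2 \<le> norm (z - pol k)) \<longrightarrow> z \<notin> zeros \<beta> \<and> z \<noteq> 0 \<and> norm (defect z) < \<epsilon>"
proof -
  have e4: "0 < \<epsilon> / 4" using assms by simp
  obtain R0 where near: "\<And>z. z \<in> zeros \<beta> \<Longrightarrow> R0 \<le> norm z \<Longrightarrow> \<exists>k\<in>J. norm (z - pol k) < 1/4"
    by (rule zeros_far) blast
  obtain R1 where R1: "\<And>z. R1 \<le> norm z \<Longrightarrow> (\<forall>k. 1/2 \<le> norm (z - pol k)) \<Longrightarrow> norm (1 / phi \<beta> z - 1 / of_real C) < \<epsilon> / 4"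
    using inv_phi_near_eta[OF e4] by blast
  obtain R2 where R2: "\<And>z. R2 \<le> norm z \<Longrightarrow> norm (exc_part z) < \<epsilon> / 4"
    using tendstoD[OF exc_part_tendsto_0 e4] unfolding eventually_at_infinity by auto
  have "\<exists>R. \<forall>A z. A \<subseteq> simple_zeros \<beta> \<longrightarrow> R \<le> norm z \<longrightarrow> (\<forall>s\<in>A. 1/4 \<le> norm (z - s)) \<longrightarrow>
      norm (cauchy_sum (\<lambda>s. 1 / deriv (phi \<beta>) s) (\<lambda>s. s) A z) < \<epsilon> / 4"
    by (rule cauchy_sum_small_at_infinity[OF residues_abs_summable e4]) simp
  then obtain R3 where R3: "\<And>z. R3 \<le> norm z \<Longrightarrow> (\<forall>s\<in>simple_zeros \<beta>. 1/4 \<le> norm (z - s)) \<Longrightarrow> norm (simple_part z) < \<epsilon> / 4"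
    unfolding simple_part_def by (meson order_refl)
  define R where "R = max (R0 + 1) (max R1 (max R2 (max R3 (max (8 / (\<epsilon> * norm (mu \<beta>))) 1))))"
  have R: "R0 + 1 \<le> R" "R1 \<le> R" "R2 \<le> R" "R3 \<le> R" "8 / (\<epsilon> * norm (mu \<beta>)) \<le> R" "1 \<le> R"
    unfolding R_def by (simp_all only: le_max_iff_disj order_refl simp_thms)
  show ?thesis
  proof (intro exI[of _ R] allI impI)
    fix z assume z: "R \<le> norm z" "\<forall>k. 1/2 \<le> norm (z - pol k)"
    have far: "1/4 \<le> norm (z - s)" if s: "s \<in> zeros \<beta>" for s
    proof (cases "R0 \<le> norm s")
      case True
      then obtain k where "norm (s - pol k) < 1/4" using near[OF s] by blast
      moreover have "1/2 \<le> norm (z - pol k)" using z by blast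
      ultimately show ?thesis using norm_triangle_ineq[of "z - s" "s - pol k"] by simp
    next
      case False
      then show ?thesis using z R norm_triangle_ineq2[of z s] by simp
    qed
    have z0: "z \<noteq> 0" using z R by auto
    have zz: "z \<notin> zeros \<beta>" using far[of z] by auto
    have "norm (1 / (mu \<beta> * z)) = 1 / (norm (mu \<beta>) * norm z)" by (simp add: norm_divide norm_mult)
    also have "\<dots> < \<epsilon> / 4"
    proof -
      have "8 / (\<epsilon> * norm (mu \<beta>)) \<le> norm z" using z R by linarith
      then have "8 \<le> norm z * (\<epsilon> * norm (mu \<beta>))" using assms mu_nonzero by (simp add: divide_le_eq)
      then show ?thesis using assms mu_nonzero z0 by (simp add: field_simps)
    qed
    finally have m: "norm (1 / (mu \<beta> * z)) < \<epsilon> / 4" .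
    have "norm (defect z) \<le> norm (1 / phi \<beta> z - 1 / of_real C) + norm (1 / (mu \<beta> * z)) + norm (exc_part z) + norm (simple_part z)"
      unfolding defect_def by (intro order_trans[OF norm_triangle_ineq4] add_mono order_refl)
    also have "\<dots> < \<epsilon> / 4 + \<epsilon> / 4 + \<epsilon> / 4 + \<epsilon> / 4"
      using z R m far zeros_split by (intro add_strict_mono R1 R2 R3) auto
    finally show "z \<notin> zeros \<beta> \<and> z \<noteq> 0 \<and> norm (defect z) < \<epsilon>" using z0 zz by simp
  qed
qed

text \<open>
  The poles lie on the negative real axis at consecutive distances 1, and the circle passes halfway between two of
  them.
\<close>

lemma circle_avoids_poles:
  assumes "norm z = \<beta> + 2 + real j + 1/2"
  shows "1/2 \<le> norm (z - pol k)"
proof -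
  have p: "norm (pol k) = \<beta> + 2 + real k"
    unfolding pol_def norm_minus_cancel norm_of_real using \<beta>_pos by simp
  have "real k \<le> real j \<or> real (Suc j) \<le> real k" unfolding of_nat_le_iff by linarith
  then have "1/2 \<le> \<bar>real j + 1/2 - real k\<bar>" by auto
  also have "\<dots> = \<bar>norm z - norm (pol k)\<bar>" using assms p by simp
  also have "\<dots> \<le> norm (z - pol k)" by (rule norm_triangle_ineq3)
  finally show ?thesis .
qed

lemma defect_extension_zero: "remove_sings defect z = 0"
proof -
  have "norm (remove_sings defect z) \<le> \<epsilon>" if \<epsilon>: "0 < \<epsilon>" for \<epsilon>
  proof -
    obtain R where R: "\<And>w. R \<le> norm w \<Longrightarrow> (\<forall>k. 1/2 \<le> norm (w - pol k)) \<Longrightarrow> w \<notin> zeros \<beta> \<and> w \<noteq> 0 \<and> norm (defect w) < \<epsilon>"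
      using defect_small_on_circles[OF \<epsilon>] by blast
    obtain j :: nat where j: "max R (norm z) < real j" using reals_Archimedean2 by blast
    \<comment> \<open>The radius lies halfway between the moduli of the \<open>j\<close>-th pole and the next one.\<close>
    define r where "r = \<beta> + 2 + real j + 1/2"
    have r: "R \<le> r" "norm z < r" "0 < r" using j \<beta>_pos by (auto simp: r_def)
    show ?thesis
    proof (rule maximum_modulus_frontier[where f = "remove_sings defect" and S = "ball 0 r"])
      show "remove_sings defect holomorphic_on interior (ball 0 r)"
        by (rule holomorphic_on_subset[OF defect_extension_holomorphic]) auto
      show "continuous_on (closure (ball 0 r)) (remove_sings defect)"
        by (rule continuous_on_subset[OF holomorphic_on_imp_continuous_on[OF defect_extension_holomorphic]]) auto
      fix w :: complex assume "w \<in> frontier (ball 0 r)"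
      then have w: "norm w = r" using r by simp
      then have "w \<notin> zeros \<beta> \<and> w \<noteq> 0 \<and> norm (defect w) < \<epsilon>"
        using circle_avoids_poles[of w j] r unfolding r_def by (intro R) auto
      then show "norm (remove_sings defect w) \<le> \<epsilon>" using defect_analytic[of w] by simp
    qed (use r in auto)
  qed
  then have "norm (remove_sings defect z) \<le> 0" by (rule field_le_epsilon) simp
  then show ?thesis by simp
qed

theorem partial_fractions:
  assumes "z \<notin> zeros \<beta>" "z \<noteq> 0"
  shows "1 / phi \<beta> z = 1 / of_real C + 1 / (mu \<beta> * z) + exc_part z + simple_part z"
  using defect_extension_zero[of z] defect_analytic[OF assms] by (simp add: defect_def algebra_simps)

text \<open>
  Both sides are the limit of \<open>1 / \<phi> z - 1 / (\<mu> z)\<close> at 0, computed from the partial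
  fractions and from the Taylor polynomial of degree 2.
\<close>

lemma constant_term:
  "1 / of_real C + exc_part 0 + simple_part 0 = - (deriv ^^ 2) (phi \<beta>) 0 / (2 * (mu \<beta>)\<^sup>2)"
proof -
  define F where "F = fps_expansion (phi \<beta>) 0"
  have F: "phi \<beta> has_fps_expansion F"
    unfolding F_def by (rule analytic_at_imp_has_fps_expansion_0[OF phi_analytic[OF zero_not_pole]])
  have F_nth: "fps_nth F 0 = 0" "fps_nth F 1 = mu \<beta>" "fps_nth F 2 = (deriv ^^ 2) (phi \<beta>) 0 / 2"
    by (auto simp: F_def fps_expansion_def phi_zero mu_def)
  define Q where "Q = F - fps_const (mu \<beta>) * fps_X"
  have Q: "(\<lambda>z. phi \<beta> z - mu \<beta> * z) has_fps_expansion Q"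
    unfolding Q_def by (intro fps_expansion_intros F)
  have Q_nth: "fps_nth Q n = 0" if "n < 2" for n
    using that F_nth(1,2) less_2_cases[OF that] by (auto simp: Q_def)
  have Q2: "fps_nth Q 2 = (deriv ^^ 2) (phi \<beta>) 0 / 2" using F_nth(3) by (simp add: Q_def fps_X_def)
  have "((\<lambda>z. (phi \<beta> z - mu \<beta> * z) / z ^ 2) \<longlongrightarrow> fps_nth Q 2) (at 0)"
  proof (cases "Q = 0")
    case True
    have "\<forall>\<^sub>F z in nhds 0. phi \<beta> z - mu \<beta> * z = 0"
      using Q unfolding True has_fps_expansion_def by (auto elim: eventually_mono)
    then have "\<forall>\<^sub>F z in at 0. (phi \<beta> z - mu \<beta> * z) / z ^ 2 = 0"
      by (simp add: eventually_at_filter eventually_mono)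
    then show ?thesis unfolding True by (simp add: tendsto_eventually)
  next
    case False
    then have "2 \<le> subdegree Q" using Q_nth by (intro subdegree_geI) auto
    from has_fps_expansion_shift[OF Q this refl]
    have "isCont (\<lambda>x. if x = 0 then fps_nth Q 2 else (phi \<beta> x - mu \<beta> * x) / x ^ 2) 0"
      using has_fps_expansion_imp_continuous by blast
    then have "((\<lambda>x. if x = 0 then fps_nth Q 2 else (phi \<beta> x - mu \<beta> * x) / x ^ 2) \<longlongrightarrow> fps_nth Q 2) (at 0)"
      by (simp add: isCont_def)
    then show ?thesis
      by (rule Lim_transform_eventually) (auto simp: eventually_at_filter)
  qed
  moreover have "(phi \<beta> has_field_derivative mu \<beta>) (at 0)"
    unfolding mu_def using phi_analytic[OF zero_not_pole] by (rule analytic_derivI)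
  then have "((\<lambda>h. phi \<beta> h / h) \<longlongrightarrow> mu \<beta>) (at 0)"
    using phi_zero by (simp add: DERIV_def)
  ultimately have "((\<lambda>z. - ((phi \<beta> z - mu \<beta> * z) / z ^ 2) / (mu \<beta> * (phi \<beta> z / z))) \<longlongrightarrow> - fps_nth Q 2 / (mu \<beta> * mu \<beta>)) (at 0)"
    using mu_nonzero by (intro tendsto_intros) auto
  moreover have "\<forall>\<^sub>F z in at 0. - ((phi \<beta> z - mu \<beta> * z) / z ^ 2) / (mu \<beta> * (phi \<beta> z / z)) = 1 / of_real C + exc_part z + simple_part z"
  proof -
    have "open (- zeros \<beta>)" using closed_zeros_subset by blast
    then have "\<forall>\<^sub>F z in at 0. z \<in> - zeros \<beta>"
      using zero_notin_zeros eventually_nhds_in_open[of "- zeros \<beta>" 0] by (auto simp: eventually_at_filter elim: eventually_mono)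
    moreover have "\<forall>\<^sub>F z in at 0. z \<noteq> (0::complex)" by (simp add: eventually_at_filter)
    ultimately show ?thesis
      using eventually_phi_nonzero[of 0]
    proof eventually_elim
      case (elim z)
      have "- ((phi \<beta> z - mu \<beta> * z) / z ^ 2) / (mu \<beta> * (phi \<beta> z / z)) = 1 / phi \<beta> z - 1 / (mu \<beta> * z)"
        using elim mu_nonzero by (simp add: field_simps power2_eq_square)
      then show ?case using partial_fractions[of z] elim by simp
    qed
  qed
  ultimately have "((\<lambda>z. 1 / of_real C + exc_part z + simple_part z) \<longlongrightarrow> - fps_nth Q 2 / (mu \<beta> * mu \<beta>)) (at 0)"
    by (rule Lim_transform_eventually)
  moreover have "isCont exc_part 0" "isCont simple_part 0"
    using zero_notin_zeros zeros_split unfolding simple_part_def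
    by (auto intro!: analytic_at_imp_isCont exc_part_analytic simple_part_analytic)
  then have "((\<lambda>z. 1 / of_real C + exc_part z + simple_part z) \<longlongrightarrow> 1 / of_real C + exc_part 0 + simple_part 0) (at 0)"
    unfolding isCont_def by (intro tendsto_intros)
  ultimately have "1 / of_real C + exc_part 0 + simple_part 0 = - fps_nth Q 2 / (mu \<beta> * mu \<beta>)"
    using LIM_unique by blast
  then show ?thesis by (simp add: Q2 power2_eq_square)
qed

end

section \<open>The potential density\<close>

lemma bounded_of_tendsto_at_top:
  fixes f :: "real \<Rightarrow> complex"
  assumes cont: "continuous_on {0..} f" and lim: "(f \<longlongrightarrow> L) at_top"
  shows "\<exists>B. \<forall>x\<ge>0. norm (f x) \<le> B"
proof -
  obtain X where X: "\<And>x. X \<le> x \<Longrightarrow> norm (f x - L) < 1"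
    using tendstoD[OF lim, of 1] unfolding eventually_at_top_linorder dist_norm by auto
  have "compact (f ` {0..X})"
    by (intro compact_continuous_image continuous_on_subset[OF cont]) auto
  then obtain B where B: "\<And>x. x \<in> {0..X} \<Longrightarrow> norm (f x) \<le> B"
    using compact_imp_bounded bounded_iff by (metis imageI)
  have "norm (f x) \<le> max B (norm L + 1)" if "0 \<le> x" for x
  proof (cases "x \<le> X")
    case False
    then show ?thesis using X[of x] norm_triangle_sub[of "f x" L] by simp
  qed (use B that in force)
  then show ?thesis by blast
qed

context beta_exponent
begin

definition simple_density :: "real \<Rightarrow> complex" where
  "simple_density x = (\<Sum>\<^sub>\<infinity>s\<in>simple_zeros \<beta>. 1 / deriv (phi \<beta>) s * exp (s * of_real x))"

lemma potential_density_eq: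
  "potential_density \<beta> x = 1 / mu \<beta> + (\<Sum>\<rho>\<in>exc_zeros \<beta>. u_term \<beta> \<rho> x) + simple_density x"
  unfolding potential_density_def simple_density_def by simp

lemma simple_zero_term_le:
  assumes "s \<in> simple_zeros \<beta>" "0 \<le> x"
  shows "norm (1 / deriv (phi \<beta>) s * exp (s * of_real x)) \<le> norm (1 / deriv (phi \<beta>) s)"
proof -
  have "Re s * x \<le> 0"
    using zeros_Re_neg[of s] assms by (intro mult_nonpos_nonneg) (auto simp: simple_zeros_def)
  then show ?thesis unfolding norm_mult by (intro mult_left_le) auto
qed

text \<open>
  On the closed half-line the exponentials are bounded by 1, so summability of the residues suffices.
\<close>

lemma simple_density_uniform:
  "uniform_limit {0..} (\<lambda>F x. \<Sum>s\<in>F. 1 / deriv (phi \<beta>) s * exp (s * of_real x)) simple_density (finite_subsets_at_top (simple_zeros \<beta>))"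
  unfolding simple_density_def
  by (rule Weierstrass_m_test_general[OF _ residues_abs_summable]) (rule simple_zero_term_le, auto)

lemma simple_density_abs_summable:
  "0 \<le> x \<Longrightarrow> (\<lambda>s. norm (1 / deriv (phi \<beta>) s * exp (s * of_real x))) summable_on simple_zeros \<beta>"
  by (rule summable_on_comparison_test[OF residues_abs_summable]) (use simple_zero_term_le in auto)

lemma density_series_converges:
  "locally_abs_unif_convergent (\<lambda>s x. exp (s * of_real x) / deriv (phi \<beta>) s) (simple_zeros \<beta>) {0::real<..}"
  unfolding locally_abs_unif_convergent_def
proof
  fix x :: real assume "x \<in> {0<..}"
  have "uniform_limit {0<..} (\<lambda>F x. \<Sum>s\<in>F. exp (s * of_real x) / deriv (phi \<beta>) s)
     (\<lambda>x. \<Sum>\<^sub>\<infinity>s\<in>simple_zeros \<beta>. exp (s * of_real x) / deriv (phi \<beta>) s) (finite_subsets_at_top (simple_zeros \<beta>))"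
  proof -
    have "{0<..} \<subseteq> {0::real..}" by auto
    from uniform_limit_on_subset[OF simple_density_uniform this] show ?thesis
      unfolding simple_density_def by simp
  qed
  then show "\<exists>V. open V \<and> x \<in> V \<and> (\<forall>y\<in>V \<inter> {0<..}. (\<lambda>s. norm (exp (s * of_real y) / deriv (phi \<beta>) s)) summable_on simple_zeros \<beta>) \<and>
     uniform_limit (V \<inter> {0<..}) (\<lambda>F y. \<Sum>s\<in>F. exp (s * of_real y) / deriv (phi \<beta>) s)
       (\<lambda>y. \<Sum>\<^sub>\<infinity>s\<in>simple_zeros \<beta>. exp (s * of_real y) / deriv (phi \<beta>) s) (finite_subsets_at_top (simple_zeros \<beta>))"
    using simple_density_abs_summable by (intro exI[of _ UNIV]) auto
qed

lemma simple_density_continuous: "continuous_on {0..} simple_density"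
proof -
  have "continuous_on {0..} (\<lambda>x. \<Sum>s\<in>F. 1 / deriv (phi \<beta>) s * exp (s * complex_of_real x))" for F
    by (intro continuous_on_sum continuous_on_mult_left continuous_on_exp continuous_on_of_real continuous_on_id)
  then show ?thesis
    by (intro uniform_limit_theorem[OF _ simple_density_uniform] always_eventually allI) auto
qed

lemma simple_density_bounded:
  assumes "0 \<le> x"
  shows "norm (simple_density x) \<le> (\<Sum>\<^sub>\<infinity>s\<in>simple_zeros \<beta>. norm (1 / deriv (phi \<beta>) s))"
proof -
  have "norm (simple_density x) \<le> (\<Sum>\<^sub>\<infinity>s\<in>simple_zeros \<beta>. norm (1 / deriv (phi \<beta>) s * exp (s * of_real x)))"
    unfolding simple_density_def by (rule norm_infsum_bound[OF simple_density_abs_summable[OF assms]])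
  also have "\<dots> \<le> (\<Sum>\<^sub>\<infinity>s\<in>simple_zeros \<beta>. norm (1 / deriv (phi \<beta>) s))"
    by (rule infsum_mono[OF simple_density_abs_summable[OF assms] residues_abs_summable]) (rule simple_zero_term_le[OF _ assms])
  finally show ?thesis .
qed

lemma u_term_eq:
  "u_term \<beta> \<rho> x = (\<Sum>l=1..mult \<beta> \<rho>. pp_coeff \<beta> \<rho> l / fact (l - 1) * (of_real x ^ (l - 1) * exp (\<rho> * of_real x)))"
  unfolding u_term_def sum_distrib_left by (intro sum.cong) auto

lemma u_term_continuous: "continuous_on A (u_term \<beta> \<rho>)"
  unfolding u_term_eq[abs_def] by (intro continuous_intros)

lemma u_term_bounded:
  assumes "Re \<rho> < 0"
  shows "\<exists>B. \<forall>x\<ge>0. norm (u_term \<beta> \<rho> x) \<le> B"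
proof (rule bounded_of_tendsto_at_top[OF u_term_continuous])
  show "(u_term \<beta> \<rho> \<longlongrightarrow> 0) at_top"
    unfolding u_term_eq[abs_def]
    by (intro tendsto_null_sum tendsto_mult_right_zero tendsto_power_times_exp_at_top assms)
qed

lemma exc_Re_neg: "\<rho> \<in> exc_zeros \<beta> \<Longrightarrow> Re \<rho> < 0"
  using zeros_Re_neg by (simp add: exc_zeros_def)

lemma potential_density_continuous: "continuous_on {0..} (potential_density \<beta>)"
  unfolding potential_density_eq[abs_def] by (intro continuous_intros u_term_continuous simple_density_continuous)

lemma potential_density_bounded: "\<exists>B. \<forall>x\<ge>0. norm (potential_density \<beta> x) \<le> B"
proof -
  obtain B where B: "\<And>\<rho> x. \<rho> \<in> exc_zeros \<beta> \<Longrightarrow> 0 \<le> x \<Longrightarrow> norm (u_term \<beta> \<rho> x) \<le> B \<rho>"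
    using u_term_bounded[OF exc_Re_neg] by metis
  have "norm (potential_density \<beta> x) \<le> norm (1 / mu \<beta>) + (\<Sum>\<rho>\<in>exc_zeros \<beta>. B \<rho>) + (\<Sum>\<^sub>\<infinity>s\<in>simple_zeros \<beta>. norm (1 / deriv (phi \<beta>) s))"
    if "0 \<le> x" for x
    unfolding potential_density_eq using B that
    by (intro order_trans[OF norm_triangle_ineq] add_mono simple_density_bounded sum_norm_le order_refl) auto
  then show ?thesis by blast
qed

text \<open>
  Termwise \<open>x^(l-1) / (l-1)!\<close> times \<open>exp (\<rho> x)\<close> has Laplace transform
  \<open>1 / (z - \<rho>)^l\<close>.
\<close>

lemma u_term_laplace:
  assumes "Re \<rho> < 0" "0 < Re z"
  shows "set_integrable lborel {0<..} (\<lambda>x. exp (- z * of_real x) * u_term \<beta> \<rho> x)"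
    and "(LBINT x:{0<..}. exp (- z * of_real x) * u_term \<beta> \<rho> x) = principal_part \<beta> \<rho> z"
proof -
  have r: "Re (\<rho> - z) < 0" using assms by simp
  have eq: "exp (- z * of_real x) * u_term \<beta> \<rho> x =
    (\<Sum>l=1..mult \<beta> \<rho>. pp_coeff \<beta> \<rho> l / fact (l - 1) * (of_real x ^ (l - 1) * exp ((\<rho> - z) * of_real x)))" for x
    unfolding u_term_eq sum_distrib_left
    by (intro sum.cong refl) (simp add: exp_diff exp_minus left_diff_distrib divide_inverse)
  note int = set_integrable_mult_right[OF power_times_exp_integrable[OF r]]
  show "set_integrable lborel {0<..} (\<lambda>x. exp (- z * of_real x) * u_term \<beta> \<rho> x)"
    unfolding eq by (rule set_integral_finite_sum(1)) (rule int)
  have "(LBINT x:{0<..}. exp (- z * of_real x) * u_term \<beta> \<rho> x) =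
     (\<Sum>l=1..mult \<beta> \<rho>. pp_coeff \<beta> \<rho> l / fact (l - 1) * (fact (l - 1) / (- (\<rho> - z)) ^ Suc (l - 1)))"
    unfolding eq by (subst set_integral_finite_sum(2)[OF int]) (simp add: laplace_power[OF r])
  also have "\<dots> = principal_part \<beta> \<rho> z"
    unfolding principal_part_def by (intro sum.cong refl) auto
  finally show "(LBINT x:{0<..}. exp (- z * of_real x) * u_term \<beta> \<rho> x) = principal_part \<beta> \<rho> z" .
qed

lemma simple_density_laplace:
  assumes "0 < Re z"
  shows "set_integrable lborel {0<..} (\<lambda>x. exp (- z * of_real x) * simple_density x)"
    and "(LBINT x:{0<..}. exp (- z * of_real x) * simple_density x) = simple_part z"
proof -
  have eq: "exp (- z * of_real x) * simple_density x =
     (\<Sum>\<^sub>\<infinity>s\<in>simple_zeros \<beta>. 1 / deriv (phi \<beta>) s * exp ((s - z) * of_real x))" for x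
  proof -
    have "exp ((s - z) * of_real x) = exp (- z * of_real x) * exp (s * of_real x)" for s
      by (simp add: exp_add[symmetric] algebra_simps)
    then show ?thesis unfolding simple_density_def infsum_cmult_right'[symmetric] by (simp add: mult_ac)
  qed
  have r: "Re (s - z) \<le> - Re z" if "s \<in> simple_zeros \<beta>" for s
    using zeros_Re_neg[of s] that by (auto simp: simple_zeros_def)
  note E = exp_sum_properties[where r = "\<lambda>s. s - z" and I = "simple_zeros \<beta>", OF residues_abs_summable assms r]
  show "set_integrable lborel {0<..} (\<lambda>x. exp (- z * of_real x) * simple_density x)"
    unfolding eq by (rule E(1))
  show "(LBINT x:{0<..}. exp (- z * of_real x) * simple_density x) = simple_part z"
  proof -
    have "(LBINT x:{0<..}. exp (- z * of_real x) * simple_density x) = (\<Sum>\<^sub>\<infinity>s\<in>simple_zeros \<beta>. 1 / deriv (phi \<beta>) s / (- (s - z)))"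
      unfolding eq by (rule E(2))
    then show ?thesis unfolding simple_part_def cauchy_sum_def by simp
  qed
qed

lemma potential_density_laplace:
  assumes "0 < Re z"
  shows "set_integrable lborel {0<..} (\<lambda>x. exp (- z * of_real x) * potential_density \<beta> x)"
    and "(LBINT x:{0<..}. exp (- z * of_real x) * potential_density \<beta> x) = 1 / phi \<beta> z - 1 / of_real C"
proof -
  have z: "z \<notin> zeros \<beta>" "z \<noteq> 0" using zeros_Re_neg[of z] assms by auto
  have r: "Re (- z) < 0" using assms by simp
  have eq: "exp (- z * of_real x) * potential_density \<beta> x =
     1 / mu \<beta> * exp (- z * of_real x) + (\<Sum>\<rho>\<in>exc_zeros \<beta>. exp (- z * of_real x) * u_term \<beta> \<rho> x) + exp (- z * of_real x) * simple_density x" for x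
    unfolding potential_density_eq distrib_left sum_distrib_left by simp
  have i1: "set_integrable lborel {0<..} (\<lambda>x. 1 / mu \<beta> * exp (- z * of_real x))"
    using set_integrable_mult_right[OF power_times_exp_integrable[OF r, of 0], of "1 / mu \<beta>"] by simp
  have I1: "(LBINT x:{0<..}. 1 / mu \<beta> * exp (- z * of_real x)) = 1 / (mu \<beta> * z)"
    using laplace_power[OF r, of 0] by simp
  note i2 = set_integral_finite_sum[of "exc_zeros \<beta>" lborel "{0<..}" "\<lambda>\<rho> x. exp (- z * of_real x) * u_term \<beta> \<rho> x", OF u_term_laplace(1)[OF exc_Re_neg assms]]
  have I2: "(LBINT x:{0<..}. \<Sum>\<rho>\<in>exc_zeros \<beta>. exp (- z * of_real x) * u_term \<beta> \<rho> x) = exc_part z"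
  proof -
    have "(LBINT x:{0<..}. \<Sum>\<rho>\<in>exc_zeros \<beta>. exp (- z * of_real x) * u_term \<beta> \<rho> x) =
      (\<Sum>\<rho>\<in>exc_zeros \<beta>. LBINT x:{0<..}. exp (- z * of_real x) * u_term \<beta> \<rho> x)"
      by (rule i2(2))
    also have "\<dots> = exc_part z"
      unfolding exc_part_def by (rule sum.cong[OF refl]) (rule u_term_laplace(2)[OF exc_Re_neg assms])
    finally show ?thesis .
  qed
  note i3 = simple_density_laplace[OF assms]
  show "set_integrable lborel {0<..} (\<lambda>x. exp (- z * of_real x) * potential_density \<beta> x)"
    unfolding eq by (intro set_integral_add(1) i1 i2(1) i3(1))
  have "(LBINT x:{0<..}. exp (- z * of_real x) * potential_density \<beta> x) = 1 / (mu \<beta> * z) + exc_part z + simple_part z"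
  proof -
    let ?a = "\<lambda>x. 1 / mu \<beta> * exp (- z * of_real x)"
    let ?b = "\<lambda>x. \<Sum>\<rho>\<in>exc_zeros \<beta>. exp (- z * of_real x) * u_term \<beta> \<rho> x"
    let ?c = "\<lambda>x. exp (- z * of_real x) * simple_density x"
    have "(LBINT x:{0<..}. (?a x + ?b x) + ?c x) = (LBINT x:{0<..}. ?a x + ?b x) + (LBINT x:{0<..}. ?c x)"
      by (rule set_integral_add(2)[OF set_integral_add(1)[OF i1 i2(1)] i3(1)])
    also have "(LBINT x:{0<..}. ?a x + ?b x) = (LBINT x:{0<..}. ?a x) + (LBINT x:{0<..}. ?b x)"
      by (rule set_integral_add(2)[OF i1 i2(1)])
    finally show ?thesis unfolding eq I1 I2 i3(2) .
  qed
  then show "(LBINT x:{0<..}. exp (- z * of_real x) * potential_density \<beta> x) = 1 / phi \<beta> z - 1 / of_real C"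
    using partial_fractions[OF z] by simp
qed

definition inv_phi_nat :: "nat \<Rightarrow> real" where
  "inv_phi_nat k = 1 / (C - (LBINT x:{0<..}. exp (- x) ^ Suc k * levy x))"

lemma exp_power_eq: "exp (- x) ^ Suc k = exp (- real (Suc k) * x)"
  by (simp add: exp_of_nat_mult[symmetric] del: of_nat_Suc power_Suc)

lemma phi_nat: "phi \<beta> (of_nat (Suc k)) = of_real (C - (LBINT x:{0<..}. exp (- x) ^ Suc k * levy x))"
  and levy_moment_less: "(LBINT x:{0<..}. exp (- x) ^ Suc k * levy x) < C"
  using phi_of_real[of "real (Suc k)"] unfolding exp_power_eq by (simp_all del: of_nat_Suc)

lemma inv_phi_nat: "1 / phi \<beta> (of_nat (Suc k)) = of_real (inv_phi_nat k)"
  unfolding phi_nat inv_phi_nat_def by simp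

lemma density_moments:
  "(LBINT x:{0<..}. exp (- x) ^ Suc k * Re (potential_density \<beta> x)) = inv_phi_nat k - 1 / C"
  "(LBINT x:{0<..}. exp (- x) ^ Suc k * Im (potential_density \<beta> x)) = 0"
  "set_integrable lborel {0<..} (\<lambda>x. exp (- x) ^ Suc k * Re (potential_density \<beta> x))"
proof -
  have pos: "0 < Re (of_nat (Suc k) :: complex)" by simp
  have e: "exp (- of_nat (Suc k) * of_real x) = complex_of_real (exp (- x) ^ Suc k)" for x
    unfolding exp_power_eq by (simp add: exp_of_real[symmetric] del: exp_of_real of_nat_Suc)
  note L = potential_density_laplace[OF pos, unfolded e inv_phi_nat]
  have reim: "Re (of_real a * w) = a * Re w" "Im (of_real a * w) = a * Im w" for a w by simp_all
  have "(LBINT x:{0<..}. Re (of_real (exp (- x) ^ Suc k) * potential_density \<beta> x)) = Re (of_real (inv_phi_nat k) - 1 / of_real C)"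
    unfolding L(2)[symmetric] using L(1) unfolding set_lebesgue_integral_def set_integrable_def
    by (subst integral_Re[symmetric]) auto
  then show "(LBINT x:{0<..}. exp (- x) ^ Suc k * Re (potential_density \<beta> x)) = inv_phi_nat k - 1 / C"
    unfolding reim by (simp del: power_Suc)
  have "(LBINT x:{0<..}. Im (of_real (exp (- x) ^ Suc k) * potential_density \<beta> x)) = Im (of_real (inv_phi_nat k) - 1 / of_real C)"
    unfolding L(2)[symmetric] using L(1) unfolding set_lebesgue_integral_def set_integrable_def
    by (subst integral_Im[symmetric]) auto
  then show "(LBINT x:{0<..}. exp (- x) ^ Suc k * Im (potential_density \<beta> x)) = 0"
    unfolding reim by (simp del: power_Suc)
  show "set_integrable lborel {0<..} (\<lambda>x. exp (- x) ^ Suc k * Re (potential_density \<beta> x))"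
    using set_integrable_Re[OF L(1)] unfolding reim .
qed

text \<open>
  The imaginary part has vanishing moments, so it and its negative are nonnegative; the moments of the real part
  are \<open>1 / (C - g k) - 1 / C\<close> with the completely monotone moments \<open>g\<close> of the Levy
  density.
\<close>

lemma potential_density_nonneg:
  assumes "0 \<le> x"
  shows "potential_density \<beta> x \<in> \<real>" and "0 \<le> Re (potential_density \<beta> x)"
proof -
  obtain B where B: "\<And>x. 0 \<le> x \<Longrightarrow> norm (potential_density \<beta> x) \<le> B" using potential_density_bounded by blast
  have ReB: "\<bar>Re (potential_density \<beta> x)\<bar> \<le> B" and ImB: "\<bar>Im (potential_density \<beta> x)\<bar> \<le> B" "\<bar>- Im (potential_density \<beta> x)\<bar> \<le> B"
    if "0 \<le> x" for x
    using B[OF that] abs_Re_le_cmod[of "potential_density \<beta> x"] abs_Im_le_cmod[of "potential_density \<beta> x"] by auto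
  have cm0: "cm_seq (\<lambda>k. 0)"
    using cm_seq_cmult[of "\<lambda>k. LBINT x:{0<..}. exp (- x) ^ Suc k * levy x" 0]
      cm_seq_laplace[OF levy_continuous, of 1] levy_nonneg levy_le_one by simp
  have "0 \<le> Im (potential_density \<beta> x)"
    by (rule nonneg_of_cm_laplace[OF _ ImB(1) _ assms])
      (auto intro!: continuous_intros potential_density_continuous simp: density_moments(2) cm0 simp del: power_Suc)
  moreover have "0 \<le> - Im (potential_density \<beta> x)"
  proof (rule nonneg_of_cm_laplace[OF _ ImB(2) _ assms])
    have "(LBINT x:{0<..}. exp (- x) ^ Suc k * - Im (potential_density \<beta> x)) = 0" for k
      using density_moments(2)[of k] unfolding set_lebesgue_integral_def by simp
    then show "cm_seq (\<lambda>k. LBINT x:{0<..}. exp (- x) ^ Suc k * - Im (potential_density \<beta> x))" using cm0 by simp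
  qed (auto intro!: continuous_intros potential_density_continuous)
  ultimately show "potential_density \<beta> x \<in> \<real>" by (simp add: complex_is_Real_iff)
  show "0 \<le> Re (potential_density \<beta> x)"
  proof (rule nonneg_of_cm_laplace[OF _ ReB _ assms])
    have "cm_seq (\<lambda>k. LBINT x:{0<..}. exp (- x) ^ Suc k * levy x)"
      by (rule cm_seq_laplace[OF levy_continuous, of 1]) (use levy_nonneg levy_le_one in auto)
    from cm_seq_renewal[OF this levy_moment_less]
    show "cm_seq (\<lambda>k. LBINT x:{0<..}. exp (- x) ^ Suc k * Re (potential_density \<beta> x))"
      unfolding density_moments(1) inv_phi_nat_def .
  qed (auto intro!: continuous_intros potential_density_continuous)
qed

end

section \<open>The potential measure\<close>

lemma nn_integral_exp_neg:
  assumes "0 < p"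
  shows "(\<integral>\<^sup>+t. ennreal (exp (- p * t)) * indicator {0..} t \<partial>lborel) = ennreal (1 / p)"
proof -
  have "(\<integral>\<^sup>+t. ennreal (erlang_density 0 p t) \<partial>lborel) = 1"
    using nn_integral_erlang_ith_moment[OF assms, of 0 0] by simp
  moreover have "ennreal (erlang_density 0 p t) = ennreal p * (ennreal (exp (- p * t)) * indicator {0..} t)" for t
    using assms by (auto simp: erlang_density_def indicator_def ennreal_mult'[symmetric])
  ultimately have "ennreal p * (\<integral>\<^sup>+t. ennreal (exp (- p * t)) * indicator {0..} t \<partial>lborel) = 1"
    by (simp add: nn_integral_cmult)
  then have "ennreal (1 / p) * (ennreal p * (\<integral>\<^sup>+t. ennreal (exp (- p * t)) * indicator {0..} t \<partial>lborel)) = ennreal (1 / p)"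
    by simp
  moreover have "ennreal (1 / p) * ennreal p = 1"
    using assms by (simp add: ennreal_mult'[symmetric])
  ultimately show ?thesis by (simp add: mult.assoc[symmetric])
qed

lemma exp_tilt_inverse:
  fixes M :: "real measure"
  assumes [measurable_cong]: "sets M = sets borel"
  shows "density (density M (\<lambda>x. ennreal (exp (- x)))) (\<lambda>x. ennreal (exp x)) = M"
proof -
  have "density (density M (\<lambda>x. ennreal (exp (- x)))) (\<lambda>x. ennreal (exp x)) = density M (\<lambda>x. ennreal (exp (- x)) * ennreal (exp x))"
    by (rule density_density_eq) measurable
  also have "(\<lambda>x. ennreal (exp (- x)) * ennreal (exp x)) = (\<lambda>x::real. 1)"
    by (simp add: ennreal_mult'[symmetric] exp_add[symmetric])
  finally show ?thesis by (simp add: density_1)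
qed

text \<open>
  Potential measures are infinite. The density \<open>exp (- x)\<close> makes them finite, shifts the index of the
  moments by one, and is invertible.
\<close>

lemma measure_eqI_tilted_exp_moments:
  fixes M N :: "real measure"
  assumes sets[measurable_cong]: "sets M = sets borel" "sets N = sets borel"
    and pos: "AE x in M. 0 \<le> x" "AE x in N. 0 \<le> x"
    and mom: "\<And>j::nat. (\<integral>\<^sup>+x. ennreal (exp (- x) ^ Suc j) \<partial>M) = (\<integral>\<^sup>+x. ennreal (exp (- x) ^ Suc j) \<partial>N)"
    and fin: "(\<integral>\<^sup>+x. ennreal (exp (- x)) \<partial>M) < \<infinity>"
  shows "M = N"
proof -
  have tilt: "(\<integral>\<^sup>+x. ennreal (exp (- x) ^ j) \<partial>density K (\<lambda>x. ennreal (exp (- x)))) = (\<integral>\<^sup>+x. ennreal (exp (- x) ^ Suc j) \<partial>K)"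
    if [measurable_cong]: "sets K = sets borel" for K j
    by (subst nn_integral_density) (auto simp: ennreal_mult'[symmetric])
  have "density M (\<lambda>x. ennreal (exp (- x))) = density N (\<lambda>x. ennreal (exp (- x)))"
  proof (rule measure_eqI_exp_moments)
    show "AE x in density M (\<lambda>x. ennreal (exp (- x))). 0 \<le> x" "AE x in density N (\<lambda>x. ennreal (exp (- x))). 0 \<le> x"
      using pos by (auto simp: AE_density)
    have sp: "space M = UNIV" using sets_eq_imp_space_eq[OF sets(1)] by (simp only: space_borel)
    have "emeasure (density M (\<lambda>x. ennreal (exp (- x)))) (space M) = (\<integral>\<^sup>+x. ennreal (exp (- x)) * indicator (space M) x \<partial>M)"
      by (rule emeasure_density) auto
    also have "\<dots> = (\<integral>\<^sup>+x. ennreal (exp (- x)) \<partial>M)" by (intro nn_integral_cong) simp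
    finally show "emeasure (density M (\<lambda>x. ennreal (exp (- x)))) UNIV < \<infinity>" using fin unfolding sp by simp
  qed (use sets tilt mom in auto)
  then show ?thesis using exp_tilt_inverse[OF sets(1)] exp_tilt_inverse[OF sets(2)] by metis
qed

text \<open>
  The time is truncated at 0 to obtain a kernel on the whole line; \<open>potential_measure\<close> gives weight 0
  to negative times.
\<close>

definition law_kernel :: "'a measure \<Rightarrow> (real \<Rightarrow> 'a \<Rightarrow> real) \<Rightarrow> real \<Rightarrow> real measure" where
  "law_kernel M \<xi> t = distr M borel (\<xi> (max 0 t))"

lemma subordinator_prob: "subordinator M \<xi> \<Longrightarrow> prob_space M"
  and subordinator_measurable: "subordinator M \<xi> \<Longrightarrow> 0 \<le> t \<Longrightarrow> \<xi> t \<in> borel_measurable M"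
  and subordinator_paths: "subordinator M \<xi> \<Longrightarrow> AE \<omega> in M. \<xi> 0 \<omega> = 0 \<and> mono_on {0..} (\<lambda>t. \<xi> t \<omega>)"
  unfolding subordinator_def by auto

text \<open>
  Paths increase almost surely, so \<open>P (\<xi> t \<le> c)\<close> is a decreasing function of \<open>t\<close>
  and hence measurable; half-lines generate.
\<close>

lemma law_kernel_measurable:
  assumes "subordinator M \<xi>"
  shows "law_kernel M \<xi> \<in> measurable borel (subprob_algebra borel)"
proof (rule measurable_subprob_algebra_generated[where \<Omega> = UNIV and G = "range atMost"])
  interpret prob_space M using assms by (rule subordinator_prob)
  note meas = subordinator_measurable[OF assms]
  show "sets borel = sigma_sets UNIV (range (atMost :: real \<Rightarrow> real set))"
    by (simp add: borel_eq_atMost)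
  show "Int_stable (range (atMost :: real \<Rightarrow> real set))"
    by (auto simp: Int_stable_def)
  show "subprob_space (law_kernel M \<xi> t)" for t
    unfolding law_kernel_def by (intro prob_space_imp_subprob_space prob_space_distr meas) simp
  have em: "emeasure (law_kernel M \<xi> t) A = emeasure M {\<omega> \<in> space M. \<xi> (max 0 t) \<omega> \<in> A}" if "A \<in> sets borel" for t A
    unfolding law_kernel_def using that meas by (subst emeasure_distr) (auto intro!: arg_cong2[where f = emeasure])
  show "(\<lambda>t. emeasure (law_kernel M \<xi> t) A) \<in> borel_measurable borel" if "A \<in> range (atMost :: real \<Rightarrow> real set)" for A
  proof -
    from that obtain c where A: "A = {..c}" by blast
    define p where "p t = prob {\<omega> \<in> space M. \<xi> (max 0 t) \<omega> \<le> c}" for t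
    have "mono (\<lambda>t. - p t)"
    proof (rule monoI)
      fix s t :: real assume "s \<le> t"
      have "p t \<le> p s" unfolding p_def
      proof (rule finite_measure_mono_AE)
        show "AE \<omega> in M. \<omega> \<in> {\<omega> \<in> space M. \<xi> (max 0 t) \<omega> \<le> c} \<longrightarrow> \<omega> \<in> {\<omega> \<in> space M. \<xi> (max 0 s) \<omega> \<le> c}"
          using subordinator_paths[OF assms]
        proof eventually_elim
          case (elim \<omega>)
          then have "\<xi> (max 0 s) \<omega> \<le> \<xi> (max 0 t) \<omega>"
            using \<open>s \<le> t\<close> by (intro mono_onD[of "{0..}" "\<lambda>t. \<xi> t \<omega>"]) auto
          then show ?case by auto
        qed
        show "{\<omega> \<in> space M. \<xi> (max 0 s) \<omega> \<le> c} \<in> events" using meas[of "max 0 s"] by measurable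
      qed
      then show "- p s \<le> - p t" by simp
    qed
    then have "(\<lambda>t. - (- p t)) \<in> borel_measurable borel"
      by (intro borel_measurable_uminus borel_measurable_mono)
    then have "(\<lambda>t. ennreal (p t)) \<in> borel_measurable borel" by simp
    moreover have "emeasure (law_kernel M \<xi> t) A = ennreal (p t)" for t
      using em[of A t] unfolding A p_def by (simp add: emeasure_eq_measure)
    ultimately show ?thesis by simp
  qed
  show "(\<lambda>t. emeasure (law_kernel M \<xi> t) UNIV) \<in> borel_measurable borel"
    using em[of UNIV] by simp
qed (auto simp: law_kernel_def)

definition potential_measure :: "'a measure \<Rightarrow> (real \<Rightarrow> 'a \<Rightarrow> real) \<Rightarrow> real measure" where
  "potential_measure M \<xi> = density lborel (indicator {0..}) \<bind> law_kernel M \<xi>"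

lemma sets_potential_measure: "subordinator M \<xi> \<Longrightarrow> sets (potential_measure M \<xi>) = sets borel"
  unfolding potential_measure_def using law_kernel_measurable[of M \<xi>]
  by (intro sets_bind[where N = borel]) (auto simp: law_kernel_def)

lemma nn_integral_potential_measure:
  assumes "subordinator M \<xi>" and [measurable]: "f \<in> borel_measurable borel"
  shows "(\<integral>\<^sup>+x. f x \<partial>potential_measure M \<xi>) = (\<integral>\<^sup>+t\<in>{0..}. (\<integral>\<^sup>+\<omega>. f (\<xi> t \<omega>) \<partial>M) \<partial>lborel)"
proof -
  have [measurable]: "law_kernel M \<xi> \<in> measurable borel (subprob_algebra borel)"
    by (rule law_kernel_measurable[OF assms(1)])
  have "(\<integral>\<^sup>+x. f x \<partial>potential_measure M \<xi>) = (\<integral>\<^sup>+t. (\<integral>\<^sup>+x. f x \<partial>law_kernel M \<xi> t) \<partial>density lborel (indicator {0..}))"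
    unfolding potential_measure_def by (rule nn_integral_bind[where B = borel]) (auto cong: measurable_cong_sets)
  also have "\<dots> = (\<integral>\<^sup>+t. indicator {0..} t * (\<integral>\<^sup>+x. f x \<partial>law_kernel M \<xi> t) \<partial>lborel)"
    by (rule nn_integral_density) (auto intro!: nn_integral_measurable_subprob_algebra2[where N = borel])
  also have "\<dots> = (\<integral>\<^sup>+t\<in>{0..}. (\<integral>\<^sup>+\<omega>. f (\<xi> t \<omega>) \<partial>M) \<partial>lborel)"
  proof (rule nn_integral_cong)
    fix t :: real
    show "indicator {0..} t * (\<integral>\<^sup>+x. f x \<partial>law_kernel M \<xi> t) = (\<integral>\<^sup>+\<omega>. f (\<xi> t \<omega>) \<partial>M) * indicator {0..} t"
      using subordinator_measurable[OF assms(1), of t]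
      by (cases "0 \<le> t") (auto simp: law_kernel_def nn_integral_distr)
  qed
  finally show ?thesis .
qed

lemma emeasure_potential_measure:
  assumes "subordinator M \<xi>" "A \<in> sets borel"
  shows "emeasure (potential_measure M \<xi>) A = potential M \<xi> A"
proof -
  have "emeasure (potential_measure M \<xi>) A = (\<integral>\<^sup>+x. indicator A x \<partial>potential_measure M \<xi>)"
    using assms sets_potential_measure[OF assms(1)] by simp
  also have "\<dots> = (\<integral>\<^sup>+t\<in>{0..}. (\<integral>\<^sup>+\<omega>. indicator A (\<xi> t \<omega>) \<partial>M) \<partial>lborel)"
    using assms by (intro nn_integral_potential_measure) auto
  also have "\<dots> = potential M \<xi> A"
    unfolding potential_def
  proof (rule nn_integral_cong)
    fix t :: real
    show "(\<integral>\<^sup>+\<omega>. indicator A (\<xi> t \<omega>) \<partial>M) * indicator {0..} t = emeasure M {\<omega> \<in> space M. \<xi> t \<omega> \<in> A} * indicator {0..} t"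
    proof (cases "0 \<le> t")
      case True
      have "{\<omega> \<in> space M. \<xi> t \<omega> \<in> A} \<in> sets M"
        using measurable_sets[OF subordinator_measurable[OF assms(1) True] assms(2)] by (simp add: vimage_def Int_def conj_commute)
      then have "(\<integral>\<^sup>+\<omega>. indicator {\<omega> \<in> space M. \<xi> t \<omega> \<in> A} \<omega> \<partial>M) = emeasure M {\<omega> \<in> space M. \<xi> t \<omega> \<in> A}" by simp
      moreover have "(\<integral>\<^sup>+\<omega>. indicator A (\<xi> t \<omega>) \<partial>M) = (\<integral>\<^sup>+\<omega>. indicator {\<omega> \<in> space M. \<xi> t \<omega> \<in> A} \<omega> \<partial>M)"
        by (intro nn_integral_cong) (auto simp: indicator_def)
      ultimately show ?thesis by simp
    qed simp
  qed
  finally show ?thesis .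
qed

lemma potential_measure_nonneg:
  assumes "subordinator M \<xi>"
  shows "AE x in potential_measure M \<xi>. 0 \<le> x"
proof (rule AE_I')
  have "emeasure M {\<omega> \<in> space M. \<xi> t \<omega> \<in> {..<0}} = 0" if "0 \<le> t" for t
  proof -
    have "AE \<omega> in M. \<not> \<xi> t \<omega> < 0"
      using subordinator_paths[OF assms]
    proof eventually_elim
      case (elim \<omega>)
      then have "\<xi> 0 \<omega> \<le> \<xi> t \<omega>" using that by (intro mono_onD[of "{0..}" "\<lambda>t. \<xi> t \<omega>"]) auto
      then show ?case using elim by simp
    qed
    then show ?thesis
      using subordinator_measurable[OF assms that] by (simp add: AE_iff_measurable[OF _ refl])
  qed
  then have "potential M \<xi> {..<0} = 0"
    unfolding potential_def by (intro nn_integral_zero') (auto simp: indicator_def)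
  then show "{..<0} \<in> null_sets (potential_measure M \<xi>)"
    using emeasure_potential_measure[OF assms, of "{..<0}"] sets_potential_measure[OF assms] by (simp add: null_sets_def)
qed auto

context beta_exponent
begin

lemma eta_eq: "eta \<beta> = 1 / C" by (simp add: eta_def C_def)

text \<open>
  The atom at 0 is spread uniformly over the interval from \<open>-1\<close> to 0, which the map
  \<open>max 0\<close> in \<open>renewal_measure\<close> collapses to the point 0 again. In this way the measure
  is built from a density.
\<close>

definition renewal_density :: "real \<Rightarrow> real" where
  "renewal_density x = (if x \<le> - 1 then 0 else if x \<le> 0 then eta \<beta> else Re (potential_density \<beta> x))"

definition renewal_measure :: "real measure" where
  "renewal_measure = distr (density lborel (\<lambda>x. ennreal (renewal_density x))) borel (max 0)"

lemma renewal_density_measurable [measurable]: "renewal_density \<in> borel_measurable borel"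
proof -
  have "continuous_on {0<..} (\<lambda>x. Re (potential_density \<beta> x))"
    by (intro continuous_intros continuous_on_subset[OF potential_density_continuous]) auto
  then have [measurable]: "(\<lambda>x. indicator {0<..} x *\<^sub>R Re (potential_density \<beta> x)) \<in> borel_measurable borel"
    by (intro borel_measurable_continuous_on_indicator) auto
  have "renewal_density = (\<lambda>x. if x \<le> - 1 then 0 else if x \<le> 0 then eta \<beta> else indicator {0<..} x *\<^sub>R Re (potential_density \<beta> x))"
    by (auto simp: renewal_density_def fun_eq_iff)
  then show ?thesis by simp
qed

lemma nn_integral_renewal_measure:
  assumes [measurable]: "f \<in> borel_measurable borel"
  shows "(\<integral>\<^sup>+x. f x \<partial>renewal_measure) = ennreal (eta \<beta>) * f 0 + (\<integral>\<^sup>+x\<in>{0<..}. ennreal (Re (potential_density \<beta> x)) * f x \<partial>lborel)"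
proof -
  have "(\<integral>\<^sup>+x. f x \<partial>renewal_measure) = (\<integral>\<^sup>+x. ennreal (renewal_density x) * f (max 0 x) \<partial>lborel)"
    unfolding renewal_measure_def by (subst nn_integral_distr) (auto simp: nn_integral_density)
  also have "\<dots> = (\<integral>\<^sup>+x. ennreal (eta \<beta>) * f 0 * indicator {-1<..0} x + indicator {0<..} x * (ennreal (renewal_density x) * f x) \<partial>lborel)"
    by (intro nn_integral_cong) (auto simp: renewal_density_def indicator_def max_def)
  also have "\<dots> = (\<integral>\<^sup>+x. ennreal (eta \<beta>) * f 0 * indicator {-1<..0} x \<partial>(lborel :: real measure)) + (\<integral>\<^sup>+x. indicator {0<..} x * (ennreal (renewal_density x) * f x) \<partial>lborel)"
    by (rule nn_integral_add) auto
  also have "(\<integral>\<^sup>+x. ennreal (eta \<beta>) * f 0 * indicator {-1<..0} x \<partial>(lborel :: real measure)) = ennreal (eta \<beta>) * f 0"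
    by (subst nn_integral_cmult_indicator) auto
  also have "(\<integral>\<^sup>+x. indicator {0<..} x * (ennreal (renewal_density x) * f x) \<partial>lborel) = (\<integral>\<^sup>+x\<in>{0<..}. ennreal (Re (potential_density \<beta> x)) * f x \<partial>lborel)"
    by (intro nn_integral_cong) (auto simp: renewal_density_def indicator_def)
  finally show ?thesis .
qed

lemma sets_renewal_measure: "sets renewal_measure = sets borel"
  unfolding renewal_measure_def by simp

lemma renewal_measure_moments:
  "(\<integral>\<^sup>+x. ennreal (exp (- x) ^ Suc j) \<partial>renewal_measure) = ennreal (inv_phi_nat j)"
proof -
  let ?u = "\<lambda>x. exp (- x) ^ Suc j * Re (potential_density \<beta> x)"
  have u0: "0 \<le> indicator {0<..} x *\<^sub>R ?u x" for x
    using potential_density_nonneg(2)[of x] by (auto simp: indicator_def)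
  have "(\<integral>\<^sup>+x\<in>{0<..}. ennreal (Re (potential_density \<beta> x)) * ennreal (exp (- x) ^ Suc j) \<partial>lborel) =
     (\<integral>\<^sup>+x. ennreal (indicator {0<..} x *\<^sub>R ?u x) \<partial>lborel)"
    by (intro nn_integral_cong) (auto simp: indicator_def ennreal_mult''[symmetric] mult.commute)
  also have "\<dots> = ennreal (\<integral>x. indicator {0<..} x *\<^sub>R ?u x \<partial>lborel)"
    using density_moments(3)[of j] u0 unfolding set_integrable_def by (intro nn_integral_eq_integral) auto
  also have "(\<integral>x. indicator {0<..} x *\<^sub>R ?u x \<partial>lborel) = inv_phi_nat j - 1 / C"
    using density_moments(1)[of j] unfolding set_lebesgue_integral_def .
  finally have I: "(\<integral>\<^sup>+x\<in>{0<..}. ennreal (Re (potential_density \<beta> x)) * ennreal (exp (- x) ^ Suc j) \<partial>lborel) = ennreal (inv_phi_nat j - 1 / C)" .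
  have "0 \<le> inv_phi_nat j - 1 / C"
    unfolding density_moments(1)[of j, symmetric] set_lebesgue_integral_def using u0 by (intro integral_nonneg_AE) auto
  then show ?thesis
    by (subst nn_integral_renewal_measure) (use C_pos I in \<open>auto simp: eta_eq ennreal_plus[symmetric] simp del: ennreal_plus power_Suc\<close>)
qed

text \<open>
  By Fubini the moment is the integral of \<open>exp (- t \<phi> (j + 1))\<close> over \<open>t \<ge> 0\<close>.
\<close>

lemma potential_measure_moments:
  assumes "subordinator M \<xi>" "has_laplace_exponent M \<xi> (phi \<beta>)"
  shows "(\<integral>\<^sup>+x. ennreal (exp (- x) ^ Suc j) \<partial>potential_measure M \<xi>) = ennreal (inv_phi_nat j)"
proof -
  interpret prob_space M using assms(1) by (rule subordinator_prob)
  define p where "p = C - (LBINT x:{0<..}. exp (- x) ^ Suc j * levy x)"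
  have p: "0 < p" "phi \<beta> (of_nat (Suc j)) = of_real p"
    using levy_moment_less[of j] phi_nat[of j] by (auto simp: p_def simp del: power_Suc of_nat_Suc)
  have "(\<integral>\<^sup>+\<omega>. ennreal (exp (- \<xi> t \<omega>) ^ Suc j) \<partial>M) = ennreal (exp (- p * t))" if t: "0 \<le> t" for t
  proof -
    have [measurable]: "\<xi> t \<in> borel_measurable M" by (rule subordinator_measurable[OF assms(1) t])
    have "AE \<omega> in M. norm (exp (- \<xi> t \<omega>) ^ Suc j) \<le> 1"
      using subordinator_paths[OF assms(1)]
    proof eventually_elim
      case (elim \<omega>)
      then have "\<xi> 0 \<omega> \<le> \<xi> t \<omega>" using t by (intro mono_onD[of "{0..}" "\<lambda>t. \<xi> t \<omega>"]) auto
      then show ?case using elim by (simp add: power_le_one mult_le_one)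
    qed
    then have int: "integrable M (\<lambda>\<omega>. exp (- \<xi> t \<omega>) ^ Suc j)"
      by (rule integrable_const_bound) measurable
    have e: "exp (- of_nat (Suc j) * of_real (\<xi> t \<omega>)) = complex_of_real (exp (- \<xi> t \<omega>) ^ Suc j)" for \<omega>
      unfolding exp_power_eq by (simp add: exp_of_real[symmetric] del: exp_of_real of_nat_Suc)
    have "0 \<le> Re (of_nat (Suc j) :: complex)" by simp
    then have "(LINT \<omega>|M. exp (- of_nat (Suc j) * of_real (\<xi> t \<omega>))) = exp (- of_real t * phi \<beta> (of_nat (Suc j)))"
      using assms(2) t unfolding has_laplace_exponent_def by blast
    then have "of_real (LINT \<omega>|M. exp (- \<xi> t \<omega>) ^ Suc j) = exp (- of_real t * phi \<beta> (of_nat (Suc j)))"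
      unfolding e by (simp only: integral_complex_of_real)
    also have "exp (- of_real t * phi \<beta> (of_nat (Suc j))) = of_real (exp (- p * t))"
      unfolding p(2) by (simp add: exp_of_real[symmetric] mult.commute del: exp_of_real)
    finally have "(LINT \<omega>|M. exp (- \<xi> t \<omega>) ^ Suc j) = exp (- p * t)" by (simp only: of_real_eq_iff)
    then show ?thesis using int by (subst nn_integral_eq_integral) (auto simp del: power_Suc)
  qed
  then have "(\<integral>\<^sup>+x. ennreal (exp (- x) ^ Suc j) \<partial>potential_measure M \<xi>) = (\<integral>\<^sup>+t. ennreal (exp (- p * t)) * indicator {0..} t \<partial>lborel)"
    by (subst nn_integral_potential_measure[OF assms(1)]) (auto intro!: nn_integral_cong simp: indicator_def simp del: power_Suc)
  also have "\<dots> = ennreal (inv_phi_nat j)"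
    unfolding nn_integral_exp_neg[OF p(1)] by (simp add: inv_phi_nat_def p_def del: power_Suc)
  finally show ?thesis .
qed

theorem potential_identity:
  assumes "subordinator M \<xi>" "has_laplace_exponent M \<xi> (phi \<beta>)" "A \<in> sets borel"
  shows "potential M \<xi> A = ennreal (eta \<beta>) * indicator A 0 + (\<integral>\<^sup>+x\<in>A \<inter> {0<..}. ennreal (Re (potential_density \<beta> x)) \<partial>lborel)"
proof -
  have "potential_measure M \<xi> = renewal_measure"
  proof (rule measure_eqI_tilted_exp_moments)
    show "AE x in renewal_measure. 0 \<le> x"
      unfolding renewal_measure_def by (subst AE_distr_iff) (auto intro!: AE_I2)
    show "(\<integral>\<^sup>+x. ennreal (exp (- x)) \<partial>potential_measure M \<xi>) < \<infinity>"
      using potential_measure_moments[OF assms(1,2), of 0] by simp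
    show "(\<integral>\<^sup>+x. ennreal (exp (- x) ^ Suc j) \<partial>potential_measure M \<xi>) = (\<integral>\<^sup>+x. ennreal (exp (- x) ^ Suc j) \<partial>renewal_measure)" for j
      unfolding potential_measure_moments[OF assms(1,2)] renewal_measure_moments ..
  qed (use assms sets_potential_measure sets_renewal_measure potential_measure_nonneg in auto)
  then have "potential M \<xi> A = emeasure renewal_measure A"
    using emeasure_potential_measure[OF assms(1,3)] by simp
  also have "\<dots> = (\<integral>\<^sup>+x. indicator A x \<partial>renewal_measure)"
    using assms(3) sets_renewal_measure by simp
  also have "\<dots> = ennreal (eta \<beta>) * indicator A 0 + (\<integral>\<^sup>+x\<in>{0<..}. ennreal (Re (potential_density \<beta> x)) * indicator A x \<partial>lborel)"
    using assms(3) by (intro nn_integral_renewal_measure) auto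
  also have "(\<integral>\<^sup>+x\<in>{0<..}. ennreal (Re (potential_density \<beta> x)) * indicator A x \<partial>lborel) = (\<integral>\<^sup>+x\<in>A \<inter> {0<..}. ennreal (Re (potential_density \<beta> x)) \<partial>lborel)"
    by (intro nn_integral_cong) (auto simp: indicator_def)
  finally show ?thesis .
qed

end

section \<open>The mean height of a leaf: recursion\<close>

lemma sum_binomial_Suc:
  fixes f :: "nat \<Rightarrow> 'a::comm_semiring_1"
  shows "(\<Sum>i\<le>Suc n. of_nat (Suc n choose i) * f i) = (\<Sum>i\<le>n. of_nat (n choose i) * (f i + f (Suc i)))"
proof -
  have "(\<Sum>i\<le>Suc n. of_nat (Suc n choose i) * f i) = f 0 + (\<Sum>i\<le>n. of_nat (Suc n choose Suc i) * f (Suc i))"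
    by (simp add: sum.atMost_Suc_shift del: sum.atMost_Suc binomial_Suc_Suc)
  also have "(\<Sum>i\<le>n. of_nat (Suc n choose Suc i) * f (Suc i)) =
      (\<Sum>i\<le>n. of_nat (n choose i) * f (Suc i)) + (\<Sum>i\<le>n. of_nat (n choose Suc i) * f (Suc i))"
    by (simp add: distrib_right sum.distrib)
  also have "f 0 + ((\<Sum>i\<le>n. of_nat (n choose i) * f (Suc i)) + (\<Sum>i\<le>n. of_nat (n choose Suc i) * f (Suc i))) =
     (\<Sum>i\<le>n. of_nat (n choose i) * f (Suc i)) + (\<Sum>i\<le>Suc n. of_nat (n choose i) * f i)"
    by (simp add: sum.atMost_Suc_shift add_ac del: sum.atMost_Suc)
  also have "(\<Sum>i\<le>Suc n. of_nat (n choose i) * f i) = (\<Sum>i\<le>n. of_nat (n choose i) * f i)"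
    by (simp add: binomial_eq_0)
  finally show ?thesis by (simp add: distrib_left sum.distrib add.commute)
qed

text \<open>
  The total mass of the beta-binomial distribution; Pascal's rule on the left corresponds to
  \<open>B(x + 1, y) + B(x, y + 1) = B(x, y)\<close>.
\<close>

lemma beta_binomial_sum:
  fixes x y :: real
  assumes "0 < x" "0 < y"
  shows "(\<Sum>i\<le>n. real (n choose i) * Beta (x + real i) (y + real (n - i))) = Beta x y"
  using assms
proof (induction n arbitrary: x y)
  case (Suc n)
  have np: "z \<notin> \<int>\<^sub>\<le>\<^sub>0" if "0 < z" for z :: real using that by (auto elim!: nonpos_Ints_cases)
  have "(\<Sum>i\<le>Suc n. real (Suc n choose i) * Beta (x + real i) (y + real (Suc n - i))) =
    (\<Sum>i\<le>n. real (n choose i) * (Beta (x + real i) (y + real (Suc n - i)) + Beta (x + real (Suc i)) (y + real (Suc n - Suc i))))"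
    by (rule sum_binomial_Suc)
  also have "\<dots> = (\<Sum>i\<le>n. real (n choose i) * Beta (x + real i) (y + real (n - i)))"
  proof (intro sum.cong refl)
    fix i assume "i \<in> {..n}"
    then have "y + real (Suc n - i) = y + real (n - i) + 1" by (simp add: Suc_diff_le)
    moreover have "Beta (x + real i + 1) (y + real (n - i)) + Beta (x + real i) (y + real (n - i) + 1) = Beta (x + real i) (y + real (n - i))"
      using Suc.prems by (intro Beta_plus1_plus1 np) auto
    ultimately show "real (n choose i) * (Beta (x + real i) (y + real (Suc n - i)) + Beta (x + real (Suc i)) (y + real (Suc n - Suc i))) =
        real (n choose i) * Beta (x + real i) (y + real (n - i))"
      by (simp add: add_ac)
  qed
  also have "\<dots> = Beta x y" by (rule Suc.IH[OF Suc.prems])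
  finally show ?case .
qed simp

text \<open>
  \<open>(n choose i) (i choose k) = (n choose k) (n - k choose i - k)\<close> reduces the factorial moment to the
  total mass.
\<close>

lemma beta_binomial_factorial_moment:
  fixes x y :: real
  assumes "0 < x" "0 < y" "k \<le> n"
  shows "(\<Sum>i\<le>n. real (n choose i) * real (i choose k) * Beta (x + real i) (y + real (n - i))) = real (n choose k) * Beta (x + real k) y"
proof -
  have "(\<Sum>i\<le>n. real (n choose i) * real (i choose k) * Beta (x + real i) (y + real (n - i))) =
     (\<Sum>i\<in>{k..n}. real (n choose i) * real (i choose k) * Beta (x + real i) (y + real (n - i)))"
    by (rule sum.mono_neutral_right) auto
  also have "\<dots> = (\<Sum>j\<le>n - k. real (n choose (j + k)) * real ((j + k) choose k) * Beta (x + real (j + k)) (y + real (n - (j + k))))"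
    using assms(3) by (intro sum.reindex_bij_witness[of _ "\<lambda>j. j + k" "\<lambda>i. i - k"]) auto
  also have "\<dots> = (\<Sum>j\<le>n - k. real (n choose k) * (real ((n - k) choose j) * Beta (x + real k + real j) (y + real (n - k - j))))"
  proof (intro sum.cong refl)
    fix j assume "j \<in> {..n - k}"
    then have "(n choose (j + k)) * ((j + k) choose k) = (n choose k) * ((n - k) choose j)"
      using choose_mult[of k "j + k" n] assms(3) by simp
    then have "real (n choose (j + k)) * real ((j + k) choose k) = real (n choose k) * real ((n - k) choose j)"
      by (metis of_nat_mult)
    then show "real (n choose (j + k)) * real ((j + k) choose k) * Beta (x + real (j + k)) (y + real (n - (j + k))) =
      real (n choose k) * (real ((n - k) choose j) * Beta (x + real k + real j) (y + real (n - k - j)))"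
      by (simp add: add_ac diff_diff_add)
  qed
  also have "\<dots> = real (n choose k) * Beta (x + real k) y"
    unfolding sum_distrib_left[symmetric] using assms by (subst beta_binomial_sum) auto
  finally show ?thesis .
qed

lemma alternating_binomial_sum_one:
  assumes "1 \<le> n"
  shows "(\<Sum>k=1..n. (-1) ^ Suc k * of_nat (n choose k)) = (1 :: 'a::comm_ring_1)"
proof -
  have "0 = (\<Sum>k\<le>n. (-1) ^ k * of_nat (n choose k) :: 'a)"
    using choose_alternating_sum[of n] assms by simp
  also have "\<dots> = 1 + (\<Sum>k=1..n. (-1) ^ k * of_nat (n choose k))"
    by (simp add: atMost_atLeast0 sum.atLeast_Suc_atMost)
  finally have "(\<Sum>k=1..n. (-1) ^ k * of_nat (n choose k) :: 'a) + 1 = 0" by (simp add: add.commute)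
  from minus_unique[OF this] show ?thesis by (simp add: sum_negf)
qed

context beta_exponent
begin

text \<open>
  The values \<open>G k\<close> at the natural numbers, as reals; thus \<open>\<phi> k = C - g k\<close>.
\<close>

definition g :: "nat \<Rightarrow> real" where "g k = Beta (real k + \<beta> + 2) (\<beta> + 1)"

text \<open>
  The rate at which a block of size \<open>n + 1\<close> splits in such a way that a marked label is left with
  exactly \<open>i\<close> companions, including the trivial splitting \<open>i = n\<close>, whose contribution
  cancels in the generator.
\<close>

definition split_weight :: "nat \<Rightarrow> nat \<Rightarrow> real" where
  "split_weight n i = real (n choose i) * Beta (real i + \<beta> + 2) (real (n - i) + \<beta> + 1)"

text \<open>
  The index is the number of companions: \<open>mean_height n\<close> is the expected height of a leaf in the tree
  on \<open>n + 1\<close> leaves. The formula is found by expanding in the functions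
  \<open>i \<mapsto> (i choose k)\<close>, the eigenfunctions of averaging over a splitting.
\<close>

definition mean_height :: "nat \<Rightarrow> real" where
  "mean_height n = (\<Sum>k=1..n. (-1) ^ Suc k * real (n choose k) / (C - g k))"

lemma g_0: "g 0 = C" by (simp add: g_def C_def)

lemma phi_of_nat: "1 \<le> k \<Longrightarrow> phi \<beta> (of_nat k) = of_real (C - g k)"
  and g_less: "1 \<le> k \<Longrightarrow> g k < C"
proof -
  assume k: "1 \<le> k"
  have "complex_of_real (LBINT x:{0<..}. exp (- real k * x) * levy x) = of_real (g k)"
    using levy_laplace_real(2)[of "real k"] G_of_real[of "real k"] by (simp add: g_def)
  then have "(LBINT x:{0<..}. exp (- real k * x) * levy x) = g k" by (simp only: of_real_eq_iff)
  then show "phi \<beta> (of_nat k) = of_real (C - g k)" "g k < C"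
    using phi_of_real[of "real k"] k by auto
qed

lemma split_weight_nonneg: "0 \<le> split_weight n i"
  unfolding split_weight_def Beta_def using \<beta>_pos
  by (intro mult_nonneg_nonneg divide_nonneg_nonneg Gamma_real_nonneg) auto

lemma split_weight_factorial_moment:
  assumes "k \<le> n"
  shows "(\<Sum>i\<le>n. split_weight n i * real (i choose k)) = real (n choose k) * g k"
proof -
  have "(\<Sum>i\<le>n. split_weight n i * real (i choose k)) =
    (\<Sum>i\<le>n. real (n choose i) * real (i choose k) * Beta ((\<beta> + 2) + real i) ((\<beta> + 1) + real (n - i)))"
    unfolding split_weight_def by (intro sum.cong refl) (simp add: add_ac mult_ac)
  also have "\<dots> = real (n choose k) * Beta ((\<beta> + 2) + real k) (\<beta> + 1)"
    using \<beta>_pos assms by (intro beta_binomial_factorial_moment) auto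
  finally show ?thesis by (simp add: g_def add_ac)
qed

lemma split_weight_sum: "(\<Sum>i\<le>n. split_weight n i) = C"
  using split_weight_factorial_moment[of 0 n] by (simp add: g_0)

lemma mean_height_0: "mean_height 0 = 0" by (simp add: mean_height_def)

lemma mean_height_extend: "i \<le> n \<Longrightarrow> mean_height i = (\<Sum>k=1..n. (-1) ^ Suc k * real (i choose k) / (C - g k))"
  unfolding mean_height_def by (rule sum.mono_neutral_left) auto

text \<open>
  Averaging with \<open>split_weight\<close> has the eigenfunctions \<open>i \<mapsto> (i choose k)\<close> with
  eigenvalues \<open>g k\<close>, and multiplying by \<open>g k\<close> turns \<open>1 / (C - g k)\<close> into
  \<open>C / (C - g k) - 1\<close>. This is the first-step equation of the mean height.
\<close>

lemma split_weight_mean_height: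
  assumes "1 \<le> n"
  shows "(\<Sum>i\<le>n. split_weight n i * mean_height i) = C * mean_height n - 1"
proof -
  have "(\<Sum>i\<le>n. split_weight n i * mean_height i) = (\<Sum>i\<le>n. \<Sum>k=1..n. (-1) ^ Suc k / (C - g k) * (split_weight n i * real (i choose k)))"
    by (intro sum.cong refl) (simp add: mean_height_extend[of _ n] sum_distrib_left mult_ac)
  also have "\<dots> = (\<Sum>k=1..n. (-1) ^ Suc k / (C - g k) * (\<Sum>i\<le>n. split_weight n i * real (i choose k)))"
    unfolding sum_distrib_left by (rule sum.swap)
  also have "\<dots> = (\<Sum>k=1..n. C * ((-1) ^ Suc k * real (n choose k) / (C - g k)) - (-1) ^ Suc k * real (n choose k))"
  proof (intro sum.cong refl)
    fix k assume k: "k \<in> {1..n}"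
    then have "(\<Sum>i\<le>n. split_weight n i * real (i choose k)) = real (n choose k) * g k"
      by (intro split_weight_factorial_moment) auto
    moreover have "C - g k \<noteq> 0" using g_less[of k] k by auto
    ultimately show "(-1) ^ Suc k / (C - g k) * (\<Sum>i\<le>n. split_weight n i * real (i choose k)) =
        C * ((-1) ^ Suc k * real (n choose k) / (C - g k)) - (-1) ^ Suc k * real (n choose k)"
      by (simp add: field_simps)
  qed
  also have "\<dots> = C * mean_height n - 1"
    unfolding sum_subtractf alternating_binomial_sum_one[OF assms] mean_height_def sum_distrib_left ..
  finally show ?thesis .
qed

text \<open>
  Not visible from the alternating sum, but an induction on the first-step equation, in which all weights are
  nonnegative.
\<close>

lemma mean_height_pos: "1 \<le> n \<Longrightarrow> 0 < mean_height n"
proof (induction n rule: less_induct)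
  case (less n)
  have mean_height_nonneg: "0 \<le> mean_height i" if "i < n" for i
    using less.IH[of i] that mean_height_0 by (cases "i = 0") auto
  have "(\<Sum>i\<le>n. split_weight n i * mean_height i) = (\<Sum>i<n. split_weight n i * mean_height i) + g n * mean_height n"
    by (simp add: lessThan_Suc_atMost[symmetric] split_weight_def g_def)
  then have "(C - g n) * mean_height n = 1 + (\<Sum>i<n. split_weight n i * mean_height i)"
    using split_weight_mean_height[OF less.prems] by (simp add: algebra_simps)
  moreover have "0 \<le> (\<Sum>i<n. split_weight n i * mean_height i)"
    by (intro sum_nonneg mult_nonneg_nonneg split_weight_nonneg mean_height_nonneg) auto
  ultimately have "0 < (C - g n) * mean_height n" by simp
  then show ?case using g_less[OF less.prems] by (simp add: zero_less_mult_iff)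
qed

lemma mean_height_nonneg: "0 \<le> mean_height n" using mean_height_pos[of n] mean_height_0 by (cases "n = 0") auto

end

section \<open>The mean height of a leaf: partial fractions\<close>

lemma Beta_nat_partial_fractions:
  fixes x :: complex
  assumes "x \<notin> \<int>\<^sub>\<le>\<^sub>0"
  shows "Beta x (of_nat (Suc n)) = (\<Sum>k\<le>n. (-1) ^ k * of_nat (n choose k) / (of_nat k + x))"
  using assms
proof (induction n arbitrary: x)
  case 0
  have "x \<noteq> 0" using 0 by auto
  then show ?case using Gamma_plus1[of x] 0 Gamma_eq_zero_iff[of x] by (simp add: Beta_def)
next
  case (Suc n)
  have x1: "x + 1 \<notin> \<int>\<^sub>\<le>\<^sub>0" using Suc.prems by (meson plus_one_in_nonpos_Ints_imp)
  have y: "of_nat (Suc n) \<notin> (\<int>\<^sub>\<le>\<^sub>0 :: complex set)" using of_nat_in_nonpos_Ints_iff[of "Suc n"] by auto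
  have "Beta x (of_nat (Suc (Suc n))) = Beta x (of_nat (Suc n)) - Beta (x + 1) (of_nat (Suc n))"
    using Beta_plus1_plus1[OF Suc.prems y] by (simp add: algebra_simps)
  also have "\<dots> = (\<Sum>k\<le>n. of_nat (n choose k) * ((-1) ^ k / (of_nat k + x) + (-1) ^ Suc k / (of_nat (Suc k) + x)))"
    unfolding Suc.IH[OF Suc.prems] Suc.IH[OF x1] sum_subtractf[symmetric]
    by (intro sum.cong refl) (simp add: field_simps add_ac)
  also have "\<dots> = (\<Sum>k\<le>Suc n. of_nat (Suc n choose k) * ((-1) ^ k / (of_nat k + x)))"
    by (rule sum_binomial_Suc[symmetric])
  finally show ?case by (simp add: mult_ac)
qed

text \<open>
  Splitting \<open>(n + 1 choose k)\<close> by Pascal's rule contributes the new term \<open>1 / (n + 1)\<close>,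
  because \<open>(n choose k - 1) / k = (n + 1 choose k) / (n + 1)\<close>.
\<close>

lemma alternating_binomial_sum_harm:
  "(\<Sum>k=1..n. (-1) ^ Suc k * of_nat (n choose k) / of_nat k) = (harm n :: 'a::real_normed_field)"
proof (induction n)
  case (Suc n)
  have "(\<Sum>k=1..Suc n. (-1) ^ Suc k * of_nat (Suc n choose k) / of_nat k :: 'a) =
    (\<Sum>k=1..Suc n. (-1) ^ Suc k * of_nat (n choose k) / of_nat k) + (\<Sum>k=1..Suc n. (-1) ^ Suc k * of_nat (n choose (k - 1)) / of_nat k)"
    unfolding sum.distrib[symmetric]
  proof (intro sum.cong refl)
    fix k assume "k \<in> {1..Suc n}"
    then obtain j where "k = Suc j" by (cases k) auto
    then show "(-1) ^ Suc k * of_nat (Suc n choose k) / of_nat k = (-1) ^ Suc k * of_nat (n choose k) / of_nat k + (-1) ^ Suc k * of_nat (n choose (k - 1)) / (of_nat k :: 'a)"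
      by (simp add: field_simps del: of_nat_Suc)
  qed
  also have "(\<Sum>k=1..Suc n. (-1) ^ Suc k * of_nat (n choose k) / of_nat k) = (harm n :: 'a)"
    using Suc by simp
  also have "(\<Sum>k=1..Suc n. (-1) ^ Suc k * of_nat (n choose (k - 1)) / of_nat k :: 'a) =
    (\<Sum>k=1..Suc n. (-1) ^ Suc k * of_nat (Suc n choose k)) / of_nat (Suc n)"
    unfolding sum_divide_distrib
  proof (intro sum.cong refl)
    fix k assume "k \<in> {1..Suc n}"
    then obtain j where j: "k = Suc j" by (cases k) auto
    have "of_nat (Suc j) * of_nat (Suc n choose Suc j) = (of_nat (Suc n) * of_nat (n choose j) :: 'a)"
      using Suc_times_binomial_eq[of n j] by (metis mult.commute of_nat_mult)
    then show "(-1) ^ Suc k * of_nat (n choose (k - 1)) / of_nat k = (-1) ^ Suc k * of_nat (Suc n choose k) / (of_nat (Suc n) :: 'a)"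
      unfolding j by (simp add: divide_eq_eq eq_divide_eq mult_ac del: of_nat_Suc binomial_Suc_Suc)
  qed
  also have "(\<Sum>k=1..Suc n. (-1) ^ Suc k * of_nat (Suc n choose k) :: 'a) = 1"
    by (rule alternating_binomial_sum_one) simp
  finally show ?case by (simp add: harm_Suc inverse_eq_divide)
qed (simp add: harm_def)

lemma higher_deriv_simple_fractions:
  assumes "Re \<rho> < 0"
  shows "(deriv ^^ j) (\<lambda>r. \<Sum>k\<le>n. a k / (of_nat k - r)) \<rho> = fact j * (\<Sum>k\<le>n. a k / (of_nat k - \<rho>) ^ Suc j)"
  using assms
proof (induction j arbitrary: \<rho>)
  case (Suc j)
  have nz: "of_nat k \<noteq> \<rho>" for k using Suc.prems by (auto simp: complex_eq_iff)
  have op: "open {r. Re r < 0}" by (rule open_halfspace_Re_lt)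
  have "\<forall>\<^sub>F r in nhds \<rho>. r \<in> {r. Re r < 0}" using Suc.prems by (intro eventually_nhds_in_open op) simp
  then have "\<forall>\<^sub>F r in nhds \<rho>. (deriv ^^ j) (\<lambda>r. \<Sum>k\<le>n. a k / (of_nat k - r)) r = fact j * (\<Sum>k\<le>n. a k / (of_nat k - r) ^ Suc j)"
    by eventually_elim (simp add: Suc.IH)
  then have "(deriv ^^ Suc j) (\<lambda>r. \<Sum>k\<le>n. a k / (of_nat k - r)) \<rho> = deriv (\<lambda>r. fact j * (\<Sum>k\<le>n. a k / (of_nat k - r) ^ Suc j)) \<rho>"
    by (simp add: deriv_cong_ev)
  also have "((\<lambda>r. fact j * (\<Sum>k\<le>n. a k / (of_nat k - r) ^ Suc j)) has_field_derivative
      fact j * (\<Sum>k\<le>n. of_nat (Suc j) * (a k / (of_nat k - \<rho>) ^ Suc (Suc j)))) (at \<rho>)"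
  proof (intro DERIV_cmult DERIV_sum)
    fix k
    have "((\<lambda>r. a k * inverse ((of_nat k - r) ^ Suc j)) has_field_derivative a k * (of_nat (Suc j) * (of_nat k - \<rho>) ^ j * inverse (((of_nat k - \<rho>) ^ Suc j) ^ 2))) (at \<rho>)"
      using nz[of k] by (auto intro!: derivative_eq_intros simp: power2_eq_square simp del: of_nat_Suc power_Suc)
    moreover have "a k * (of_nat (Suc j) * (of_nat k - \<rho>) ^ j * inverse (((of_nat k - \<rho>) ^ Suc j) ^ 2)) = of_nat (Suc j) * (a k / (of_nat k - \<rho>) ^ Suc (Suc j))"
    proof -
      define w where "w = of_nat k - \<rho>"
      have "w \<noteq> 0" using nz[of k] by (simp add: w_def)
      then show ?thesis unfolding w_def[symmetric] by (simp add: field_simps power2_eq_square del: of_nat_Suc)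
    qed
    ultimately show "((\<lambda>r. a k / (of_nat k - r) ^ Suc j) has_field_derivative of_nat (Suc j) * (a k / (of_nat k - \<rho>) ^ Suc (Suc j))) (at \<rho>)"
      by (simp add: divide_inverse del: of_nat_Suc power_Suc)
  qed
  then have "deriv (\<lambda>r. fact j * (\<Sum>k\<le>n. a k / (of_nat k - r) ^ Suc j)) \<rho> = fact j * (\<Sum>k\<le>n. of_nat (Suc j) * (a k / (of_nat k - \<rho>) ^ Suc (Suc j)))"
    by (rule DERIV_imp_deriv)
  finally show ?case
    unfolding sum_distrib_left[symmetric] fact_Suc by (simp add: mult.commute mult.left_commute del: of_nat_Suc power_Suc)
qed simp

lemma Re_neg_not_nonpos_Int: "Re \<rho> < 0 \<Longrightarrow> - \<rho> \<notin> \<int>\<^sub>\<le>\<^sub>0"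
  by (auto elim!: nonpos_Ints_cases simp: complex_eq_iff)

context beta_exponent
begin

text \<open>
  Up to sign, the \<open>n\<close>-th difference of \<open>f\<close> at 0.
\<close>

definition alt_sum :: "nat \<Rightarrow> (complex \<Rightarrow> complex) \<Rightarrow> complex" where
  "alt_sum n f = (\<Sum>k\<le>n. (-1) ^ k * of_nat (n choose k) * f (of_nat k))"

lemma alt_sum_split: "(\<Sum>k=1..n. (-1) ^ Suc k * of_nat (n choose k) * f (of_nat k)) = f 0 - alt_sum n f"
  unfolding alt_sum_def by (simp add: atMost_atLeast0 sum.atLeast_Suc_atMost sum_negf)

text \<open>
  By partial fractions \<open>B(-r, n + 1)\<close> is the alternating sum of \<open>1 / (z - r)\<close>, and
  differentiating in \<open>r\<close> raises the order of the pole.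
\<close>

lemma B_term_eq:
  assumes "Re \<rho> < 0"
  shows "B_term \<beta> \<rho> (Suc n) = alt_sum n (principal_part \<beta> \<rho>)"
proof -
  have der: "(deriv ^^ j) (\<lambda>r. Beta (- r) (of_nat (Suc n))) \<rho> = fact j * (\<Sum>k\<le>n. (-1) ^ k * of_nat (n choose k) / (of_nat k - \<rho>) ^ Suc j)" for j
  proof -
    have "\<forall>\<^sub>F r in nhds \<rho>. r \<in> {r. Re r < 0}" using assms by (intro eventually_nhds_in_open open_halfspace_Re_lt) simp
    then have "\<forall>\<^sub>F r in nhds \<rho>. Beta (- r) (of_nat (Suc n)) = (\<Sum>k\<le>n. (-1) ^ k * of_nat (n choose k) / (of_nat k - r))"
      by eventually_elim (use Beta_nat_partial_fractions[OF Re_neg_not_nonpos_Int] in simp)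
    then have "(deriv ^^ j) (\<lambda>r. Beta (- r) (of_nat (Suc n))) \<rho> = (deriv ^^ j) (\<lambda>r. \<Sum>k\<le>n. (-1) ^ k * of_nat (n choose k) / (of_nat k - r)) \<rho>"
      by (rule higher_deriv_cong_ev) simp
    then show ?thesis unfolding higher_deriv_simple_fractions[OF assms] .
  qed
  have "B_term \<beta> \<rho> (Suc n) = (\<Sum>l=1..mult \<beta> \<rho>. \<Sum>k\<le>n. (-1) ^ k * of_nat (n choose k) * (pp_coeff \<beta> \<rho> l / (of_nat k - \<rho>) ^ l))"
    unfolding B_term_def der
  proof (intro sum.cong refl)
    fix l assume "l \<in> {1..mult \<beta> \<rho>}"
    then have l: "Suc (l - 1) = l" by simp
    show "pp_coeff \<beta> \<rho> l / fact (l - 1) * (fact (l - 1) * (\<Sum>k\<le>n. (-1) ^ k * of_nat (n choose k) / (of_nat k - \<rho>) ^ Suc (l - 1))) =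
       (\<Sum>k\<le>n. (-1) ^ k * of_nat (n choose k) * (pp_coeff \<beta> \<rho> l / (of_nat k - \<rho>) ^ l))"
      unfolding l by (simp add: sum_distrib_left mult_ac)
  qed
  also have "\<dots> = (\<Sum>k\<le>n. \<Sum>l=1..mult \<beta> \<rho>. (-1) ^ k * of_nat (n choose k) * (pp_coeff \<beta> \<rho> l / (of_nat k - \<rho>) ^ l))"
    by (rule sum.swap)
  also have "\<dots> = alt_sum n (principal_part \<beta> \<rho>)"
    unfolding alt_sum_def principal_part_def sum_distrib_left ..
  finally show ?thesis .
qed

definition leaf_term :: "nat \<Rightarrow> complex \<Rightarrow> complex" where
  "leaf_term n s = Gamma (- s) * Gamma (of_nat (Suc n)) / (deriv (phi \<beta>) s * Gamma (of_nat (Suc n) - s))"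

lemma leaf_term_eq:
  assumes "s \<in> simple_zeros \<beta>"
  shows "leaf_term n s = alt_sum n (\<lambda>z. 1 / deriv (phi \<beta>) s / (z - s))"
proof -
  have "Re s < 0" using zeros_Re_neg assms by (auto simp: simple_zeros_def)
  from Beta_nat_partial_fractions[OF Re_neg_not_nonpos_Int[OF this], of n]
  have "Gamma (- s) * Gamma (of_nat (Suc n)) / Gamma (of_nat (Suc n) - s) = (\<Sum>k\<le>n. (-1) ^ k * of_nat (n choose k) / (of_nat k - s))"
    by (simp add: Beta_def add.commute[of "- s"] del: of_nat_Suc)
  moreover have "leaf_term n s = 1 / deriv (phi \<beta>) s * (Gamma (- s) * Gamma (of_nat (Suc n)) / Gamma (of_nat (Suc n) - s))"
    unfolding leaf_term_def by simp
  ultimately have "leaf_term n s = 1 / deriv (phi \<beta>) s * (\<Sum>k\<le>n. (-1) ^ k * of_nat (n choose k) / (of_nat k - s))"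
    by (simp only:)
  also have "\<dots> = alt_sum n (\<lambda>z. 1 / deriv (phi \<beta>) s / (z - s))"
    unfolding alt_sum_def sum_distrib_left by (intro sum.cong refl) simp
  finally show ?thesis .
qed

lemma nat_not_zero: "of_nat k \<notin> zeros \<beta>"
  using zeros_Re_neg[of "of_nat k"] by auto

lemma simple_part_at_nat:
  "(\<lambda>s. norm (1 / deriv (phi \<beta>) s / (of_nat k - s))) summable_on simple_zeros \<beta>"
proof -
  have "closed (zeros \<beta>)" by (rule closed_zeros_subset) simp
  then obtain e where e: "0 < e" "cball (of_nat k) e \<subseteq> - zeros \<beta>"
    using nat_not_zero[of k] open_Compl[of "zeros \<beta>"] open_contains_cball[of "- zeros \<beta>"] by auto
  show ?thesis
  proof (rule cauchy_sum_abs_summable[OF residues_abs_summable e(1)])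
    fix s assume "s \<in> simple_zeros \<beta>"
    then have "s \<notin> cball (of_nat k) e" using e(2) by (auto simp: simple_zeros_def)
    then show "e \<le> norm (of_nat k - s)" by (simp add: dist_norm)
  qed
qed

lemma leaf_term_sums:
  shows "(\<lambda>s. norm (leaf_term n s)) summable_on simple_zeros \<beta>"
    and "(\<Sum>\<^sub>\<infinity>s\<in>simple_zeros \<beta>. leaf_term n s) = alt_sum n simple_part"
proof -
  let ?t = "\<lambda>k s. (-1) ^ k * of_nat (n choose k) * (1 / deriv (phi \<beta>) s / (of_nat k - s))"
  have abs: "(\<lambda>s. norm (?t k s)) summable_on simple_zeros \<beta>" for k
    using summable_on_cmult_right[OF simple_part_at_nat, of "norm ((-1) ^ k * of_nat (n choose k) :: complex)" k]
    by (simp only: norm_mult[symmetric])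
  have sm: "((\<lambda>s. ?t k s) has_sum (-1) ^ k * of_nat (n choose k) * simple_part (of_nat k)) (simple_zeros \<beta>)" for k
  proof -
    have "(\<lambda>s. 1 / deriv (phi \<beta>) s / (of_nat k - s)) summable_on simple_zeros \<beta>"
      by (rule abs_summable_summable[OF simple_part_at_nat])
    from has_sum_cmult_right[OF has_sum_infsum[OF this]] show ?thesis
      unfolding simple_part_def cauchy_sum_def .
  qed
  have "((\<lambda>s. \<Sum>k\<in>K. ?t k s) has_sum (\<Sum>k\<in>K. (-1) ^ k * of_nat (n choose k) * simple_part (of_nat k))) (simple_zeros \<beta>)" if "finite K" for K
    using that
  proof (induction K rule: finite_induct)
    case (insert x F)
    show ?case unfolding sum.insert[OF insert.hyps(1,2)] by (rule has_sum_add[OF sm insert.IH])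
  qed simp
  then have "((\<lambda>s. \<Sum>k\<le>n. ?t k s) has_sum alt_sum n simple_part) (simple_zeros \<beta>)"
    unfolding alt_sum_def by simp
  then have "(leaf_term n has_sum alt_sum n simple_part) (simple_zeros \<beta>)"
    by (rule has_sum_cong[THEN iffD1, rotated]) (simp add: leaf_term_eq alt_sum_def)
  then show "(\<Sum>\<^sub>\<infinity>s\<in>simple_zeros \<beta>. leaf_term n s) = alt_sum n simple_part" by (rule infsumI)
  have "(\<lambda>s. \<Sum>k\<in>K. norm (?t k s)) summable_on simple_zeros \<beta>" if "finite K" for K
    using that
  proof (induction K rule: finite_induct)
    case (insert x F)
    show ?case unfolding sum.insert[OF insert.hyps(1,2)] by (rule summable_on_add[OF abs insert.IH])
  qed simp
  then have "(\<lambda>s. \<Sum>k\<le>n. norm (?t k s)) summable_on simple_zeros \<beta>" by simp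
  then show "(\<lambda>s. norm (leaf_term n s)) summable_on simple_zeros \<beta>"
    by (rule summable_on_comparison_test) (auto simp: leaf_term_eq alt_sum_def intro: norm_sum)
qed

text \<open>
  \<open>mean_height n\<close> is an alternating sum of \<open>1 / \<phi> k\<close> over \<open>k \<ge> 1\<close>.
  The constant \<open>1 / C\<close> contributes itself, \<open>1 / (\<mu> k)\<close> the harmonic number, and
  every regular function \<open>f\<close> contributes \<open>f 0\<close> minus its full alternating sum; the
  values at 0 combine to \<open>constant_term\<close>.
\<close>

theorem mean_height_partial_fractions:
  assumes "1 \<le> n"
  shows "of_real (mean_height n) = harm n / mu \<beta> - (deriv ^^ 2) (phi \<beta>) 0 / (2 * (mu \<beta>)\<^sup>2)
     - (\<Sum>\<rho>\<in>exc_zeros \<beta>. B_term \<beta> \<rho> (Suc n)) - (\<Sum>\<^sub>\<infinity>s\<in>simple_zeros \<beta>. leaf_term n s)"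
proof -
  let ?w = "\<lambda>k. (-1) ^ Suc k * of_nat (n choose k) :: complex"
  have "of_real (mean_height n) = (\<Sum>k=1..n. ?w k * (1 / of_real C + 1 / (mu \<beta> * of_nat k) + exc_part (of_nat k) + simple_part (of_nat k)))"
    unfolding mean_height_def of_real_sum
  proof (intro sum.cong refl)
    fix k assume k: "k \<in> {1..n}"
    have "1 / phi \<beta> (of_nat k) = 1 / of_real C + 1 / (mu \<beta> * of_nat k) + exc_part (of_nat k) + simple_part (of_nat k)"
      using k by (intro partial_fractions nat_not_zero) auto
    moreover have "phi \<beta> (of_nat k) = of_real (C - g k)" using k by (intro phi_of_nat) auto
    ultimately show "complex_of_real ((-1) ^ Suc k * real (n choose k) / (C - g k)) =
        ?w k * (1 / of_real C + 1 / (mu \<beta> * of_nat k) + exc_part (of_nat k) + simple_part (of_nat k))"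
      by (metis (no_types, lifting) mult.right_neutral of_real_1 of_real_divide of_real_minus of_real_mult of_real_of_nat_eq of_real_power times_divide_eq_right)
  qed
  also have "\<dots> = (\<Sum>k=1..n. ?w k) * (1 / of_real C) + (\<Sum>k=1..n. ?w k / of_nat k) / mu \<beta> +
      (\<Sum>k=1..n. ?w k * exc_part (of_nat k)) + (\<Sum>k=1..n. ?w k * simple_part (of_nat k))"
    unfolding sum_distrib_right sum_divide_distrib sum.distrib[symmetric]
    by (intro sum.cong refl) (simp add: distrib_left mult.commute)
  also have "(\<Sum>k=1..n. ?w k) = 1" by (rule alternating_binomial_sum_one[OF assms])
  also have "(\<Sum>k=1..n. ?w k / of_nat k) = harm n" by (rule alternating_binomial_sum_harm)
  also have "(\<Sum>k=1..n. ?w k * simple_part (of_nat k)) = simple_part 0 - (\<Sum>\<^sub>\<infinity>s\<in>simple_zeros \<beta>. leaf_term n s)"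
    unfolding alt_sum_split leaf_term_sums(2) ..
  also have "(\<Sum>k=1..n. ?w k * exc_part (of_nat k)) = exc_part 0 - (\<Sum>\<rho>\<in>exc_zeros \<beta>. B_term \<beta> \<rho> (Suc n))"
  proof -
    have "alt_sum n exc_part = (\<Sum>\<rho>\<in>exc_zeros \<beta>. alt_sum n (principal_part \<beta> \<rho>))"
      unfolding alt_sum_def exc_part_def sum_distrib_left by (rule sum.swap)
    also have "\<dots> = (\<Sum>\<rho>\<in>exc_zeros \<beta>. B_term \<beta> \<rho> (Suc n))"
      by (intro sum.cong refl B_term_eq[symmetric] exc_Re_neg)
    finally show ?thesis unfolding alt_sum_split by simp
  qed
  finally have "of_real (mean_height n) = (1 / of_real C + exc_part 0 + simple_part 0) + harm n / mu \<beta>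
      - (\<Sum>\<rho>\<in>exc_zeros \<beta>. B_term \<beta> \<rho> (Suc n)) - (\<Sum>\<^sub>\<infinity>s\<in>simple_zeros \<beta>. leaf_term n s)"
    by simp
  then show ?thesis unfolding constant_term by simp
qed

end

section \<open>Hitting times of finite Markov semigroups\<close>

lemma transition_semigroupD:
  assumes "transition_semigroup S Q p"
  shows "\<And>t x y. 0 \<le> t \<Longrightarrow> x \<in> S \<Longrightarrow> y \<in> S \<Longrightarrow> 0 \<le> p t x y"
    and "\<And>t x. 0 \<le> t \<Longrightarrow> x \<in> S \<Longrightarrow> (\<Sum>y\<in>S. p t x y) = 1"
    and "\<And>x y. x \<in> S \<Longrightarrow> y \<in> S \<Longrightarrow> p 0 x y = of_bool (x = y)"
    and "\<And>s t x y. 0 \<le> s \<Longrightarrow> 0 \<le> t \<Longrightarrow> x \<in> S \<Longrightarrow> y \<in> S \<Longrightarrow> p (s + t) x y = (\<Sum>z\<in>S. p s x z * p t z y)"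
    and "\<And>x y. x \<in> S \<Longrightarrow> y \<in> S \<Longrightarrow> ((\<lambda>t. p t x y) has_real_derivative Q x y) (at_right 0)"
  using assms unfolding transition_semigroup_def by blast+

context
  fixes S :: "'s set" and Q :: "'s \<Rightarrow> 's \<Rightarrow> real" and p :: "real \<Rightarrow> 's \<Rightarrow> 's \<Rightarrow> real"
  assumes fin: "finite S" and ts: "transition_semigroup S Q p"
begin

lemma semigroup_le_one:
  assumes "0 \<le> t" "x \<in> S" "y \<in> S"
  shows "p t x y \<le> 1"
proof -
  have "p t x y \<le> (\<Sum>y\<in>S. p t x y)"
    using assms fin transition_semigroupD(1)[OF ts] by (intro member_le_sum) auto
  then show ?thesis using transition_semigroupD(2)[OF ts] assms by simp
qed

lemma semigroup_at_zero: "x \<in> S \<Longrightarrow> (\<Sum>y\<in>S. p 0 x y * h y) = h x"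
  using fin transition_semigroupD(3)[OF ts] by (simp add: of_bool_def if_distrib[of "\<lambda>c. c * _"] cong: if_cong sum.cong)

lemma semigroup_step:
  assumes "0 \<le> t" "0 \<le> s" "x \<in> S"
  shows "(\<Sum>z\<in>S. p (t + s) x z * h z) - (\<Sum>y\<in>S. p t x y * h y) = (\<Sum>y\<in>S. p t x y * ((\<Sum>z\<in>S. p s y z * h z) - h y))"
proof -
  have "(\<Sum>z\<in>S. p (t + s) x z * h z) = (\<Sum>z\<in>S. \<Sum>y\<in>S. p t x y * (p s y z * h z))"
    using transition_semigroupD(4)[OF ts assms(1,2,3)] by (intro sum.cong refl) (simp add: sum_distrib_right mult.assoc)
  also have "\<dots> = (\<Sum>y\<in>S. \<Sum>z\<in>S. p t x y * (p s y z * h z))" by (rule sum.swap)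
  finally show ?thesis by (simp add: sum_distrib_left right_diff_distrib sum_subtractf)
qed

lemma semigroup_quotient:
  assumes "x \<in> S"
  shows "((\<lambda>s. ((\<Sum>z\<in>S. p s x z * h z) - h x) / s) \<longlongrightarrow> (\<Sum>z\<in>S. Q x z * h z)) (at_right 0)"
proof -
  have "((\<lambda>s. (p s x z - p 0 x z) / s) \<longlongrightarrow> Q x z) (at_right 0)" if "z \<in> S" for z
    using transition_semigroupD(5)[OF ts assms that] by (simp add: has_field_derivative_iff)
  then have "((\<lambda>s. \<Sum>z\<in>S. (p s x z - p 0 x z) / s * h z) \<longlongrightarrow> (\<Sum>z\<in>S. Q x z * h z)) (at_right 0)"
    by (intro tendsto_intros)
  moreover have "(\<Sum>z\<in>S. (p s x z - p 0 x z) / s * h z) = ((\<Sum>z\<in>S. p s x z * h z) - h x) / s" for s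
    using semigroup_at_zero[OF assms, of h]
    by (simp add: left_diff_distrib diff_divide_distrib sum_subtractf sum_divide_distrib[symmetric])
  ultimately show ?thesis by simp
qed

lemma semigroup_tendsto_zero:
  assumes "x \<in> S"
  shows "((\<lambda>s. (\<Sum>z\<in>S. p s x z * h z) - h x) \<longlongrightarrow> 0) (at_right 0)"
proof -
  have "((\<lambda>s. ((\<Sum>z\<in>S. p s x z * h z) - h x) / s * s) \<longlongrightarrow> (\<Sum>z\<in>S. Q x z * h z) * 0) (at_right 0)"
    by (intro tendsto_mult semigroup_quotient[OF assms] tendsto_ident_at)
  then have "((\<lambda>s. ((\<Sum>z\<in>S. p s x z * h z) - h x) / s * s) \<longlongrightarrow> 0) (at_right 0)" by simp
  then show ?thesis by (rule Lim_transform_eventually) (auto simp: eventually_at_filter)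
qed

lemma semigroup_left_continuous:
  assumes "0 < t" "x \<in> S"
  shows "((\<lambda>s. \<Sum>y\<in>S. p (t - s) x y * h y) \<longlongrightarrow> (\<Sum>y\<in>S. p t x y * h y)) (at_right 0)"
proof -
  have "((\<lambda>s. (\<Sum>y\<in>S. p t x y * h y) - (\<Sum>y\<in>S. p (t - s) x y * h y)) \<longlongrightarrow> 0) (at_right 0)"
  proof (rule Lim_null_comparison)
    have "((\<lambda>s. \<Sum>y\<in>S. \<bar>(\<Sum>z\<in>S. p s y z * h z) - h y\<bar>) \<longlongrightarrow> (\<Sum>y\<in>S. \<bar>0\<bar>)) (at_right 0)"
      by (intro tendsto_intros semigroup_tendsto_zero)
    then show "((\<lambda>s. \<Sum>y\<in>S. \<bar>(\<Sum>z\<in>S. p s y z * h z) - h y\<bar>) \<longlongrightarrow> 0) (at_right 0)" by simp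
    have "\<forall>\<^sub>F s in at_right 0. s \<in> {0<..<t}" using assms(1) by (rule eventually_at_right_real)
    then show "\<forall>\<^sub>F s in at_right 0. norm ((\<Sum>y\<in>S. p t x y * h y) - (\<Sum>y\<in>S. p (t - s) x y * h y)) \<le> (\<Sum>y\<in>S. \<bar>(\<Sum>z\<in>S. p s y z * h z) - h y\<bar>)"
    proof eventually_elim
      case (elim s)
      have "(\<Sum>y\<in>S. p t x y * h y) - (\<Sum>y\<in>S. p (t - s) x y * h y) = (\<Sum>y\<in>S. p (t - s) x y * ((\<Sum>z\<in>S. p s y z * h z) - h y))"
        using semigroup_step[of "t - s" s x h] elim assms(2) by simp
      also have "norm \<dots> \<le> (\<Sum>y\<in>S. \<bar>(\<Sum>z\<in>S. p s y z * h z) - h y\<bar>)"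
      proof (rule sum_norm_le)
        fix y assume y: "y \<in> S"
        have "0 \<le> p (t - s) x y" "p (t - s) x y \<le> 1"
          using elim assms(2) y transition_semigroupD(1)[OF ts] semigroup_le_one by auto
        then show "norm (p (t - s) x y * ((\<Sum>z\<in>S. p s y z * h z) - h y)) \<le> \<bar>(\<Sum>z\<in>S. p s y z * h z) - h y\<bar>"
          by (simp add: abs_mult mult_left_le_one_le)
      qed
      finally show ?case .
    qed
  qed
  from tendsto_diff[OF tendsto_const[of "\<Sum>y\<in>S. p t x y * h y"] this] show ?thesis by simp
qed

lemma semigroup_right_derivative:
  assumes "0 \<le> t" "x \<in> S"
  shows "((\<lambda>s. ((\<Sum>y\<in>S. p (t + s) x y * h y) - (\<Sum>y\<in>S. p t x y * h y)) / s) \<longlongrightarrow> (\<Sum>y\<in>S. p t x y * (\<Sum>z\<in>S. Q y z * h z))) (at_right 0)"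
proof -
  have "((\<lambda>s. \<Sum>y\<in>S. p t x y * (((\<Sum>z\<in>S. p s y z * h z) - h y) / s)) \<longlongrightarrow> (\<Sum>y\<in>S. p t x y * (\<Sum>z\<in>S. Q y z * h z))) (at_right 0)"
    by (intro tendsto_intros semigroup_quotient)
  then show ?thesis
  proof (rule Lim_transform_eventually)
    have "\<forall>\<^sub>F s in at_right (0::real). 0 < s" by (rule eventually_at_right_less)
    then show "\<forall>\<^sub>F s in at_right 0. (\<Sum>y\<in>S. p t x y * (((\<Sum>z\<in>S. p s y z * h z) - h y) / s)) =
        ((\<Sum>y\<in>S. p (t + s) x y * h y) - (\<Sum>y\<in>S. p t x y * h y)) / s"
      by eventually_elim (simp add: semigroup_step assms sum_divide_distrib)
  qed
qed

text \<open>
  Kolmogorov's forward equation, tested against \<open>h\<close>. The generator is given as a right derivative at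
  0 only; the left difference quotient at \<open>t\<close> is brought to this form by starting the increment at
  \<open>t - s\<close>, which requires left continuity.
\<close>

lemma semigroup_derivative:
  assumes "0 < t" "x \<in> S"
  shows "((\<lambda>t. \<Sum>y\<in>S. p t x y * h y) has_real_derivative (\<Sum>y\<in>S. p t x y * (\<Sum>z\<in>S. Q y z * h z))) (at t)"
proof -
  define E where "E t = (\<Sum>y\<in>S. p t x y * h y)" for t
  define d where "d = (\<Sum>y\<in>S. p t x y * (\<Sum>z\<in>S. Q y z * h z))"
  have "((\<lambda>y. (E y - E t) / (y - t)) \<longlongrightarrow> d) (at_right t)"
    unfolding filterlim_at_right_to_0[of _ _ t]
    using semigroup_right_derivative[of t x h] assms by (simp add: E_def d_def add.commute)
  moreover have "((\<lambda>y. (E y - E t) / (y - t)) \<longlongrightarrow> d) (at_left t)"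
  proof -
    have "((\<lambda>s. \<Sum>y\<in>S. p (t - s) x y * (((\<Sum>z\<in>S. p s y z * h z) - h y) / s)) \<longlongrightarrow> d) (at_right 0)"
      unfolding d_def
    proof (intro tendsto_sum tendsto_mult semigroup_quotient)
      fix y assume y: "y \<in> S"
      show "((\<lambda>s. p (t - s) x y) \<longlongrightarrow> p t x y) (at_right 0)"
        using semigroup_left_continuous[OF assms, of "\<lambda>z. of_bool (z = y)"] y fin
        by (simp add: of_bool_def if_distrib[of "\<lambda>c. _ * c"] cong: if_cong)
    qed
    then have "((\<lambda>s. (E (t - s) - E t) / (- s)) \<longlongrightarrow> d) (at_right 0)"
    proof (rule Lim_transform_eventually)
      have "\<forall>\<^sub>F s in at_right 0. s \<in> {0<..<t}" using assms(1) by (rule eventually_at_right_real)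
      then show "\<forall>\<^sub>F s in at_right 0. (\<Sum>y\<in>S. p (t - s) x y * (((\<Sum>z\<in>S. p s y z * h z) - h y) / s)) = (E (t - s) - E t) / (- s)"
      proof eventually_elim
        case (elim s)
        have "E t - E (t - s) = (\<Sum>y\<in>S. p (t - s) x y * ((\<Sum>z\<in>S. p s y z * h z) - h y))"
          unfolding E_def using semigroup_step[of "t - s" s x h] elim assms(2) by simp
        then have "(E t - E (t - s)) / s = (\<Sum>y\<in>S. p (t - s) x y * (((\<Sum>z\<in>S. p s y z * h z) - h y) / s))"
          by (simp add: sum_divide_distrib)
        moreover have "(E (t - s) - E t) / (- s) = (E t - E (t - s)) / s" using elim by (simp add: field_simps)
        ultimately show ?case by simp
      qed
    qed
    then show ?thesis
      unfolding filterlim_at_left_to_right[of _ _ t] filterlim_at_right_to_0[of _ _ "- t"]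
      by (simp add: algebra_simps)
  qed
  ultimately have "((\<lambda>y. (E y - E t) / (y - t)) \<longlongrightarrow> d) (at t)"
    by (rule filterlim_split_at[rotated])
  then show ?thesis unfolding has_field_derivative_iff E_def d_def .
qed

lemma semigroup_continuous:
  assumes "x \<in> S"
  shows "continuous_on {0..} (\<lambda>t. \<Sum>y\<in>S. p t x y * h y)"
proof -
  have "continuous (at t within {0..}) (\<lambda>t. \<Sum>y\<in>S. p t x y * h y)" if "t \<in> {0..}" for t
  proof (cases "t = 0")
    case False
    then have "isCont (\<lambda>t. \<Sum>y\<in>S. p t x y * h y) t"
      using semigroup_derivative[of t x h] assms that DERIV_isCont by auto
    then show ?thesis by (rule continuous_at_imp_continuous_at_within)
  next
    case True
    have "((\<lambda>s. ((\<Sum>z\<in>S. p s x z * h z) - h x) + h x) \<longlongrightarrow> 0 + h x) (at_right 0)"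
      by (intro tendsto_add semigroup_tendsto_zero[OF assms] tendsto_const)
    then have "((\<lambda>s. \<Sum>z\<in>S. p s x z * h z) \<longlongrightarrow> h x) (at_right 0)" by simp
    then have "((\<lambda>s. \<Sum>z\<in>S. p s x z * h z) \<longlongrightarrow> (\<Sum>z\<in>S. p 0 x z * h z)) (at 0 within {0..})"
      unfolding semigroup_at_zero[OF assms] at_within_Ici_at_right .
    then show ?thesis unfolding True continuous_within .
  qed
  then show ?thesis by (simp add: continuous_on_eq_continuous_within)
qed

context
  fixes A :: "'s set" and h :: "'s \<Rightarrow> real"
  assumes h_in: "\<And>y. y \<in> S \<Longrightarrow> y \<in> A \<Longrightarrow> h y = 0"
    and h_out: "\<And>y. y \<in> S \<Longrightarrow> y \<notin> A \<Longrightarrow> 0 < h y"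
    and gen: "\<And>y. y \<in> S \<Longrightarrow> (\<Sum>z\<in>S. Q y z * h z) = - of_bool (y \<notin> A)"
begin

lemma hitting_derivative:
  assumes "0 < t" "x \<in> S"
  shows "((\<lambda>t. \<Sum>y\<in>S. p t x y * h y) has_real_derivative - (\<Sum>y\<in>S - A. p t x y)) (at t)"
proof -
  have "(\<Sum>y\<in>S. p t x y * (\<Sum>z\<in>S. Q y z * h z)) = (\<Sum>y\<in>S. if y \<in> S - A then - p t x y else 0)"
    by (intro sum.cong refl) (simp add: gen)
  also have "\<dots> = (\<Sum>y\<in>S - A. - p t x y)"
    using fin by (intro sum.mono_neutral_cong_right) auto
  also have "\<dots> = - (\<Sum>y\<in>S - A. p t x y)" by (rule sum_negf)
  finally show ?thesis using semigroup_derivative[OF assms, of h] by simp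
qed

lemma hitting_nonneg:
  assumes "0 \<le> t" "x \<in> S"
  shows "0 \<le> (\<Sum>y\<in>S. p t x y * h y)" "0 \<le> (\<Sum>y\<in>S - A. p t x y)"
proof -
  have "0 \<le> h y" if "y \<in> S" for y using h_in[OF that] h_out[OF that] by (cases "y \<in> A") auto
  then show "0 \<le> (\<Sum>y\<in>S. p t x y * h y)" "0 \<le> (\<Sum>y\<in>S - A. p t x y)"
    using assms transition_semigroupD(1)[OF ts] by (auto intro!: sum_nonneg mult_nonneg_nonneg)
qed

text \<open>
  With \<open>K\<close> bounding \<open>h\<close>, the expectation of \<open>h\<close> is at most \<open>K\<close>
  times the probability of being outside \<open>A\<close>, and that probability is minus the derivative of the
  expectation; hence exponential decay.
\<close>

lemma hitting_decay:
  obtains K where "0 < K" "\<And>x t. x \<in> S \<Longrightarrow> 0 \<le> t \<Longrightarrow> (\<Sum>y\<in>S. p t x y * h y) \<le> h x * exp (- t / K)"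
proof -
  \<comment> \<open>The summand 1 keeps \<open>K\<close> positive when \<open>h\<close> vanishes on \<open>S\<close>.\<close>
  define K where "K = (\<Sum>y\<in>S. \<bar>h y\<bar>) + 1"
  have K: "0 < K" unfolding K_def by (intro add_nonneg_pos sum_nonneg) auto
  have hK: "h y \<le> K" if "y \<in> S" for y
    using member_le_sum[of y S "\<lambda>y. \<bar>h y\<bar>"] that fin by (simp add: K_def)
  have bound: "(\<Sum>y\<in>S. p t x y * h y) \<le> K * (\<Sum>y\<in>S - A. p t x y)" if "0 \<le> t" "x \<in> S" for t x
  proof -
    have "(\<Sum>y\<in>S. p t x y * h y) = (\<Sum>y\<in>S - A. p t x y * h y)"
      using fin h_in by (intro sum.mono_neutral_right) auto
    also have "\<dots> \<le> (\<Sum>y\<in>S - A. p t x y * K)"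
      using that hK transition_semigroupD(1)[OF ts] by (intro sum_mono mult_left_mono) auto
    finally show ?thesis by (simp add: sum_distrib_left mult.commute)
  qed
  have "(\<Sum>y\<in>S. p t x y * h y) \<le> h x * exp (- t / K)" if x: "x \<in> S" and t: "0 \<le> t" for x t
  proof -
    let ?F = "\<lambda>t. (\<Sum>y\<in>S. p t x y * h y) * exp (t / K)"
    have "?F t \<le> ?F 0"
    proof (rule DERIV_nonpos_imp_decreasing_open[OF t])
      fix s assume s: "0 < s" "s < t"
      have "(?F has_real_derivative (- (\<Sum>y\<in>S - A. p s x y) * exp (s / K) + (\<Sum>y\<in>S. p s x y * h y) * (exp (s / K) * (1 / K)))) (at s)"
      proof -
        have "((\<lambda>t. exp (t / K)) has_real_derivative exp (s / K) * (1 / K)) (at s)"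
          using K by (auto intro!: derivative_eq_intros)
        from DERIV_mult[OF hitting_derivative[OF s(1) x] this] show ?thesis
          by (rule DERIV_cong) simp
      qed
      moreover have "- (\<Sum>y\<in>S - A. p s x y) * exp (s / K) + (\<Sum>y\<in>S. p s x y * h y) * (exp (s / K) * (1 / K)) \<le> 0"
      proof -
        have "(\<Sum>y\<in>S. p s x y * h y) * (1 / K) \<le> (\<Sum>y\<in>S - A. p s x y)"
          using bound[of s x] s x K by (simp add: field_simps)
        then have "((\<Sum>y\<in>S. p s x y * h y) * (1 / K)) * exp (s / K) \<le> (\<Sum>y\<in>S - A. p s x y) * exp (s / K)"
          by (intro mult_right_mono) auto
        then show ?thesis by (simp add: algebra_simps)
      qed
      ultimately show "\<exists>y. (?F has_real_derivative y) (at s) \<and> y \<le> 0" by blast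
    next
      show "continuous_on {0..t} ?F"
        using K by (intro continuous_intros continuous_on_subset[OF semigroup_continuous[OF x]]) auto
    qed
    then have "(\<Sum>y\<in>S. p t x y * h y) * exp (t / K) \<le> h x" using semigroup_at_zero[OF x, of h] by simp
    then show ?thesis by (simp add: exp_minus field_simps)
  qed
  then show thesis using that[OF K] by simp
qed

text \<open>
  Started in \<open>A\<close>, the expectation of \<open>h\<close> stays 0, while \<open>h > 0\<close> outside
  \<open>A\<close>.
\<close>

lemma absorbing:
  assumes "0 \<le> t" "x \<in> S" "x \<in> A" "y \<in> S" "y \<notin> A"
  shows "p t x y = 0"
proof -
  obtain K where K: "0 < K" "\<And>x t. x \<in> S \<Longrightarrow> 0 \<le> t \<Longrightarrow> (\<Sum>y\<in>S. p t x y * h y) \<le> h x * exp (- t / K)"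
    by (rule hitting_decay, rule that)
  from K(2)[OF assms(2,1)] have "(\<Sum>y\<in>S. p t x y * h y) \<le> 0" using h_in assms by simp
  moreover have nn: "0 \<le> p t x z * h z" if "z \<in> S" for z
    using that assms transition_semigroupD(1)[OF ts] h_in[OF that] h_out[OF that] by (cases "z \<in> A") auto
  ultimately have "(\<Sum>y\<in>S. p t x y * h y) = 0" using sum_nonneg[of S "\<lambda>y. p t x y * h y"] by force
  then have "p t x y * h y = 0" using nn fin assms by (simp add: sum_nonneg_eq_0_iff)
  then show ?thesis using h_out assms by force
qed

text \<open>
  The survival probability is minus the derivative of the expectation of \<open>h\<close>, which goes from
  \<open>h x\<close> to 0.
\<close>

lemma expected_hitting_time:
  assumes x: "x \<in> S"
  shows "(\<integral>\<^sup>+t\<in>{0<..}. ennreal (\<Sum>y\<in>S - A. p t x y) \<partial>lborel) = ennreal (h x)"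
proof -
  let ?F = "\<lambda>t. - (\<Sum>y\<in>S. p t x y * h y)" and ?r = "\<lambda>t. \<Sum>y\<in>S - A. p t x y"
  have contr: "isCont ?r t" if "0 < t" for t
  proof -
    have "isCont (\<lambda>t. \<Sum>y\<in>S. p t x y * of_bool (y \<notin> A)) t"
      by (rule DERIV_isCont[OF semigroup_derivative[OF that x]])
    moreover have "(\<Sum>y\<in>S. p t x y * of_bool (y \<notin> A)) = ?r t" for t
      using fin by (intro sum.mono_neutral_cong_right) auto
    ultimately show ?thesis by simp
  qed
  obtain K where K: "0 < K" "\<And>x t. x \<in> S \<Longrightarrow> 0 \<le> t \<Longrightarrow> (\<Sum>y\<in>S. p t x y * h y) \<le> h x * exp (- t / K)"
    by (rule hitting_decay, rule that)
  have lim: "((\<lambda>t. \<Sum>y\<in>S. p t x y * h y) \<longlongrightarrow> 0) at_top"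
  proof (rule tendsto_sandwich[of "\<lambda>_. 0" _ _ "\<lambda>t. h x * exp (- t / K)"])
    show "((\<lambda>t. h x * exp (- t / K)) \<longlongrightarrow> 0) at_top" using K(1) by real_asymp
  qed (use K(2) hitting_nonneg(1) x in \<open>auto intro: eventually_mono[OF eventually_ge_at_top[of 0]]\<close>)
  have lim0: "((\<lambda>t. \<Sum>y\<in>S. p t x y * h y) \<longlongrightarrow> h x) (at_right 0)"
    using tendsto_add[OF semigroup_tendsto_zero[OF x, of h] tendsto_const[of "h x"]] by simp
  have d: "DERIV ?F t :> ?r t" if "0 < ereal t" "ereal t < \<infinity>" for t
    using DERIV_minus[OF hitting_derivative[of t x]] that x by simp
  have c: "isCont ?r t" if "0 < ereal t" "ereal t < \<infinity>" for t using contr that by simp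
  have nn: "AE t in lborel. 0 < ereal t \<longrightarrow> ereal t < \<infinity> \<longrightarrow> 0 \<le> ?r t" using hitting_nonneg(2) x by auto
  have l0: "((?F \<circ> real_of_ereal) \<longlongrightarrow> - h x) (at_right 0)"
    unfolding zero_ereal_def ereal_tendsto_simps1 using tendsto_minus[OF lim0] by (simp add: o_def)
  have l1: "((?F \<circ> real_of_ereal) \<longlongrightarrow> 0) (at_left \<infinity>)"
    unfolding ereal_tendsto_simps1 using tendsto_minus[OF lim] by simp
  have "0 < (\<infinity>::ereal)" by simp
  note FTC = interval_integral_FTC_nonneg[OF this d c nn l0 l1]
  have int: "integrable lborel (\<lambda>t. indicator {0<..} t *\<^sub>R ?r t)"
    using FTC(1) by (simp add: set_integrable_def zero_ereal_def)
  have "(\<integral>\<^sup>+t\<in>{0<..}. ennreal (?r t) \<partial>lborel) = (\<integral>\<^sup>+t. ennreal (indicator {0<..} t *\<^sub>R ?r t) \<partial>lborel)"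
    by (intro nn_integral_cong) (auto simp: indicator_def)
  also have "\<dots> = ennreal (\<integral>t. indicator {0<..} t *\<^sub>R ?r t \<partial>lborel)"
    using hitting_nonneg(2) x by (intro nn_integral_eq_integral int) (auto simp: indicator_def)
  also have "(\<integral>t. indicator {0<..} t *\<^sub>R ?r t \<partial>lborel) = h x"
    using FTC(2) by (simp add: interval_lebesgue_integral_0_infty set_lebesgue_integral_def)
  finally show ?thesis .
qed

end

end

section \<open>The block of a label\<close>

text \<open>
  The union avoids a choice; on partitions it is the one block that contains \<open>i\<close>.
\<close>

definition block_of :: "'l \<Rightarrow> 'l set set \<Rightarrow> 'l set" where
  "block_of i P = \<Union>{b \<in> P. i \<in> b}"

lemma block_of_eq:
  assumes "partition_on A P" "b \<in> P" "i \<in> b"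
  shows "block_of i P = b"
proof -
  have "{c \<in> P. i \<in> c} = {b}"
    using assms partition_onD2[OF assms(1)] by (auto simp: disjoint_def)
  then show ?thesis by (simp add: block_of_def)
qed

lemma block_of_mem:
  assumes "partition_on A P" "i \<in> A"
  shows "block_of i P \<in> P" "i \<in> block_of i P"
proof -
  obtain b where "b \<in> P" "i \<in> b" using assms partition_onD1 by blast
  then show "block_of i P \<in> P" "i \<in> block_of i P" using block_of_eq[OF assms(1)] by auto
qed

lemma finite_partition_blocks: "finite A \<Longrightarrow> partition_on A P \<Longrightarrow> b \<in> P \<Longrightarrow> finite b"
  using partition_onD1[of A P] by (auto intro: finite_subset[of b A])

lemma partition_on_split:
  assumes P: "partition_on A P" and b: "b \<in> P" and a: "a \<subset> b" "a \<noteq> {}"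
  shows "partition_on A (insert a (insert (b - a) (P - {b})))"
proof (rule partition_onI)
  have U: "\<Union>P = A" using partition_onD1[OF P] by simp
  show "\<Union>(insert a (insert (b - a) (P - {b}))) = A" using U a b by blast
  show "{} \<notin> insert a (insert (b - a) (P - {b}))" using a partition_onD3[OF P] by auto
  have disj: "c \<inter> b = {}" if "c \<in> P - {b}" for c
    using that b partition_onD2[OF P] by (auto simp: disjoint_def)
  fix p q assume "p \<in> insert a (insert (b - a) (P - {b}))" "q \<in> insert a (insert (b - a) (P - {b}))" "p \<noteq> q"
  then show "disjnt p q"
    using disj a partition_onD2[OF P] unfolding disjnt_def disjoint_def by blast
qed

lemma block_of_split:
  assumes P: "partition_on A P" and b: "b \<in> P" and a: "a \<subset> b" "a \<noteq> {}" and i: "i \<in> A"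
  shows "block_of i (insert a (insert (b - a) (P - {b}))) = (if i \<in> b then if i \<in> a then a else b - a else block_of i P)"
proof -
  note P' = partition_on_split[OF P b a]
  show ?thesis
  proof (cases "i \<in> b")
    case True
    then show ?thesis using block_of_eq[OF P', of a i] block_of_eq[OF P', of "b - a" i] by auto
  next
    case False
    then have "block_of i P \<in> P - {b}" using block_of_mem[OF P i] by auto
    then show ?thesis using block_of_eq[OF P', of "block_of i P" i] block_of_mem[OF P i] False by auto
  qed
qed

lemma finite_partitions: "finite A \<Longrightarrow> finite {P. partition_on A P}"
  by (rule finite_subset[of _ "Pow (Pow A)"]) (auto dest: partition_onD1)

lemma sum_subsets_by_card:
  fixes f :: "nat \<Rightarrow> real"
  assumes "finite X"
  shows "(\<Sum>c\<in>Pow X. f (card c)) = (\<Sum>j\<le>card X. real (card X choose j) * f j)"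
proof -
  have "(\<Sum>c\<in>Pow X. f (card c)) = (\<Sum>j\<in>{..card X}. \<Sum>c\<in>{c \<in> Pow X. card c = j}. f (card c))"
    using assms by (intro sum.group[symmetric]) (auto intro: card_mono)
  also have "\<dots> = (\<Sum>j\<le>card X. real (card X choose j) * f j)"
  proof (intro sum.cong refl)
    fix j
    have "{c \<in> Pow X. card c = j} = {c. c \<subseteq> X \<and> card c = j}" by auto
    then show "(\<Sum>c\<in>{c \<in> Pow X. card c = j}. f (card c)) = real (card X choose j) * f j"
      using n_subsets[OF assms, of j] by simp
  qed
  finally show ?thesis .
qed

context beta_exponent
begin

definition expected_height :: "'l \<Rightarrow> 'l set set \<Rightarrow> real" where
  "expected_height i P = mean_height (card (block_of i P) - 1)"

lemma split_rate_eq: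
  assumes "finite b" "a \<subset> b" "a \<noteq> {}"
  shows "split_rate \<beta> b a = Beta (real (card a) + \<beta> + 1) (real (card b - card a) + \<beta> + 1) / 2"
proof -
  have ca: "1 \<le> card a" "card a < card b"
    using assms psubset_card_mono[OF assms(1,2)] by (auto simp: Suc_le_eq card_gt_0_iff dest: finite_subset psubset_imp_subset)
  then have "1 \<le> card b - 1" by linarith
  then have "Re (phi \<beta> (of_nat (card b - 1))) \<noteq> 0"
    using phi_of_nat[of "card b - 1"] g_less[of "card b - 1"] by simp
  moreover have "real (card b choose card a) \<noteq> 0" using ca by simp
  ultimately show ?thesis unfolding split_rate_def split_prob_def by simp
qed

text \<open>
  The splittings \<open>(a, b - a)\<close> and \<open>(b - a, a)\<close> have equal rates and the same effect, so
  one may assume that \<open>i\<close> is in the first part, doubling the rate. Writing this part as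
  \<open>insert i c\<close> and counting the \<open>c\<close> by size gives the first-step equation
  \<open>split_weight_mean_height\<close>.
\<close>

lemma split_generator_on_block:
  assumes b: "finite b" "i \<in> b" "2 \<le> card b"
  shows "(\<Sum>a\<in>{a. a \<subset> b \<and> a \<noteq> {}}. split_rate \<beta> b a * (mean_height (card (if i \<in> a then a else b - a) - 1) - mean_height (card b - 1))) = -1"
proof -
  define n where "n = card b - 1"
  define X where "X = b - {i}"
  have X: "finite X" "card X = n" "i \<notin> X" "b = insert i X" using b by (auto simp: X_def n_def)
  have n: "1 \<le> n" "card b = Suc n" using b(3) by (auto simp: n_def)
  define w where "w k = Beta (real k + \<beta> + 1) (real (card b - k) + \<beta> + 1) / 2" for k
  define F where "F a = w (card a) * (mean_height (card (if i \<in> a then a else b - a) - 1) - mean_height n)" for a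
  have fin: "finite {a. a \<subset> b \<and> a \<noteq> {}}" using b(1) by (rule_tac finite_subset[of _ "Pow b"]) auto
  have "(\<Sum>a\<in>{a. a \<subset> b \<and> a \<noteq> {}}. split_rate \<beta> b a * (mean_height (card (if i \<in> a then a else b - a) - 1) - mean_height (card b - 1))) =
     (\<Sum>a\<in>{a. a \<subset> b \<and> a \<noteq> {}}. F a)"
    unfolding F_def w_def n_def by (intro sum.cong refl) (use split_rate_eq[OF b(1)] in auto)
  also have "\<dots> = (\<Sum>a\<in>{a. a \<subset> b \<and> i \<in> a} \<union> {a. a \<subset> b \<and> a \<noteq> {} \<and> i \<notin> a}. F a)"
    by (intro sum.cong) auto
  also have "\<dots> = (\<Sum>a\<in>{a. a \<subset> b \<and> i \<in> a}. F a) + (\<Sum>a\<in>{a. a \<subset> b \<and> a \<noteq> {} \<and> i \<notin> a}. F a)"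
    using fin by (intro sum.union_disjoint) (auto intro: finite_subset[OF _ fin])
  also have "(\<Sum>a\<in>{a. a \<subset> b \<and> a \<noteq> {} \<and> i \<notin> a}. F a) = (\<Sum>a\<in>{a. a \<subset> b \<and> i \<in> a}. F a)"
  proof (rule sum.reindex_bij_witness[of _ "\<lambda>a. b - a" "\<lambda>a. b - a"])
    fix a assume a: "a \<in> {a. a \<subset> b \<and> a \<noteq> {} \<and> i \<notin> a}"
    then have "finite a" "a \<subseteq> b" using b(1) finite_subset by auto
    then have "card (b - a) = card b - card a" "card a \<le> card b"
      using b(1) by (auto simp: card_Diff_subset card_mono)
    then have "w (card (b - a)) = w (card a)" unfolding w_def by (simp add: Beta_commute)
    then show "F (b - a) = F a" using a b(2) by (simp add: F_def double_diff)
  qed (use b(2) in auto)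
  also have "(\<Sum>a\<in>{a. a \<subset> b \<and> i \<in> a}. F a) = (\<Sum>c\<in>Pow X - {X}. F (insert i c))"
    by (rule sum.reindex_bij_witness[of _ "\<lambda>c. insert i c" "\<lambda>a. a - {i}"]) (use X in \<open>auto simp: insert_absorb\<close>)
  also have "\<dots> + \<dots> = (\<Sum>c\<in>Pow X - {X}. 2 * w (Suc (card c)) * (mean_height (card c) - mean_height n))"
    unfolding sum.distrib[symmetric]
  proof (intro sum.cong refl)
    fix c assume "c \<in> Pow X - {X}"
    then have "card (insert i c) = Suc (card c)" using X finite_subset by (subst card_insert_disjoint) auto
    then show "F (insert i c) + F (insert i c) = 2 * w (Suc (card c)) * (mean_height (card c) - mean_height n)"
      by (simp add: F_def)
  qed
  also have "\<dots> = (\<Sum>c\<in>Pow X. 2 * w (Suc (card c)) * (mean_height (card c) - mean_height n))"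
    using X by (intro sum.mono_neutral_left) auto
  also have "\<dots> = (\<Sum>j\<le>n. real (n choose j) * (2 * w (Suc j) * (mean_height j - mean_height n)))"
    using sum_subsets_by_card[OF X(1), of "\<lambda>j. 2 * w (Suc j) * (mean_height j - mean_height n)"] X(2) by simp
  also have "\<dots> = (\<Sum>j\<le>n. split_weight n j * mean_height j - split_weight n j * mean_height n)"
    unfolding w_def split_weight_def n(2) by (intro sum.cong refl) (simp add: add_ac algebra_simps)
  also have "\<dots> = -1"
    unfolding sum_subtractf sum_distrib_right[symmetric] split_weight_sum split_weight_mean_height[OF n(1)] by simp
  finally show ?thesis .
qed

text \<open>
  Only a splitting of the block of \<open>i\<close> changes the value of \<open>expected_height i\<close>. On
  singletons there is none, which makes the set of partitions with \<open>{i}\<close> absorbing.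
\<close>

lemma splitting_gen_expected_height:
  assumes A: "finite A" and P: "partition_on A P" and i: "i \<in> A"
  shows "(\<Sum>P'\<in>{P. partition_on A P}. splitting_gen \<beta> P P' * expected_height i P') = - of_bool ({i} \<notin> P)"
proof -
  let ?S = "{P. partition_on A P}" and ?B = "{b \<in> P. card b \<ge> 2}"
  let ?new = "\<lambda>b a. insert a (insert (b - a) (P - {b}))"
  have finP: "finite P" using A P by (meson finite_elements)
  have finS: "finite ?S" by (rule finite_partitions[OF A])
  have "(\<Sum>P'\<in>?S. splitting_gen \<beta> P P' * expected_height i P') =
    (\<Sum>P'\<in>?S. \<Sum>b\<in>?B. \<Sum>a\<in>{a. a \<subset> b \<and> a \<noteq> {}}. split_rate \<beta> b a * (of_bool (P' = ?new b a) * expected_height i P' - of_bool (P' = P) * expected_height i P'))"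
    unfolding splitting_gen_def sum_distrib_right by (intro sum.cong refl) (simp add: algebra_simps)
  also have "\<dots> = (\<Sum>b\<in>?B. \<Sum>P'\<in>?S. \<Sum>a\<in>{a. a \<subset> b \<and> a \<noteq> {}}. split_rate \<beta> b a * (of_bool (P' = ?new b a) * expected_height i P' - of_bool (P' = P) * expected_height i P'))"
    by (rule sum.swap)
  also have "\<dots> = (\<Sum>b\<in>?B. \<Sum>a\<in>{a. a \<subset> b \<and> a \<noteq> {}}. \<Sum>P'\<in>?S. split_rate \<beta> b a * (of_bool (P' = ?new b a) * expected_height i P' - of_bool (P' = P) * expected_height i P'))"
    by (intro sum.cong refl sum.swap)
  also have "\<dots> = (\<Sum>b\<in>?B. \<Sum>a\<in>{a. a \<subset> b \<and> a \<noteq> {}}. split_rate \<beta> b a * (expected_height i (?new b a) - expected_height i P))"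
  proof (intro sum.cong refl)
    fix b a assume ba: "b \<in> ?B" "a \<in> {a. a \<subset> b \<and> a \<noteq> {}}"
    have delta: "(\<Sum>P'\<in>?S. of_bool (P' = R) * expected_height i P') = expected_height i R" if "partition_on A R" for R
      using finS that by (simp add: of_bool_def if_distrib[of "\<lambda>c. c * _"] cong: if_cong)
    have "partition_on A (?new b a)" using ba by (intro partition_on_split[OF P]) auto
    then show "(\<Sum>P'\<in>?S. split_rate \<beta> b a * (of_bool (P' = ?new b a) * expected_height i P' - of_bool (P' = P) * expected_height i P')) =
        split_rate \<beta> b a * (expected_height i (?new b a) - expected_height i P)"
      using delta[of "?new b a"] delta[OF P] unfolding sum_distrib_left[symmetric] sum_subtractf by simp
  qed
  also have "\<dots> = (\<Sum>b\<in>?B. if b = block_of i P then - 1 else 0)"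
  proof (intro sum.cong refl)
    fix b assume b: "b \<in> ?B"
    have fb: "finite b" using finite_partition_blocks[OF A P] b by auto
    have new: "expected_height i (?new b a) = (if i \<in> b then mean_height (card (if i \<in> a then a else b - a) - 1) else expected_height i P)"
      if "a \<in> {a. a \<subset> b \<and> a \<noteq> {}}" for a
      using that b block_of_split[OF P _ _ _ i, of b a] by (simp add: expected_height_def)
    show "(\<Sum>a\<in>{a. a \<subset> b \<and> a \<noteq> {}}. split_rate \<beta> b a * (expected_height i (?new b a) - expected_height i P)) = (if b = block_of i P then - 1 else 0)"
    proof (cases "i \<in> b")
      case True
      then have blk: "block_of i P = b" using block_of_eq[OF P] b by auto
      have "(\<Sum>a\<in>{a. a \<subset> b \<and> a \<noteq> {}}. split_rate \<beta> b a * (expected_height i (?new b a) - expected_height i P)) =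
        (\<Sum>a\<in>{a. a \<subset> b \<and> a \<noteq> {}}. split_rate \<beta> b a * (mean_height (card (if i \<in> a then a else b - a) - 1) - mean_height (card b - 1)))"
        using True by (intro sum.cong refl) (simp add: new expected_height_def[of i P] blk)
      also have "\<dots> = -1" using split_generator_on_block[OF fb True] b by simp
      finally show ?thesis using blk by simp
    next
      case False
      then have "b \<noteq> block_of i P" using block_of_mem[OF P i] by auto
      moreover have "(\<Sum>a\<in>{a. a \<subset> b \<and> a \<noteq> {}}. split_rate \<beta> b a * (expected_height i (?new b a) - expected_height i P)) = 0"
        using False by (intro sum.neutral ballI) (simp add: new)
      ultimately show ?thesis by simp
    qed
  qed
  also have "\<dots> = - of_bool ({i} \<notin> P)"
  proof -
    have blk: "block_of i P \<in> P" "i \<in> block_of i P" using block_of_mem[OF P i] by auto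
    have fb: "finite (block_of i P)" using finite_partition_blocks[OF A P blk(1)] .
    have "block_of i P \<in> ?B \<longleftrightarrow> {i} \<notin> P"
    proof
      assume "block_of i P \<in> ?B"
      then show "{i} \<notin> P" using block_of_eq[OF P, of "{i}" i] by auto
    next
      assume "{i} \<notin> P"
      then have "block_of i P \<noteq> {i}" using blk by auto
      then have "{i} \<subset> block_of i P" using blk by auto
      then have "card {i} < card (block_of i P)" using fb by (intro psubset_card_mono)
      then show "block_of i P \<in> ?B" using blk by simp
    qed
    then show ?thesis using finP by (simp add: sum.delta)
  qed
  finally show ?thesis .
qed

lemma expected_height_singleton:
  assumes "partition_on A P" "{i} \<in> P"
  shows "expected_height i P = 0"
  using block_of_eq[OF assms, of i] by (simp add: expected_height_def mean_height_0)

lemma expected_height_pos: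
  assumes "finite A" "partition_on A P" "i \<in> A" "{i} \<notin> P"
  shows "0 < expected_height i P"
proof -
  have blk: "block_of i P \<in> P" "i \<in> block_of i P" using block_of_mem[OF assms(2,3)] by auto
  have "finite (block_of i P)" using finite_partition_blocks[OF assms(1,2) blk(1)] .
  moreover have "{i} \<subset> block_of i P" using blk assms(4) by auto
  ultimately have "card {i} < card (block_of i P)" by (rule psubset_card_mono)
  then show ?thesis unfolding expected_height_def by (intro mean_height_pos) simp
qed

end

section \<open>Mean of a random time from its tail\<close>

text \<open>
  If the infimum of a set of times is less than \<open>t\<close>, then some time before \<open>t\<close> belongs
  to the set; if it equals \<open>t\<close>, nothing can be concluded. The formula with \<open><\<close> and with
  \<open>\<le>\<close> makes it possible to ignore this case.
\<close>

lemma ennreal_eq_lebesgue_below: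
  "(\<integral>\<^sup>+t\<in>{0<..}. of_bool (ennreal t < c) \<partial>lborel) = c" (is ?below)
  "(\<integral>\<^sup>+t\<in>{0<..}. of_bool (ennreal t \<le> c) \<partial>lborel) = c" (is ?upto)
proof -
  have len: "emeasure lborel A = c" if "c = ennreal x" "0 \<le> x" "{0<..<x} \<subseteq> A" "A \<subseteq> {0<..x}" "A \<in> sets borel" for A x
  proof (rule antisym)
    have "emeasure lborel A \<le> emeasure lborel {0<..x}" using that by (intro emeasure_mono) auto
    then show "emeasure lborel A \<le> c" using that by simp
    have "emeasure lborel {0<..<x} \<le> emeasure lborel A" using that by (intro emeasure_mono) auto
    then show "c \<le> emeasure lborel A" using that by simp
  qed
  have ind: "(\<integral>\<^sup>+t\<in>{0<..}. of_bool (P t) \<partial>lborel) = emeasure lborel {t. 0 < t \<and> P t}"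
    if "{t. 0 < t \<and> P t} \<in> sets borel" for P :: "real \<Rightarrow> bool"
  proof -
    have "(\<integral>\<^sup>+t\<in>{0<..}. of_bool (P t) \<partial>lborel) = (\<integral>\<^sup>+t. indicator {t. 0 < t \<and> P t} t \<partial>lborel)"
      by (intro nn_integral_cong) (auto simp: indicator_def)
    then show ?thesis using that by simp
  qed
  have m: "{t. 0 < t \<and> ennreal t < c} \<in> sets borel" "{t. 0 < t \<and> ennreal t \<le> c} \<in> sets borel"
    by measurable
  have "emeasure lborel {t. 0 < t \<and> ennreal t < c} = c \<and> emeasure lborel {t. 0 < t \<and> ennreal t \<le> c} = c"
  proof (cases c)
    case (real x)
    then show ?thesis
      using m by (intro conjI len[of x]) (auto simp: ennreal_less_iff ennreal_le_iff)
  next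
    case top
    have "{t. 0 < t \<and> ennreal t < c} = {0::real<..}" "{t. 0 < t \<and> ennreal t \<le> c} = {0::real<..}"
      using top by auto
    moreover have "emeasure lborel {0::real<..} = \<infinity>"
    proof -
      have "of_nat m \<le> emeasure lborel {0::real<..}" for m
      proof -
        have "emeasure lborel {0<..real m} \<le> emeasure lborel {0::real<..}" by (rule emeasure_mono) auto
        then show ?thesis by (simp add: ennreal_of_nat_eq_real_of_nat)
      qed
      then have "(SUP m. of_nat m :: ennreal) \<le> emeasure lborel {0::real<..}" by (rule SUP_least)
      then show ?thesis unfolding ennreal_SUP_of_nat_eq_top by (simp add: top_unique)
    qed
    ultimately show ?thesis using top by simp
  qed
  then show ?below ?upto using ind m by auto
qed

lemma nn_integral_tail:
  assumes "prob_space M" and [measurable]: "T \<in> borel_measurable M"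
  shows "(\<integral>\<^sup>+\<omega>. T \<omega> \<partial>M) = (\<integral>\<^sup>+t\<in>{0<..}. emeasure M {\<omega> \<in> space M. ennreal t < T \<omega>} \<partial>lborel)"
    and "(\<integral>\<^sup>+\<omega>. T \<omega> \<partial>M) = (\<integral>\<^sup>+t\<in>{0<..}. emeasure M {\<omega> \<in> space M. ennreal t \<le> T \<omega>} \<partial>lborel)"
proof -
  interpret prob_space M by fact
  interpret pair_sigma_finite M "lborel :: real measure" ..
  have fub: "(\<integral>\<^sup>+\<omega>. (\<integral>\<^sup>+t. of_bool (P \<omega> t) * indicator {0<..} t \<partial>lborel) \<partial>M) = (\<integral>\<^sup>+t\<in>{0<..}. emeasure M {\<omega> \<in> space M. P \<omega> t} \<partial>lborel)"
    if [measurable]: "Measurable.pred (M \<Otimes>\<^sub>M borel) (\<lambda>(\<omega>, t). P \<omega> t)" for P :: "'a \<Rightarrow> real \<Rightarrow> bool"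
  proof -
    have m: "(\<lambda>(\<omega>, t). of_bool (P \<omega> t) * indicator {0<..} t :: ennreal) \<in> borel_measurable (M \<Otimes>\<^sub>M lborel)"
      by measurable
    have "(\<integral>\<^sup>+\<omega>. (\<integral>\<^sup>+t. of_bool (P \<omega> t) * indicator {0<..} t \<partial>lborel) \<partial>M) =
      (\<integral>\<^sup>+t. (\<integral>\<^sup>+\<omega>. of_bool (P \<omega> t) * indicator {0<..} t \<partial>M) \<partial>lborel)"
      by (rule Fubini'[OF m, symmetric])
    also have "\<dots> = (\<integral>\<^sup>+t\<in>{0<..}. emeasure M {\<omega> \<in> space M. P \<omega> t} \<partial>lborel)"
    proof (intro nn_integral_cong)
      fix t :: real
      have [measurable]: "Measurable.pred M (\<lambda>\<omega>. P \<omega> t)" by measurable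
      have "(\<integral>\<^sup>+\<omega>. of_bool (P \<omega> t) * indicator {0<..} t \<partial>M) = (\<integral>\<^sup>+\<omega>. indicator {0<..} t * indicator {\<omega> \<in> space M. P \<omega> t} \<omega> \<partial>M)"
        by (intro nn_integral_cong) (auto simp: indicator_def)
      also have "\<dots> = indicator {0<..} t * emeasure M {\<omega> \<in> space M. P \<omega> t}"
        by (rule nn_integral_cmult_indicator) measurable
      finally show "(\<integral>\<^sup>+\<omega>. of_bool (P \<omega> t) * indicator {0<..} t \<partial>M) = emeasure M {\<omega> \<in> space M. P \<omega> t} * indicator {0<..} t"
        by (simp add: mult.commute)
    qed
    finally show ?thesis .
  qed
  have "(\<integral>\<^sup>+\<omega>. T \<omega> \<partial>M) = (\<integral>\<^sup>+\<omega>. (\<integral>\<^sup>+t. of_bool (ennreal t < T \<omega>) * indicator {0<..} t \<partial>lborel) \<partial>M)"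
    unfolding ennreal_eq_lebesgue_below(1) ..
  also have "\<dots> = (\<integral>\<^sup>+t\<in>{0<..}. emeasure M {\<omega> \<in> space M. ennreal t < T \<omega>} \<partial>lborel)"
    by (rule fub) measurable
  finally show "(\<integral>\<^sup>+\<omega>. T \<omega> \<partial>M) = (\<integral>\<^sup>+t\<in>{0<..}. emeasure M {\<omega> \<in> space M. ennreal t < T \<omega>} \<partial>lborel)" .
  have "(\<integral>\<^sup>+\<omega>. T \<omega> \<partial>M) = (\<integral>\<^sup>+\<omega>. (\<integral>\<^sup>+t. of_bool (ennreal t \<le> T \<omega>) * indicator {0<..} t \<partial>lborel) \<partial>M)"
    unfolding ennreal_eq_lebesgue_below(2) ..
  also have "\<dots> = (\<integral>\<^sup>+t\<in>{0<..}. emeasure M {\<omega> \<in> space M. ennreal t \<le> T \<omega>} \<partial>lborel)"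
    by (rule fub) measurable
  finally show "(\<integral>\<^sup>+\<omega>. T \<omega> \<partial>M) = (\<integral>\<^sup>+t\<in>{0<..}. emeasure M {\<omega> \<in> space M. ennreal t \<le> T \<omega>} \<partial>lborel)" .
qed

section \<open>Leaf heights\<close>

lemma markov_chainD:
  assumes "markov_chain M S Q x0 X"
  shows "prob_space M" and "\<And>t. 0 \<le> t \<Longrightarrow> X t \<in> measurable M (count_space S)"
    and "AE \<omega> in M. X 0 \<omega> = x0" and "AE \<omega> in M. \<forall>t\<ge>0. \<forall>\<^sub>F s in at_right t. X s \<omega> = X t \<omega>"
    and "\<exists>p. transition_semigroup S Q p \<and>
        (\<forall>k t x. 0 \<le> t 0 \<and> (\<forall>i<k. t i \<le> t (Suc i)) \<and> (\<forall>i\<le>k. x i \<in> S) \<longrightarrow>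
           measure M {\<omega> \<in> space M. \<forall>i\<le>k::nat. X (t i) \<omega> = x i} =
           measure M {\<omega> \<in> space M. X (t 0) \<omega> = x 0} *
             (\<Prod>i<k. p (t (Suc i) - t i) (x i) (x (Suc i))))"
proof -
  note * = assms[unfolded markov_chain_def]
  note meas = *[THEN conjunct2, THEN conjunct2, THEN conjunct1]
  show "prob_space M" by (rule *[THEN conjunct1])
  show "X t \<in> measurable M (count_space S)" if "0 \<le> t" for t using meas that by simp
  show "AE \<omega> in M. X 0 \<omega> = x0"
    by (rule *[THEN conjunct2, THEN conjunct2, THEN conjunct2, THEN conjunct1])
  show "AE \<omega> in M. \<forall>t\<ge>0. \<forall>\<^sub>F s in at_right t. X s \<omega> = X t \<omega>"
    by (rule *[THEN conjunct2, THEN conjunct2, THEN conjunct2, THEN conjunct2, THEN conjunct1])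
qed (rule assms[unfolded markov_chain_def, THEN conjunct2, THEN conjunct2, THEN conjunct2, THEN conjunct2, THEN conjunct2])

lemma markov_chain_laws:
  assumes mc: "markov_chain M S Q x0 X" and x0: "x0 \<in> S"
  obtains p where "transition_semigroup S Q p"
    and "\<And>t y. 0 \<le> t \<Longrightarrow> y \<in> S \<Longrightarrow> measure M {\<omega> \<in> space M. X t \<omega> = y} = p t x0 y"
    and "\<And>s t x y. 0 \<le> s \<Longrightarrow> s \<le> t \<Longrightarrow> x \<in> S \<Longrightarrow> y \<in> S \<Longrightarrow>
        measure M {\<omega> \<in> space M. X s \<omega> = x \<and> X t \<omega> = y} = measure M {\<omega> \<in> space M. X s \<omega> = x} * p (t - s) x y"
proof -
  interpret prob_space M by (rule markov_chainD(1)[OF mc])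
  from markov_chainD(5)[OF mc] obtain p where pp: "transition_semigroup S Q p \<and>
      (\<forall>k t x. 0 \<le> t 0 \<and> (\<forall>i<k. t i \<le> t (Suc i)) \<and> (\<forall>i\<le>k. x i \<in> S) \<longrightarrow>
      measure M {\<omega> \<in> space M. \<forall>i\<le>k::nat. X (t i) \<omega> = x i} =
      measure M {\<omega> \<in> space M. X (t 0) \<omega> = x 0} * (\<Prod>i<k. p (t (Suc i) - t i) (x i) (x (Suc i))))" ..
  note p = pp[THEN conjunct1] and fdd = pp[THEN conjunct2]
  have two: "measure M {\<omega> \<in> space M. X s \<omega> = x \<and> X t \<omega> = y} = measure M {\<omega> \<in> space M. X s \<omega> = x} * p (t - s) x y"
    if "0 \<le> s" "s \<le> t" "x \<in> S" "y \<in> S" for s t x y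
  proof -
    have "measure M {\<omega> \<in> space M. \<forall>i\<le>1::nat. X (if i = 0 then s else t) \<omega> = (if i = 0 then x else y)} =
      measure M {\<omega> \<in> space M. X s \<omega> = x} * p (t - s) x y"
      using fdd[rule_format, of "\<lambda>i. if i = 0 then s else t" 1 "\<lambda>i. if i = 0 then x else y"] that by simp
    moreover have "(\<forall>i\<le>1::nat. X (if i = 0 then s else t) \<omega> = (if i = 0 then x else y)) \<longleftrightarrow> X s \<omega> = x \<and> X t \<omega> = y" for \<omega>
      by (auto simp: le_Suc_eq)
    ultimately show ?thesis by simp
  qed
  have meas: "{\<omega> \<in> space M. X t \<omega> = y} \<in> events" if "0 \<le> t" "y \<in> S" for t y
  proof -
    have "X t \<in> measurable M (count_space S)" using markov_chainD(2)[OF mc] that by simp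
    from measurable_sets[OF this, of "{y}"] show ?thesis using that by (simp add: vimage_def Int_def conj_commute)
  qed
  have start: "AE \<omega> in M. X 0 \<omega> = x0" by (rule markov_chainD(3)[OF mc])
  have one: "measure M {\<omega> \<in> space M. X t \<omega> = y} = p t x0 y" if t: "0 \<le> t" "y \<in> S" for t y
  proof -
    have "measure M {\<omega> \<in> space M. X 0 \<omega> = x0} = 1"
      using start meas[of 0 x0] x0 by (simp add: prob_Collect_eq_1)
    then have "measure M {\<omega> \<in> space M. X 0 \<omega> = x0 \<and> X t \<omega> = y} = p t x0 y"
      using two[of 0 t x0 y] t x0 by simp
    moreover have "measure M {\<omega> \<in> space M. X 0 \<omega> = x0 \<and> X t \<omega> = y} = measure M {\<omega> \<in> space M. X t \<omega> = y}"
    proof (rule finite_measure_eq_AE)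
      show "AE \<omega> in M. \<omega> \<in> {\<omega> \<in> space M. X 0 \<omega> = x0 \<and> X t \<omega> = y} \<longleftrightarrow> \<omega> \<in> {\<omega> \<in> space M. X t \<omega> = y}"
        using start by eventually_elim auto
      have "{\<omega> \<in> space M. X 0 \<omega> = x0 \<and> X t \<omega> = y} = {\<omega> \<in> space M. X 0 \<omega> = x0} \<inter> {\<omega> \<in> space M. X t \<omega> = y}" by auto
      then show "{\<omega> \<in> space M. X 0 \<omega> = x0 \<and> X t \<omega> = y} \<in> events" using meas[of 0 x0] meas[of t y] x0 t by auto
    qed (rule meas[OF t])
    ultimately show ?thesis by simp
  qed
  show thesis by (rule that[OF p one two])
qed

text \<open>
  A countable set of times suffices to detect the hitting time of a right-constant path, and makes the hitting
  time measurable.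
\<close>

definition rational_times :: "real set" where "rational_times = \<rat> \<inter> {0..}"

lemma countable_rational_times: "countable rational_times"
  unfolding rational_times_def by (intro countable_Int1 countable_rat)

lemma INF_rational_times:
  fixes Y :: "real \<Rightarrow> bool"
  assumes "\<And>t. 0 \<le> t \<Longrightarrow> Y t \<Longrightarrow> \<forall>\<^sub>F s in at_right t. Y s"
  shows "Inf {ennreal t |t. 0 \<le> t \<and> Y t} = (INF q\<in>rational_times. if Y q then ennreal q else \<infinity>)"
proof (rule antisym)
  show "Inf {ennreal t |t. 0 \<le> t \<and> Y t} \<le> (INF q\<in>rational_times. if Y q then ennreal q else \<infinity>)"
    by (rule INF_greatest) (auto simp: rational_times_def intro!: Inf_lower)
  show "(INF q\<in>rational_times. if Y q then ennreal q else \<infinity>) \<le> Inf {ennreal t |t. 0 \<le> t \<and> Y t}"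
  proof (rule Inf_greatest)
    fix z assume "z \<in> {ennreal t |t. 0 \<le> t \<and> Y t}"
    then obtain t where t: "z = ennreal t" "0 \<le> t" "Y t" by auto
    have near: "(INF q\<in>rational_times. if Y q then ennreal q else \<infinity>) \<le> ennreal t + ennreal e" if e: "0 < e" for e
    proof -
      obtain b where b: "t < b" "\<And>s. t < s \<Longrightarrow> s < b \<Longrightarrow> Y s"
        using assms[OF t(2,3)] unfolding eventually_at_right_field by blast
      obtain q where q: "q \<in> \<rat>" "t < q" "q < min b (t + e)"
        using Rats_dense_in_real[of t "min b (t + e)"] b e by auto
      have "(INF q\<in>rational_times. if Y q then ennreal q else \<infinity>) \<le> (if Y q then ennreal q else \<infinity>)"
        using q t by (intro INF_lower) (auto simp: rational_times_def)
      also have "\<dots> \<le> ennreal (t + e)" using q b(2)[of q] by (auto intro!: ennreal_leI)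
      finally show ?thesis using t e by (simp add: ennreal_plus)
    qed
    show "(INF q\<in>rational_times. if Y q then ennreal q else \<infinity>) \<le> z"
      unfolding t(1) by (rule ennreal_le_epsilon, rule near)
  qed
qed

context beta_exponent
begin

text \<open>
  The height exceeds \<open>t\<close> exactly when the label is not yet isolated at time \<open>t\<close>, up to
  null sets and up to the difference between \<open>>\<close> and \<open>\<ge>\<close>, which is invisible after
  integration over \<open>t\<close>. By independence of the label the survival probability averages the
  \<open>n\<close> survival probabilities of fixed labels, each of which integrates to the same mean.
\<close>

theorem expected_leaf_height:
  assumes tree: "beta_splitting_tree \<beta> n M X" and lab: "uniform_label n M X L" and n: "2 \<le> n"
  shows "(\<integral>\<^sup>+\<omega>. leaf_height X L \<omega> \<partial>M) = ennreal (mean_height (n - 1))"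
proof -
  define S where "S = {P. partition_on {1..n} P}"
  define x0 where "x0 = {{1..n}}"
  have mc: "markov_chain M S (splitting_gen \<beta>) x0 X"
    using tree unfolding beta_splitting_tree_def S_def x0_def .
  interpret prob_space M by (rule markov_chainD(1)[OF mc])
  have finS: "finite S" unfolding S_def by (rule finite_partitions) simp
  have x0S: "x0 \<in> S" unfolding S_def x0_def using n by (simp add: partition_on_space)
  obtain p where p: "transition_semigroup S (splitting_gen \<beta>) p"
    and law: "\<And>t y. 0 \<le> t \<Longrightarrow> y \<in> S \<Longrightarrow> prob {\<omega> \<in> space M. X t \<omega> = y} = p t x0 y"
    and law2: "\<And>s t x y. 0 \<le> s \<Longrightarrow> s \<le> t \<Longrightarrow> x \<in> S \<Longrightarrow> y \<in> S \<Longrightarrow>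
        prob {\<omega> \<in> space M. X s \<omega> = x \<and> X t \<omega> = y} = prob {\<omega> \<in> space M. X s \<omega> = x} * p (t - s) x y"
    by (rule markov_chain_laws[OF mc x0S], rule that) (assumption | simp)+
  have Xmeas: "X t \<in> measurable M (count_space S)" if "0 \<le> t" for t using markov_chainD(2)[OF mc] that by simp
  have XS: "X t \<omega> \<in> S" if "0 \<le> t" "\<omega> \<in> space M" for t \<omega>
    using measurable_space[OF Xmeas[OF that(1)] that(2)] by simp
  have Lmeas: "L \<in> measurable M (count_space {1..n})" using lab by (simp add: uniform_label_def)
  have LN: "L \<omega> \<in> {1..n}" if "\<omega> \<in> space M" for \<omega> using measurable_space[OF Lmeas that] by simp
  have Xev: "{\<omega> \<in> space M. X t \<omega> \<in> B} \<in> events" if "0 \<le> t" for t B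
  proof -
    have "{\<omega> \<in> space M. X t \<omega> \<in> B} = X t -` (B \<inter> S) \<inter> space M" using XS[OF that] by auto
    then show ?thesis using measurable_sets[OF Xmeas[OF that], of "B \<inter> S"] by simp
  qed
  have Lev: "{\<omega> \<in> space M. L \<omega> = i} \<in> events" for i
  proof -
    have "{\<omega> \<in> space M. L \<omega> = i} = L -` ({i} \<inter> {1..n}) \<inter> space M" using LN by auto
    then show ?thesis using measurable_sets[OF Lmeas, of "{i} \<inter> {1..n}"] by simp
  qed
  have Aev: "{\<omega> \<in> space M. {L \<omega>} \<in> X t \<omega>} \<in> events" "{\<omega> \<in> space M. {L \<omega>} \<notin> X t \<omega>} \<in> events" if "0 \<le> t" for t
  proof -
    have *: "{\<omega> \<in> space M. {L \<omega>} \<in> X t \<omega>} = (\<Union>i\<in>{1..n}. {\<omega> \<in> space M. L \<omega> = i} \<inter> {\<omega> \<in> space M. X t \<omega> \<in> {P. {i} \<in> P}})"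
      using LN by auto
    show **: "{\<omega> \<in> space M. {L \<omega>} \<in> X t \<omega>} \<in> events"
      unfolding * by (intro sets.finite_UN sets.Int Lev Xev[OF that]) simp
    have "{\<omega> \<in> space M. {L \<omega>} \<notin> X t \<omega>} = space M - {\<omega> \<in> space M. {L \<omega>} \<in> X t \<omega>}" by auto
    then show "{\<omega> \<in> space M. {L \<omega>} \<notin> X t \<omega>} \<in> events" using ** by auto
  qed
  define A where "A i = {P. {i} \<in> P}" for i :: nat
  have h_in: "expected_height i y = 0" if "y \<in> S" "y \<in> A i" for i y
    using that expected_height_singleton[of "{1..n}" y i] by (simp add: S_def A_def)
  have h_out: "0 < expected_height i y" if "i \<in> {1..n}" "y \<in> S" "y \<notin> A i" for i y
    using that expected_height_pos[of "{1..n}" y i] by (simp add: S_def A_def)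
  have gen: "(\<Sum>z\<in>S. splitting_gen \<beta> y z * expected_height i z) = - of_bool (y \<notin> A i)" if "i \<in> {1..n}" "y \<in> S" for i y
    using splitting_gen_expected_height[of "{1..n}" y i] that by (simp add: S_def A_def)
  have survive: "(\<integral>\<^sup>+t\<in>{0<..}. ennreal (\<Sum>y\<in>S - A i. p t x0 y) \<partial>lborel) = ennreal (mean_height (n - 1))" if i: "i \<in> {1..n}" for i
  proof -
    have "block_of i x0 = {1..n}"
      using i x0S by (intro block_of_eq[of "{1..n}"]) (auto simp: x0_def S_def)
    then have "expected_height i x0 = mean_height (n - 1)" by (simp add: expected_height_def)
    then show ?thesis
      using expected_hitting_time[OF finS p h_in h_out[OF i] gen[OF i] x0S] by simp
  qed
  have surv_prob: "prob {\<omega> \<in> space M. {i} \<notin> X t \<omega>} = (\<Sum>y\<in>S - A i. p t x0 y)" if "0 \<le> t" for i t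
  proof -
    have "{\<omega> \<in> space M. {i} \<notin> X t \<omega>} = (\<Union>y\<in>S - A i. {\<omega> \<in> space M. X t \<omega> \<in> {y}})"
      using XS[OF that] by (auto simp: A_def)
    also have "prob \<dots> = (\<Sum>y\<in>S - A i. prob {\<omega> \<in> space M. X t \<omega> \<in> {y}})"
    proof (rule finite_measure_finite_Union)
      show "(\<lambda>y. {\<omega> \<in> space M. X t \<omega> \<in> {y}}) ` (S - A i) \<subseteq> events"
        by (rule image_subsetI) (rule Xev[OF that])
    qed (use finS in \<open>auto simp: disjoint_family_on_def\<close>)
    finally show ?thesis using law[OF that] by simp
  qed
  have surv_L: "prob {\<omega> \<in> space M. {L \<omega>} \<notin> X t \<omega>} = (\<Sum>i\<in>{1..n}. (\<Sum>y\<in>S - A i. p t x0 y) / n)" if t: "0 \<le> t" for t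
  proof -
    have indep: "prob ({\<omega> \<in> space M. L \<omega> = i} \<inter> {\<omega> \<in> space M. {i} \<notin> X t \<omega>}) = prob {\<omega> \<in> space M. L \<omega> = i} * prob {\<omega> \<in> space M. {i} \<notin> X t \<omega>}"
      if i: "i \<in> {1..n}" for i
    proof (rule indep_setD)
      show "indep_set {L -` A \<inter> space M |A. A \<in> sets (count_space {1..n})}
         {(\<lambda>\<omega>. \<lambda>t\<in>{0..}. X t \<omega>) -` A \<inter> space M |A. A \<in> sets (PiM {0..} (\<lambda>_. count_space S))}"
        using lab unfolding uniform_label_def S_def by simp
      have "{\<omega> \<in> space M. L \<omega> = i} = L -` {i} \<inter> space M" by auto
      then show "{\<omega> \<in> space M. L \<omega> = i} \<in> {L -` A \<inter> space M |A. A \<in> sets (count_space {1..n})}"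
        using i by (intro CollectI exI[of _ "{i}"] conjI) auto
      have "{f \<in> space (PiM {0..} (\<lambda>_. count_space S)). f t \<in> S - A i} \<in> sets (PiM {0..} (\<lambda>_. count_space S))"
      proof -
        have "(\<lambda>f. f t) \<in> measurable (PiM {0..} (\<lambda>_. count_space S)) (count_space S)"
          using t by (intro measurable_component_singleton) simp
        from measurable_sets[OF this, of "S - A i"] show ?thesis by (simp add: vimage_def Int_def conj_commute)
      qed
      moreover have "{\<omega> \<in> space M. {i} \<notin> X t \<omega>} = (\<lambda>\<omega>. \<lambda>t\<in>{0..}. X t \<omega>) -` {f \<in> space (PiM {0..} (\<lambda>_. count_space S)). f t \<in> S - A i} \<inter> space M"
        using XS t by (auto simp: space_PiM A_def)
      ultimately show "{\<omega> \<in> space M. {i} \<notin> X t \<omega>} \<in> {(\<lambda>\<omega>. \<lambda>t\<in>{0..}. X t \<omega>) -` A \<inter> space M |A. A \<in> sets (PiM {0..} (\<lambda>_. count_space S))}"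
        by blast
    qed
    have probL: "prob {\<omega> \<in> space M. L \<omega> = i} = 1 / n" if i: "i \<in> {1..n}" for i
    proof -
      have "{\<omega> \<in> space M. L \<omega> = i} = L -` {i} \<inter> space M" by auto
      then have "prob {\<omega> \<in> space M. L \<omega> = i} = measure (distr M (count_space {1..n}) L) {i}"
        using i Lmeas by (simp add: measure_distr)
      also have "\<dots> = measure (uniform_count_measure {1..n}) {i}" using lab by (simp add: uniform_label_def)
      also have "\<dots> = 1 / n" using i by (simp add: measure_uniform_count_measure)
      finally show ?thesis .
    qed
    have Xi: "{\<omega> \<in> space M. {i} \<notin> X t \<omega>} \<in> events" for i using Xev[OF t, of "{P. {i} \<notin> P}"] by simp
    have "{\<omega> \<in> space M. {L \<omega>} \<notin> X t \<omega>} = (\<Union>i\<in>{1..n}. {\<omega> \<in> space M. L \<omega> = i} \<inter> {\<omega> \<in> space M. {i} \<notin> X t \<omega>})"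
      using LN by auto
    also have "prob \<dots> = (\<Sum>i\<in>{1..n}. prob ({\<omega> \<in> space M. L \<omega> = i} \<inter> {\<omega> \<in> space M. {i} \<notin> X t \<omega>}))"
      using Lev Xi by (intro finite_measure_finite_Union) (auto simp: disjoint_family_on_def)
    also have "\<dots> = (\<Sum>i\<in>{1..n}. (\<Sum>y\<in>S - A i. p t x0 y) / n)"
      by (intro sum.cong refl) (simp add: indep probL surv_prob[OF t])
    finally show ?thesis .
  qed
  have absorb: "AE \<omega> in M. {L \<omega>} \<in> X s \<omega> \<longrightarrow> {L \<omega>} \<in> X t \<omega>" if st: "0 \<le> s" "s \<le> t" for s t
  proof -
    have "AE \<omega> in M. \<not> (X s \<omega> = x \<and> X t \<omega> = y)" if xy: "i \<in> {1..n}" "x \<in> S \<inter> A i" "y \<in> S - A i" for i x y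
    proof -
      have "p (t - s) x y = 0"
        using absorbing[OF finS p h_in h_out[OF xy(1)] gen[OF xy(1)], of "t - s" x y] st xy by auto
      then have "prob {\<omega> \<in> space M. X s \<omega> = x \<and> X t \<omega> = y} = 0" using law2[of s t x y] st xy by simp
      moreover have "{\<omega> \<in> space M. X s \<omega> = x \<and> X t \<omega> = y} \<in> events"
      proof -
        have "{\<omega> \<in> space M. X s \<omega> = x \<and> X t \<omega> = y} = {\<omega> \<in> space M. X s \<omega> \<in> {x}} \<inter> {\<omega> \<in> space M. X t \<omega> \<in> {y}}" by auto
        then show ?thesis using Xev[of s "{x}"] Xev[of t "{y}"] st by auto
      qed
      ultimately show ?thesis by (simp add: AE_iff_measurable[OF _ refl] emeasure_eq_measure)
    qed
    then have "AE \<omega> in M. \<forall>i\<in>{1..n}. \<forall>x\<in>S \<inter> A i. \<forall>y\<in>S - A i. \<not> (X s \<omega> = x \<and> X t \<omega> = y)"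
      using finS by (intro AE_finite_allI) auto
    then show ?thesis
    proof (rule AE_mp[OF _ AE_I2], intro impI)
      fix \<omega> assume \<omega>: "\<omega> \<in> space M" "\<forall>i\<in>{1..n}. \<forall>x\<in>S \<inter> A i. \<forall>y\<in>S - A i. \<not> (X s \<omega> = x \<and> X t \<omega> = y)" "{L \<omega>} \<in> X s \<omega>"
      have "X s \<omega> \<in> S" "X t \<omega> \<in> S" using XS \<omega>(1) st by auto
      then show "{L \<omega>} \<in> X t \<omega>" using \<omega>(2,3) LN[OF \<omega>(1)] unfolding A_def by blast
    qed
  qed
  \<comment> \<open>A measurable version of the height: almost surely the infimum over all times equals the one over rational times.\<close>
  define T where "T \<omega> = (INF q\<in>rational_times. if {L \<omega>} \<in> X q \<omega> then ennreal q else \<infinity>)" for \<omega>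
  have Tmeas: "T \<in> borel_measurable M"
    unfolding T_def
  proof (rule borel_measurable_INF[OF countable_rational_times])
    fix q assume "q \<in> rational_times"
    then have [measurable]: "Measurable.pred M (\<lambda>\<omega>. {L \<omega>} \<in> X q \<omega>)"
      using Aev(1)[of q] by (simp add: pred_def rational_times_def)
    show "(\<lambda>\<omega>. if {L \<omega>} \<in> X q \<omega> then ennreal q else \<infinity>) \<in> borel_measurable M" by measurable
  qed
  have TT: "AE \<omega> in M. leaf_height X L \<omega> = T \<omega>"
  proof -
    have "AE \<omega> in M. \<forall>t\<ge>0. \<forall>\<^sub>F s in at_right t. X s \<omega> = X t \<omega>" by (rule markov_chainD(4)[OF mc])
    then show ?thesis
    proof eventually_elim
      case (elim \<omega>)
      have "\<forall>\<^sub>F s in at_right t. {L \<omega>} \<in> X s \<omega>" if "0 \<le> t" "{L \<omega>} \<in> X t \<omega>" for t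
        using elim[rule_format, OF that(1)] by eventually_elim (use that in simp)
      from INF_rational_times[of "\<lambda>t. {L \<omega>} \<in> X t \<omega>", OF this]
      show ?case unfolding leaf_height_def T_def .
    qed
  qed
  have upper: "emeasure M {\<omega> \<in> space M. ennreal t < T \<omega>} \<le> emeasure M {\<omega> \<in> space M. {L \<omega>} \<notin> X t \<omega>}" if t: "0 < t" for t
  proof (rule emeasure_mono_AE)
    show "AE \<omega> in M. \<omega> \<in> {\<omega> \<in> space M. ennreal t < T \<omega>} \<longrightarrow> \<omega> \<in> {\<omega> \<in> space M. {L \<omega>} \<notin> X t \<omega>}"
      using TT
    proof eventually_elim
      case (elim \<omega>)
      have "T \<omega> \<le> ennreal t" if "{L \<omega>} \<in> X t \<omega>"
        unfolding elim[symmetric] leaf_height_def using that t by (intro Inf_lower) auto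
      then show ?case by auto
    qed
  qed (rule Aev(2), use t in simp)
  have lower: "emeasure M {\<omega> \<in> space M. {L \<omega>} \<notin> X t \<omega>} \<le> emeasure M {\<omega> \<in> space M. ennreal t \<le> T \<omega>}" if t: "0 < t" for t
  proof (rule emeasure_mono_AE)
    \<comment> \<open>The null set in \<open>absorb\<close> depends on the two times, so only countably many of them may be combined.\<close>
    have "AE \<omega> in M. \<forall>q\<in>rational_times. q \<le> t \<longrightarrow> {L \<omega>} \<in> X q \<omega> \<longrightarrow> {L \<omega>} \<in> X t \<omega>"
      using absorb by (intro AE_ball_countable[THEN iffD2] countable_rational_times ballI AE_impI) (auto simp: rational_times_def)
    then show "AE \<omega> in M. \<omega> \<in> {\<omega> \<in> space M. {L \<omega>} \<notin> X t \<omega>} \<longrightarrow> \<omega> \<in> {\<omega> \<in> space M. ennreal t \<le> T \<omega>}"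
    proof eventually_elim
      case (elim \<omega>)
      have "ennreal t \<le> T \<omega>" if "{L \<omega>} \<notin> X t \<omega>"
        unfolding T_def
      proof (rule INF_greatest)
        fix q assume "q \<in> rational_times"
        then show "ennreal t \<le> (if {L \<omega>} \<in> X q \<omega> then ennreal q else \<infinity>)"
          using elim that by (cases "q \<le> t") (auto intro!: ennreal_leI)
      qed
      then show ?case by auto
    qed
    show "{\<omega> \<in> space M. ennreal t \<le> T \<omega>} \<in> events" using Tmeas by measurable
  qed
  let ?I = "\<integral>\<^sup>+t\<in>{0<..}. emeasure M {\<omega> \<in> space M. {L \<omega>} \<notin> X t \<omega>} \<partial>lborel"
  have "(\<integral>\<^sup>+\<omega>. leaf_height X L \<omega> \<partial>M) = (\<integral>\<^sup>+\<omega>. T \<omega> \<partial>M)" using TT by (rule nn_integral_cong_AE)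
  also have "\<dots> = ?I"
  proof (rule antisym)
    show "(\<integral>\<^sup>+\<omega>. T \<omega> \<partial>M) \<le> ?I"
      unfolding nn_integral_tail(1)[OF prob_space_axioms Tmeas]
      using upper by (intro nn_integral_mono) (auto simp: indicator_def)
    show "?I \<le> (\<integral>\<^sup>+\<omega>. T \<omega> \<partial>M)"
      unfolding nn_integral_tail(2)[OF prob_space_axioms Tmeas]
      using lower by (intro nn_integral_mono) (auto simp: indicator_def)
  qed
  also have "?I = (\<integral>\<^sup>+t. (\<Sum>i\<in>{1..n}. ennreal (1 / n) * (ennreal (\<Sum>y\<in>S - A i. p t x0 y) * indicator {0<..} t)) \<partial>lborel)"
  proof (rule nn_integral_cong)
    fix t :: real
    show "emeasure M {\<omega> \<in> space M. {L \<omega>} \<notin> X t \<omega>} * indicator {0<..} t = (\<Sum>i\<in>{1..n}. ennreal (1 / n) * (ennreal (\<Sum>y\<in>S - A i. p t x0 y) * indicator {0<..} t))"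
    proof (cases "0 < t")
      case True
      have nn: "0 \<le> (\<Sum>y\<in>S - A i. p t x0 y)" for i
        using transition_semigroupD(1)[OF p] True x0S by (intro sum_nonneg) auto
      have "emeasure M {\<omega> \<in> space M. {L \<omega>} \<notin> X t \<omega>} = ennreal (\<Sum>i\<in>{1..n}. (\<Sum>y\<in>S - A i. p t x0 y) / n)"
        using True by (simp add: emeasure_eq_measure surv_L)
      also have "\<dots> = (\<Sum>i\<in>{1..n}. ennreal ((1 / n) * (\<Sum>y\<in>S - A i. p t x0 y)))"
        using nn by (subst sum_ennreal[symmetric]) auto
      also have "\<dots> = (\<Sum>i\<in>{1..n}. ennreal (1 / n) * ennreal (\<Sum>y\<in>S - A i. p t x0 y))"
        using nn by (intro sum.cong refl ennreal_mult) auto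
      finally show ?thesis using True by simp
    qed simp
  qed
  also have "\<dots> = (\<Sum>i\<in>{1..n}. ennreal (1 / n) * (\<integral>\<^sup>+t\<in>{0<..}. ennreal (\<Sum>y\<in>S - A i. p t x0 y) \<partial>lborel))"
  proof -
    have m: "(\<lambda>t. ennreal (\<Sum>y\<in>S - A i. p t x0 y) * indicator {0<..} t) \<in> borel_measurable lborel" for i
    proof -
      have "continuous_on {0<..} (\<lambda>t. \<Sum>y\<in>S. p t x0 y * of_bool (y \<notin> A i))"
        by (rule continuous_on_subset[OF semigroup_continuous[OF finS p x0S]]) auto
      then have "(\<lambda>t. indicator {0<..} t *\<^sub>R (\<Sum>y\<in>S. p t x0 y * of_bool (y \<notin> A i))) \<in> borel_measurable borel"
        by (intro borel_measurable_continuous_on_indicator) auto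
      then have "(\<lambda>t. ennreal (indicator {0<..} t *\<^sub>R (\<Sum>y\<in>S. p t x0 y * of_bool (y \<notin> A i)))) \<in> borel_measurable borel"
        by measurable
      moreover have "(\<Sum>y\<in>S. p t x0 y * of_bool (y \<notin> A i)) = (\<Sum>y\<in>S - A i. p t x0 y)" for t
        using finS by (intro sum.mono_neutral_cong_right) auto
      moreover have "ennreal (indicator {0<..} t *\<^sub>R x) = ennreal x * indicator {0<..} t" for t x :: real
        by (simp add: indicator_def)
      ultimately show ?thesis by simp
    qed
    show ?thesis using m by (simp add: nn_integral_sum nn_integral_cmult)
  qed
  also have "\<dots> = (\<Sum>i\<in>{1..n}. ennreal (1 / n) * ennreal (mean_height (n - 1)))"
    by (intro sum.cong refl) (simp only: survive)
  also have "\<dots> = ennreal (mean_height (n - 1))"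
  proof -
    have "(\<Sum>i\<in>{1..n}. ennreal (1 / n) * ennreal (mean_height (n - 1))) = (\<Sum>i\<in>{1..n}. ennreal ((1 / n) * mean_height (n - 1)))"
      using mean_height_nonneg by (intro sum.cong refl ennreal_mult[symmetric]) auto
    also have "\<dots> = ennreal (\<Sum>i\<in>{1..n}. (1 / n) * mean_height (n - 1))"
      using mean_height_nonneg by (intro sum_ennreal) auto
    also have "(\<Sum>i\<in>{1..n}. (1 / n) * mean_height (n - 1)) = mean_height (n - 1)" using n by simp
    finally show ?thesis .
  qed
  finally show ?thesis .
qed

end

section \<open>Renewal expansion and mean leaf height\<close>

theorem theorem2p9:
  fixes \<beta> :: real
  assumes "\<beta> > 0"
  shows
    "finite (exc_zeros \<beta>) \<and>

     (locally_abs_unif_convergent (\<lambda>s x. exp (s * of_real x) / deriv (phi \<beta>) s)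
        (simple_zeros \<beta>) {0::real<..} \<and>
      (\<forall>x>0. potential_density \<beta> x \<in> \<real> \<and> Re (potential_density \<beta> x) \<ge> 0) \<and>
      (\<forall>(M :: 'a measure) \<xi>. subordinator M \<xi> \<and> has_laplace_exponent M \<xi> (phi \<beta>) \<longrightarrow>
         (\<forall>A\<in>sets borel. potential M \<xi> A =
            ennreal (eta \<beta>) * indicator A 0
            + (\<integral>\<^sup>+x\<in>A \<inter> {0<..}. ennreal (Re (potential_density \<beta> x)) \<partial>lborel)))) \<and>

     (locally_abs_unif_convergent (\<lambda>s z. 1 / (deriv (phi \<beta>) s * (z - s)))
        (simple_zeros \<beta>) (- zeros \<beta>) \<and>
      (\<forall>z. z \<notin> zeros \<beta> \<and> z \<noteq> 0 \<longrightarrow>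
         1 / phi \<beta> z =
           of_real (eta \<beta>) + 1 / (mu \<beta> * z) + (\<Sum>\<rho>\<in>exc_zeros \<beta>. principal_part \<beta> \<rho> z)
           + (\<Sum>\<^sub>\<infinity>s\<in>simple_zeros \<beta>. 1 / (deriv (phi \<beta>) s * (z - s))))) \<and>

     (\<forall>n\<ge>2.
        (\<lambda>s. norm (Gamma (- s) * Gamma (of_nat n) / (deriv (phi \<beta>) s * Gamma (of_nat n - s))))
          summable_on simple_zeros \<beta> \<and>
        (\<forall>(N :: 'b measure) X L. beta_splitting_tree \<beta> n N X \<and> uniform_label n N X L \<longrightarrow>
           (\<integral>\<^sup>+\<omega>. leaf_height X L \<omega> \<partial>N) < \<infinity> \<and>
           of_real (enn2real (\<integral>\<^sup>+\<omega>. leaf_height X L \<omega> \<partial>N)) =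
             harm (n - 1) / mu \<beta> - (deriv ^^ 2) (phi \<beta>) 0 / (2 * (mu \<beta>)\<^sup>2)
             - (\<Sum>\<rho>\<in>exc_zeros \<beta>. B_term \<beta> \<rho> n)
             - (\<Sum>\<^sub>\<infinity>s\<in>simple_zeros \<beta>.
                  Gamma (- s) * Gamma (of_nat n) / (deriv (phi \<beta>) s * Gamma (of_nat n - s)))))"
proof -
  interpret beta_exponent \<beta> by unfold_locales fact
  have density: "\<forall>x>0. potential_density \<beta> x \<in> \<real> \<and> Re (potential_density \<beta> x) \<ge> 0"
  proof (intro allI impI)
    fix x :: real assume "0 < x"
    then show "potential_density \<beta> x \<in> \<real> \<and> Re (potential_density \<beta> x) \<ge> 0"
      using potential_density_nonneg[of x] by simp
  qed
  have potential: "\<forall>(M :: 'a measure) \<xi>. subordinator M \<xi> \<and> has_laplace_exponent M \<xi> (phi \<beta>) \<longrightarrow>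
         (\<forall>A\<in>sets borel. potential M \<xi> A =
            ennreal (eta \<beta>) * indicator A 0
            + (\<integral>\<^sup>+x\<in>A \<inter> {0<..}. ennreal (Re (potential_density \<beta> x)) \<partial>lborel))"
  proof (intro allI impI ballI)
    fix M :: "'a measure" and \<xi> and A :: "real set"
    assume *: "subordinator M \<xi> \<and> has_laplace_exponent M \<xi> (phi \<beta>)" and A: "A \<in> sets borel"
    show "potential M \<xi> A = ennreal (eta \<beta>) * indicator A 0
            + (\<integral>\<^sup>+x\<in>A \<inter> {0<..}. ennreal (Re (potential_density \<beta> x)) \<partial>lborel)"
      by (rule potential_identity[OF *[THEN conjunct1] *[THEN conjunct2] A])
  qed
  have partial: "1 / phi \<beta> z = of_real (eta \<beta>) + 1 / (mu \<beta> * z) + (\<Sum>\<rho>\<in>exc_zeros \<beta>. principal_part \<beta> \<rho> z)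
           + (\<Sum>\<^sub>\<infinity>s\<in>simple_zeros \<beta>. 1 / (deriv (phi \<beta>) s * (z - s)))" if "z \<notin> zeros \<beta>" "z \<noteq> 0" for z
  proof -
    have "(of_real (eta \<beta>) :: complex) = 1 / of_real C" unfolding eta_eq by simp
    then show ?thesis
      using partial_fractions[OF that]
      unfolding exc_part_def simple_part_def cauchy_sum_def divide_divide_eq_left by simp
  qed
  have series: "locally_abs_unif_convergent (\<lambda>s z. 1 / (deriv (phi \<beta>) s * (z - s))) (simple_zeros \<beta>) (- zeros \<beta>)"
    unfolding divide_divide_eq_left[symmetric]
  proof (rule cauchy_sum_locally_abs_unif_convergent[OF residues_abs_summable])
    show "open (- zeros \<beta>)" by (rule open_Compl, rule closed_zeros_subset, rule subset_refl)
    show "s \<notin> - zeros \<beta>" if "s \<in> simple_zeros \<beta>" for s using that zeros_split(1) by simp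
  qed
  have leaf: "(\<lambda>s. norm (Gamma (- s) * Gamma (of_nat n) / (deriv (phi \<beta>) s * Gamma (of_nat n - s))))
          summable_on simple_zeros \<beta> \<and>
        (\<forall>(N :: 'b measure) X L. beta_splitting_tree \<beta> n N X \<and> uniform_label n N X L \<longrightarrow>
           (\<integral>\<^sup>+\<omega>. leaf_height X L \<omega> \<partial>N) < \<infinity> \<and>
           of_real (enn2real (\<integral>\<^sup>+\<omega>. leaf_height X L \<omega> \<partial>N)) =
             harm (n - 1) / mu \<beta> - (deriv ^^ 2) (phi \<beta>) 0 / (2 * (mu \<beta>)\<^sup>2)
             - (\<Sum>\<rho>\<in>exc_zeros \<beta>. B_term \<beta> \<rho> n)
             - (\<Sum>\<^sub>\<infinity>s\<in>simple_zeros \<beta>.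
                  Gamma (- s) * Gamma (of_nat n) / (deriv (phi \<beta>) s * Gamma (of_nat n - s))))"
    if n: "2 \<le> n" for n
  proof -
    have Suc: "Suc (n - 1) = n" and pos: "1 \<le> n - 1" using n by auto
    note leaf_eq = leaf_term_def[of "n - 1", unfolded Suc]
    show ?thesis
    proof (intro conjI allI impI)
      show "(\<lambda>s. norm (Gamma (- s) * Gamma (of_nat n) / (deriv (phi \<beta>) s * Gamma (of_nat n - s))))
          summable_on simple_zeros \<beta>"
        using leaf_term_sums(1)[of "n - 1"] pos unfolding leaf_eq by simp
      fix N :: "'b measure" and X L
      assume *: "beta_splitting_tree \<beta> n N X \<and> uniform_label n N X L"
      have height: "(\<integral>\<^sup>+\<omega>. leaf_height X L \<omega> \<partial>N) = ennreal (mean_height (n - 1))"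
        by (rule expected_leaf_height[OF *[THEN conjunct1] *[THEN conjunct2] n])
      then show "(\<integral>\<^sup>+\<omega>. leaf_height X L \<omega> \<partial>N) < \<infinity>" by simp
      show "of_real (enn2real (\<integral>\<^sup>+\<omega>. leaf_height X L \<omega> \<partial>N)) =
             harm (n - 1) / mu \<beta> - (deriv ^^ 2) (phi \<beta>) 0 / (2 * (mu \<beta>)\<^sup>2)
             - (\<Sum>\<rho>\<in>exc_zeros \<beta>. B_term \<beta> \<rho> n)
             - (\<Sum>\<^sub>\<infinity>s\<in>simple_zeros \<beta>.
                  Gamma (- s) * Gamma (of_nat n) / (deriv (phi \<beta>) s * Gamma (of_nat n - s)))"
        using mean_height_partial_fractions[OF pos] mean_height_nonneg[of "n - 1"]
        unfolding height leaf_eq Suc by simp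
    qed
  qed
  show ?thesis
  proof (intro conjI)
    show "\<forall>z. z \<notin> zeros \<beta> \<and> z \<noteq> 0 \<longrightarrow>
         1 / phi \<beta> z =
           of_real (eta \<beta>) + 1 / (mu \<beta> * z) + (\<Sum>\<rho>\<in>exc_zeros \<beta>. principal_part \<beta> \<rho> z)
           + (\<Sum>\<^sub>\<infinity>s\<in>simple_zeros \<beta>. 1 / (deriv (phi \<beta>) s * (z - s)))"
      by (intro allI impI, rule partial) simp_all
  qed (rule finite_exc_zeros density_series_converges density potential series allI[OF impI[OF leaf]])+
qed

end
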